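(* For $t$ an even positive integer, for any complex number $z$, we have: $$\sum_{\lambda\in \mathcal{SC}}q^{|\lambda|}x^{|\mathcal{H}_t(\lambda)|}b^{\mathrm{BG}(\lambda)}\prod_{h\in\mathcal{H}_t(\lambda)}\left(\frac{1}{h}\,\frac{1+z^h}{1-z^h}\right)^{1/2}=\left(q^{2t};q^{2t}\right)_{\infty}^{t/2}\left(-bq;q^4\right)_{\infty}\left(-q^3/b;q^4\right)_{\infty}\exp\left(\frac{1+z^t}{1-z^t}\,\frac{x^2q^{2t}}{2}+\frac{x^4q^{4t}}{4t}\right).$$
   Context: A partition is a finite nonincreasing sequence $\lambda=(\lambda_1,\dots,\lambda_\ell)$ of positive integers (the empty partition is allowed), and $|\lambda|$ is the sum of its parts. A partition is identified with its Ferrers diagram, the set of boxes $(i,j)$ (row $i$, column $j$) with $1\le j\le\lambda_i$. The conjugate $\lambda'$ is given by $\lambda'_j=\#\{i:\lambda_i\ge j\}$; $\mathcal{SC}$ is the set of self-conjugate partitions ($\lambda=\lambda'$). The hook-length of a box $(i,j)$ is $\lambda_i-j+\lambda'_j-i+1$; $\mathcal{H}_t(\lambda)$ is the multiset of hook-lengths of $\lambda$ divisible by $t$ (cardinality and products are taken with multiplicity; empty products are $1$). The BG-rank is $\mathrm{BG}(\lambda)=\sum_{(i,j)\in\lambda}(-1)^{i+j}$. Also $(a;q)_\infty=\prod_{j\ge0}(1-aq^j)$. *)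

theory Defs
  imports
    "HOL-Library.Multiset"
    "HOL-Computational_Algebra.Formal_Laurent_Series"
    "HOL-Analysis.Infinite_Products"
    "HOL-Analysis.Infinite_Sum"
begin

section \<open>Partitions\<close>

definition is_partition :: "nat list \<Rightarrow> bool" where
  "is_partition \<mu> \<longleftrightarrow> sorted_wrt (\<ge>) \<mu> \<and> (\<forall>p\<in>set \<mu>. p > 0)"

text \<open>The \<open>i\<close>-th part, with \<open>i\<close> counted from 1 and the value 0 beyond the last part.\<close>

definition part :: "nat list \<Rightarrow> nat \<Rightarrow> nat" where
  "part \<mu> i = (if 1 \<le> i \<and> i \<le> length \<mu> then \<mu> ! (i - 1) else 0)"

definition ferrers :: "nat list \<Rightarrow> (nat \<times> nat) set" where
  "ferrers \<mu> = {(i, j). 1 \<le> i \<and> i \<le> length \<mu> \<and> 1 \<le> j \<and> j \<le> part \<mu> i}"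

definition conjugate :: "nat list \<Rightarrow> nat list" where
  "conjugate \<mu> =
     map (\<lambda>j. card {i. 1 \<le> i \<and> i \<le> length \<mu> \<and> part \<mu> i \<ge> j}) [1..<Suc (part \<mu> 1)]"

definition self_conjugate_partitions :: "nat list set" where
  "self_conjugate_partitions = {\<mu>. is_partition \<mu> \<and> conjugate \<mu> = \<mu>}"

text \<open>The hook-length is used only for boxes of the diagram, where neither of the two
  subtractions on \<^typ>\<open>nat\<close> truncates.\<close>

definition hook_length :: "nat list \<Rightarrow> nat \<times> nat \<Rightarrow> nat" where
  "hook_length \<mu> = (\<lambda>(i, j). (part \<mu> i - j) + (part (conjugate \<mu>) j - i) + 1)"

definition hooks_div :: "nat \<Rightarrow> nat list \<Rightarrow> nat multiset" where
  "hooks_div t \<mu> =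
     filter_mset (\<lambda>h. t dvd h) (image_mset (hook_length \<mu>) (mset_set (ferrers \<mu>)))"

definition BG_rank :: "nat list \<Rightarrow> int" where
  "BG_rank \<mu> = (\<Sum>(i, j)\<in>ferrers \<mu>. (-1) ^ (i + j))"


section \<open>Formal power series in \<open>q\<close>\<close>

text \<open>The variables \<open>q\<close>, \<open>x\<close>, \<open>b\<close> are indeterminates. Power series in \<open>q\<close> have their
  coefficients in the field of iterated Laurent series in \<open>x\<close> and then \<open>b\<close>, in which \<open>b\<close> is
  invertible and which contains the Laurent polynomials in \<open>x\<close> and \<open>b\<close>. The topology on
  power series in \<open>q\<close> is the \<open>q\<close>-adic one.\<close>

type_synonym coeff_field = "complex fls fls"

abbreviation scalar :: "complex \<Rightarrow> coeff_field" where
  "scalar c \<equiv> fls_const (fls_const c)"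

abbreviation var_x :: coeff_field where
  "var_x \<equiv> fls_const fls_X"

abbreviation var_b :: coeff_field where
  "var_b \<equiv> fls_X"

abbreviation var_q :: "coeff_field fps" where
  "var_q \<equiv> fps_X"

definition qpoch_inf :: "'a::comm_ring_1 fps \<Rightarrow> 'a fps \<Rightarrow> 'a fps" where
  "qpoch_inf a q = (\<Prod>j. 1 - a * q ^ j)"

text \<open>The exponential of a power series; meaningful for a series with constant term 0.\<close>

definition exp_series :: "'a::field_char_0 fps \<Rightarrow> 'a fps" where
  "exp_series f = fps_exp 1 oo f"

end

theory Submission
  imports Defs "HOL-Computational_Algebra.Polynomial" "HOL-Library.FuncSet"
begin

text \<open>
  Encode a partition by the set \<open>S = {\<lambda>\<^sub>i - i}\<close> of integers (its Maya diagram). Hooks are the pairs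
  of a bead \<open>s \<in> S\<close> and a gap \<open>g \<notin> S\<close> with \<open>g < s\<close>, of length \<open>s - g\<close>, and \<open>\<lambda>\<close> is self-conjugate
  iff \<open>S\<close> is the complement of its image under \<open>m \<mapsto> -1 - m\<close>. Splitting \<open>S\<close> into residue classes
  modulo the even number \<open>t\<close> gives \<open>t\<close> Maya diagrams of arbitrary charge, the last \<open>t/2\<close> of which are
  reflections of the first, and the hooks divisible by \<open>t\<close> are \<open>t\<close> times the hooks of these pieces,
  each occurring twice (which removes the square roots). Hence the generating function is a product
  of \<open>t/2\<close> theta series, which carry the charges and \<open>b\<close>, and the \<open>t/2\<close>-th power of the series
  \<open>\<Sum> C(n) q\<^bsup>2tn\<^esup>\<close>, where \<open>C(n)\<close> sums the hook products over the partitions of \<open>n\<close>.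

  For the weight \<open>(1/h) (1 + w\<^sup>h)/(1 - w\<^sup>h)\<close> one has \<open>n C(n) = (1 + w)/(1 - w) C(n-1) + C(n-2)\<close>.
  This follows from three local identities for adding or removing a box:
  \<open>\<Sum> d(\<lambda>\<^sup>+) = d(\<lambda>)\<close> and \<open>\<Sum> d(\<lambda>\<^sup>-) = |\<lambda>| d(\<lambda>)\<close> for \<open>d(\<lambda>) = \<Prod> 1/h\<close>, and
  \<open>\<Sum> g(\<lambda>\<^sup>+) = (1 + w)/(1 - w) g(\<lambda>) + \<Sum> g(\<lambda>\<^sup>-)\<close> for \<open>g(\<lambda>) = \<Prod> (1 + w\<^sup>h)/(1 - w\<^sup>h)\<close>. All three
  are instances of Lagrange interpolation.
\<close>

section \<open>Partial-fraction identities\<close>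

text \<open>The local identities combine by double counting. In n d(\<lambda>) g(\<lambda>) replace
  n d(\<lambda>) by the sum of d over all removals of a box, regroup by the smaller partition \<mu>,
  and expand the sum of g over the enlargements of \<mu>. This leaves a multiple of d(\<mu>)
  g(\<mu>) and a sum over removals from \<mu>; regrouped again by the smaller partition, the latter
  collapses, because d summed over the enlargements of a partition gives d back.

  The identities are proved for sets of k beads, where a box opening a new row is visible only if
  bead 0 is present. So k must exceed the size, and independence of k has to be shown separately.

  Let \<kappa> = x^2/t be the factor that a doubled hook carries besides the weight, w = z^t and y =
  q^(2t). With \<kappa> included, the recurrence says F' = (\<kappa> (1+w)/(1-w) + \<kappa>^2 y) F
  for the series F in y. Its solution, raised to the power t/2, has the constants 1/2 and 1/(4t) in
  the exponent.\<close>

lemma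
  fixes f :: "'b \<Rightarrow> 'a::field"
  assumes "finite A"
  shows degree_prod_linear: "degree (\<Prod>a\<in>A. [:f a, 1:]) = card A"
    and lead_coeff_prod_linear: "coeff (\<Prod>a\<in>A. [:f a, 1:]) (card A) = 1"
proof -
  show *: "degree (\<Prod>a\<in>A. [:f a, 1:]) = card A"
    by (subst degree_prod_eq_sum_degree) simp_all
  show "coeff (\<Prod>a\<in>A. [:f a, 1:]) (card A) = 1"
    using lead_coeff_prod[of "\<lambda>a. [:f a, 1:]" A] by (simp add: *)
qed

text \<open>The Lagrange interpolant of \<open>p\<close> on \<open>A\<close> has degree below
  \<open>card A\<close>, hence is \<open>p\<close> itself; the sum is its top coefficient.\<close>

lemma lagrange_sum:
  fixes p :: "'a::field poly"
  assumes "finite A" "degree p < card A"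
  shows "(\<Sum>a\<in>A. poly p a / (\<Prod>b\<in>A-{a}. a - b)) = coeff p (card A - 1)"
proof -
  define L where "L = (\<lambda>a. \<Prod>b\<in>A-{a}. [:-b, 1:])"
  define q where "q = (\<Sum>a\<in>A. smult (poly p a / (\<Prod>b\<in>A-{a}. a - b)) (L a))"
  have deg_L: "degree (L a) = card A - 1" if "a \<in> A" for a
    using that assms(1) by (simp add: L_def degree_prod_eq_sum_degree)
  have coeff_L: "coeff (L a) (card A - 1) = 1" if "a \<in> A" for a
    using that assms(1) lead_coeff_prod_linear[of "A - {a}" "\<lambda>b. -b"] by (simp add: L_def)
  have poly_L: "poly (L a) c = (if a = c then (\<Prod>b\<in>A-{a}. a - b) else 0)" if "a \<in> A" "c \<in> A" for a c
    using that assms(1) by (auto simp: L_def poly_prod intro!: prod_zero)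
  have nz: "(\<Prod>b\<in>A-{a}. a - b) \<noteq> 0" for a
    using assms(1) by auto
  have "poly q c = poly p c" if "c \<in> A" for c
  proof -
    have "poly q c = (\<Sum>a\<in>A. if a = c then poly p c else 0)"
      unfolding q_def poly_sum by (intro sum.cong) (use that nz in \<open>auto simp: poly_L\<close>)
    then show ?thesis using that assms(1) by simp
  qed
  moreover have "degree q < card A"
    unfolding q_def
    by (rule degree_sum_less) (use assms deg_L in \<open>auto intro: le_less_trans[OF degree_smult_le]\<close>)
  ultimately have "q = p"
    using assms poly_eqI_degree[of A q p] by auto
  moreover have "coeff q (card A - 1) = (\<Sum>a\<in>A. poly p a / (\<Prod>b\<in>A-{a}. a - b))"
    unfolding q_def coeff_sum by (intro sum.cong) (simp_all only: coeff_smult coeff_L mult_1_right)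
  ultimately show ?thesis by simp
qed

lemma coeff_prod_linear_second:
  fixes f :: "'b \<Rightarrow> 'a::field"
  assumes "finite A" "A \<noteq> {}"
  shows "coeff (\<Prod>a\<in>A. [:- f a, 1:]) (card A - 1) = - (\<Sum>a\<in>A. f a)"
  using assms
proof (induction rule: finite_ne_induct)
  case (insert a A)
  have "coeff (\<Prod>a\<in>A. [:- f a, 1:]) (card A) = 1"
    using insert.hyps by (intro lead_coeff_prod_linear) auto
  moreover obtain m where "card A = Suc m"
    using insert.hyps by (metis card_eq_0_iff not0_implies_Suc)
  ultimately show ?case using insert by (simp add: coeff_pCons)
qed simp

text \<open>Degree \<open>card A\<close> is one too many for interpolation, so a multiple of the
  monic nodal polynomial \<open>M\<close> is subtracted first. It vanishes on \<open>A\<close>, and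
  its second coefficient is minus the sum of the nodes.\<close>

lemma lagrange_sum_next:
  fixes p :: "'a::field poly"
  assumes "finite A" "A \<noteq> {}" "degree p \<le> card A"
  shows "(\<Sum>a\<in>A. poly p a / (\<Prod>b\<in>A-{a}. a - b)) = coeff p (card A - 1) + coeff p (card A) * \<Sum>A"
proof -
  define M where "M = (\<Prod>a\<in>A. [:- a, 1:])"
  define r where "r = p - smult (coeff p (card A)) M"
  have pos: "card A > 0" using assms by (simp add: card_gt_0_iff)
  have deg_M: "degree M = card A" and lead_M: "coeff M (card A) = 1"
    using assms(1) degree_prod_linear[of A "\<lambda>a. - a"] lead_coeff_prod_linear[of A "\<lambda>a. - a"]
    by (simp_all add: M_def)
  have "degree r \<le> card A"
    unfolding r_def using assms deg_M by (intro degree_diff_le) (auto intro: order_trans[OF degree_smult_le])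
  moreover have "coeff r (card A) = 0" by (simp add: r_def lead_M)
  ultimately have "degree r < card A"
    using pos by (metis le_neq_implies_less leading_coeff_0_iff degree_0)
  then have "(\<Sum>a\<in>A. poly r a / (\<Prod>b\<in>A-{a}. a - b)) = coeff r (card A - 1)"
    by (rule lagrange_sum[OF assms(1)])
  moreover have "poly r a = poly p a" if "a \<in> A" for a
    using that assms(1) by (auto simp: r_def M_def poly_prod intro!: prod_zero)
  moreover have "coeff r (card A - 1) = coeff p (card A - 1) + coeff p (card A) * \<Sum>A"
    using coeff_prod_linear_second[OF assms(1,2), of "\<lambda>a. a"] by (simp add: r_def M_def)
  ultimately show ?thesis by simp
qed

text \<open>Interpolate the product of all \<open>X + b\<close> at the nodes \<open>A\<close> and 0.
  A node \<open>a\<close> gives twice the wanted product, since the factor \<open>b = a\<close> is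
  \<open>2 * a\<close>, and the node 0 gives -1. The odd cardinality fixes both signs.\<close>

lemma sum_prod_plus_over_minus:
  fixes A :: "'a::field_char_0 set"
  assumes "finite A" "0 \<notin> A" "odd (card A)"
  shows "(\<Sum>a\<in>A. \<Prod>b\<in>A-{a}. (b + a) / (b - a)) = 1"
proof -
  define p where "p = (\<Prod>b\<in>A. [:b, 1:])"
  have deg: "degree p = card A" and lead: "coeff p (card A) = 1"
    using assms(1) degree_prod_linear[of A "\<lambda>a. a"] lead_coeff_prod_linear[of A "\<lambda>a. a"]
    by (simp_all add: p_def)
  have term_a: "poly p a / (\<Prod>b\<in>insert 0 A-{a}. a - b) = 2 * (\<Prod>b\<in>A-{a}. (b + a) / (b - a))"
    if a: "a \<in> A" for a
  proof -
    have "a \<noteq> 0" using a assms by auto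
    have "insert 0 A - {a} = insert 0 (A - {a})" using \<open>a \<noteq> 0\<close> by auto
    then have "(\<Prod>b\<in>insert 0 A-{a}. a - b) = a * (\<Prod>b\<in>A-{a}. a - b)"
      using assms by simp
    also have "(\<Prod>b\<in>A-{a}. a - b) = (\<Prod>b\<in>A-{a}. (-1) * (b - a))" by simp
    also have "\<dots> = (-1) ^ card (A - {a}) * (\<Prod>b\<in>A-{a}. b - a)" by (subst prod.distrib) simp
    also have "(-1::'a) ^ card (A - {a}) = 1" using a assms by auto
    finally have "(\<Prod>b\<in>insert 0 A-{a}. a - b) = a * (\<Prod>b\<in>A-{a}. b - a)" by simp
    moreover have "poly p a = 2 * a * (\<Prod>b\<in>A-{a}. b + a)"
      using prod.remove[OF assms(1) a, of "\<lambda>b. b + a"] by (simp add: p_def poly_prod)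
    ultimately show ?thesis using \<open>a \<noteq> 0\<close> by (simp add: prod_dividef)
  qed
  have "(\<Sum>a\<in>insert 0 A. poly p a / (\<Prod>b\<in>insert 0 A-{a}. a - b)) = 1"
    using assms lagrange_sum[of "insert 0 A" p] deg lead by simp
  moreover have "poly p 0 / (\<Prod>b\<in>insert 0 A-{0}. 0 - b) = -1"
  proof -
    have "(\<Prod>b\<in>A. - b) = (\<Prod>b\<in>A. (-1) * b)" by simp
    also have "\<dots> = - (\<Prod>b\<in>A. b)" using assms by (subst prod.distrib) simp
    finally show ?thesis using assms by (simp add: p_def poly_prod)
  qed
  ultimately have "2 * (\<Sum>a\<in>A. \<Prod>b\<in>A-{a}. (b + a) / (b - a)) + (-1) = 1"
    using assms by (simp add: term_a sum_distrib_left)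
  then show ?thesis by simp
qed

text \<open>For nonzero \<open>w\<close> this is -tanh(m log(w) / 2), an odd function on the
  integers whose reciprocal at a hook length is the factor (1 + w^h)/(1 - w^h).\<close>

definition psi :: "complex \<Rightarrow> int \<Rightarrow> complex" where
  "psi w m = (1 - w powi m) / (1 + w powi m)"

lemma psi_zero [simp]: "psi w 0 = 0"
  by (simp add: psi_def)

locale no_root =
  fixes w :: complex
  assumes w0: "w \<noteq> 0" and no_root: "\<And>n. n > 0 \<Longrightarrow> w ^ n \<noteq> 1"
begin

lemma powi_eq_1_iff: "w powi m = 1 \<longleftrightarrow> m = 0"
proof
  assume *: "w powi m = 1"
  show "m = 0"
  proof (cases "m \<ge> 0")
    case True
    then show ?thesis using * no_root[of "nat m"] by (cases "m = 0") (auto simp: power_int_def)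
  next
    case False
    then have "w ^ nat (-m) = 1" using * by (auto simp: power_int_def power_inverse)
    then show ?thesis using no_root[of "nat (-m)"] False by auto
  qed
qed simp

lemma powi_neq_minus_1: "w powi m \<noteq> -1"
proof
  assume *: "w powi m = -1"
  then have "w powi (m * 2) = 1" by (simp add: power_int_mult)
  then show False using * powi_eq_1_iff[of "m * 2"] by auto
qed

lemma powi_neq_0: "w powi m \<noteq> 0"
  using w0 by simp

lemma psi_denom: "1 + w powi m \<noteq> 0"
  using powi_neq_minus_1[of m] by (metis add.inverse_inverse add_eq_0_iff)

lemma psi_eq_0_iff: "psi w m = 0 \<longleftrightarrow> m = 0"
  using powi_eq_1_iff[of m] psi_denom[of m] by (auto simp: psi_def)

lemma psi_uminus: "psi w (- m) = - psi w m"
proof -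
  have "psi w (- m) = (w powi m * (1 - w powi (- m))) / (w powi m * (1 + w powi (- m)))"
    using powi_neq_0[of m] by (simp add: psi_def)
  also have "\<dots> = (- (1 - w powi m)) / (1 + w powi m)"
    using powi_neq_0[of m] by (simp add: power_int_minus algebra_simps)
  finally show ?thesis by (simp only: psi_def minus_divide_left)
qed

text \<open>Factors of this shape occur in \<open>sum_prod_plus_over_minus\<close>: inverted for two
  nodes of the same kind (both \<open>w\<close> powers or both negatives of such), upright for nodes
  of different kinds.\<close>

lemma psi_diff: "psi w (m - n) = (w powi n - w powi m) / (w powi n + w powi m)"
proof -
  have "psi w (m - n) = (1 - w powi m / w powi n) / (1 + w powi m / w powi n)"
    using w0 by (simp add: psi_def power_int_diff)
  also have "\<dots> = (w powi n * (1 - w powi m / w powi n)) / (w powi n * (1 + w powi m / w powi n))"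
    using powi_neq_0[of n] by (subst mult_divide_mult_cancel_left) simp_all
  also have "\<dots> = (w powi n - w powi m) / (w powi n + w powi m)"
    using powi_neq_0[of n] by (simp add: distrib_left right_diff_distrib)
  finally show ?thesis .
qed

lemma powi_eq_iff: "w powi m = w powi n \<longleftrightarrow> m = n"
proof -
  have "w powi (m - n) = w powi m / w powi n" using w0 by (simp add: power_int_diff)
  then show ?thesis using powi_eq_1_iff[of "m - n"] powi_neq_0[of n] by auto
qed

lemma powi_neq_uminus: "w powi m \<noteq> - (w powi n)"
proof
  assume *: "w powi m = - (w powi n)"
  have "w powi (m - n) = w powi m / w powi n" using w0 by (simp add: power_int_diff)
  with * show False using powi_neq_minus_1[of "m - n"] powi_neq_0[of n] by auto
qed

text \<open>This is the lemma \<open>sum_prod_plus_over_minus\<close> for the nodes \<open>1\<close>, \<open>w ^ (s + 1)\<close> and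
  \<open>- w ^ s\<close> with \<open>s \<in> X\<close>; the node \<open>1\<close> contributes nothing because \<open>0 \<in> X\<close>.\<close>

lemma psi_move_identity:
  fixes X :: "int set"
  assumes X: "finite X" "0 \<in> X" "\<And>s. s \<in> X \<Longrightarrow> s \<ge> 0"
  shows "(\<Sum>s\<in>X. (\<Prod>j\<in>X-{s}. psi w (s + 1 - j) / psi w (s - j)) / psi w (s + 1)) =
    1 / psi w 1 + (\<Sum>s\<in>X. (\<Prod>j\<in>X-{s}. psi w (s - 1 - j) / psi w (s - j)) * psi w s)"
proof -
  let ?u = "\<lambda>s::int. w powi (s + 1)" and ?v = "\<lambda>s::int. - (w powi s)"
  define Y where "Y = insert (-1) X"
  define U V where "U = ?u ` Y" and "V = ?v ` X"
  have "-1 \<notin> X" using X(3)[of "-1"] by auto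
  have finY: "finite Y" using X by (simp add: Y_def)
  then have fin: "finite U" "finite V" using X by (auto simp: U_def V_def)
  have inj_u: "inj_on ?u B" for B by (auto simp: inj_on_def powi_eq_iff)
  have inj_v: "inj_on ?v B" for B by (auto simp: inj_on_def powi_eq_iff)
  have disj: "U \<inter> V = {}"
    unfolding U_def V_def using powi_neq_uminus by fastforce
  have uu: "(?u j + ?u s) / (?u j - ?u s) = 1 / psi w (s - j)" for j s
    using psi_diff[of "s+1" "j+1"] by simp
  have vu: "(?v j + ?u s) / (?v j - ?u s) = psi w (s + 1 - j)" for j s
  proof -
    have "(?v j + ?u s) / (?v j - ?u s) = (- (w powi j - ?u s)) / (- (w powi j + ?u s))" by simp
    then show ?thesis by (simp only: minus_divide_divide psi_diff)
  qed
  have uv: "(?u j + ?v s) / (?u j - ?v s) = psi w (s - 1 - j)" for j s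
    using psi_diff[of s "j+1"] by (simp add: algebra_simps)
  have vv: "(?v j + ?v s) / (?v j - ?v s) = 1 / psi w (s - j)" for j s
  proof -
    have "(?v j + ?v s) / (?v j - ?v s) = (- (w powi j + w powi s)) / (- (w powi j - w powi s))" by simp
    then show ?thesis by (simp only: minus_divide_divide psi_diff) simp
  qed
  let ?F = "\<lambda>a. \<Prod>b\<in>(U \<union> V)-{a}. (b + a) / (b - a)"
  have card: "card (U \<union> V) = Suc (2 * card X)"
  proof -
    have "card Y = Suc (card X)" using X(1) \<open>-1 \<notin> X\<close> by (simp add: Y_def)
    moreover have "card U = card Y" "card V = card X"
      by (simp_all only: U_def V_def card_image[OF inj_u] card_image[OF inj_v])
    ultimately show ?thesis using fin disj by (simp add: card_Un_disjoint)
  qed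
  have "0 \<notin> U \<union> V" using powi_neq_0 by (auto simp: U_def V_def)
  then have "1 = (\<Sum>a\<in>U \<union> V. ?F a)"
    using sum_prod_plus_over_minus[of "U \<union> V"] fin card by simp
  also have "\<dots> = (\<Sum>s\<in>Y. ?F (?u s)) + (\<Sum>s\<in>X. ?F (?v s))"
    using fin disj by (simp add: sum.union_disjoint U_def V_def sum.reindex[OF inj_u] sum.reindex[OF inj_v])
  finally have main: "1 = (\<Sum>s\<in>Y. ?F (?u s)) + (\<Sum>s\<in>X. ?F (?v s))" .
  have Fu: "?F (?u s) = (\<Prod>j\<in>Y-{s}. 1 / psi w (s - j)) * (\<Prod>j\<in>X. psi w (s + 1 - j))" if "s \<in> Y" for s
  proof -
    have "(U \<union> V) - {?u s} = ?u ` (Y - {s}) \<union> V"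
      using that disj inj_u[of UNIV] unfolding U_def V_def inj_on_def by blast
    moreover have "?u ` (Y - {s}) \<inter> V = {}" using disj unfolding U_def by blast
    ultimately have "?F (?u s) = (\<Prod>b\<in>?u ` (Y - {s}). (b + ?u s) / (b - ?u s)) * (\<Prod>b\<in>V. (b + ?u s) / (b - ?u s))"
      using fin finY by (simp only: prod.union_disjoint finite_imageI finite_Diff)
    then show ?thesis
      unfolding V_def by (simp only: prod.reindex[OF inj_u] prod.reindex[OF inj_v] o_def uu vu)
  qed
  have Fv: "?F (?v s) = (\<Prod>j\<in>Y. psi w (s - 1 - j)) * (\<Prod>j\<in>X-{s}. 1 / psi w (s - j))" if "s \<in> X" for s
  proof -
    have "(U \<union> V) - {?v s} = U \<union> ?v ` (X - {s})"
      using that disj inj_v[of UNIV] unfolding U_def V_def inj_on_def by blast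
    moreover have "U \<inter> ?v ` (X - {s}) = {}" using disj unfolding V_def by blast
    ultimately have "?F (?v s) = (\<Prod>b\<in>U. (b + ?v s) / (b - ?v s)) * (\<Prod>b\<in>?v ` (X - {s}). (b + ?v s) / (b - ?v s))"
      using fin X(1) by (simp only: prod.union_disjoint finite_imageI finite_Diff)
    then show ?thesis
      unfolding U_def by (simp only: prod.reindex[OF inj_u] prod.reindex[OF inj_v] o_def uv vv)
  qed
  have "?F (?u (-1)) = 0"
    by (subst Fu) (use X in \<open>auto simp: Y_def intro!: prod_zero bexI[of _ 0]\<close>)
  \<comment> \<open>The factor \<open>psi w 1\<close> comes from \<open>j = s\<close> in the product
    over \<open>X\<close>, the denominator \<open>psi w (s + 1)\<close> from the extra index -1 in
    \<open>Y\<close>.\<close>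
  moreover have "?F (?u s) = psi w 1 * ((\<Prod>j\<in>X-{s}. psi w (s + 1 - j) / psi w (s - j)) / psi w (s + 1))"
    if s: "s \<in> X" for s
  proof -
    have "Y - {s} = insert (-1) (X - {s})" using s X(3)[of s] by (auto simp: Y_def)
    then have "(\<Prod>j\<in>Y-{s}. 1 / psi w (s - j)) = (\<Prod>j\<in>X-{s}. 1 / psi w (s - j)) / psi w (s + 1)"
      using X(1) \<open>-1 \<notin> X\<close> by simp
    moreover have "(\<Prod>j\<in>X. psi w (s + 1 - j)) = psi w 1 * (\<Prod>j\<in>X-{s}. psi w (s + 1 - j))"
      using prod.remove[OF X(1) s, of "\<lambda>j. psi w (s + 1 - j)"] by simp
    ultimately show ?thesis using s by (subst Fu) (simp_all add: Y_def prod_dividef)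
  qed
  \<comment> \<open>Here \<open>j = s\<close> gives \<open>psi w (-1) = - psi w 1\<close>, the sign
    that separates up moves from down moves, and \<open>j = -1\<close> gives
    \<open>psi w s\<close>.\<close>
  moreover have "?F (?v s) = - psi w 1 * ((\<Prod>j\<in>X-{s}. psi w (s - 1 - j) / psi w (s - j)) * psi w s)"
    if s: "s \<in> X" for s
  proof -
    have "(\<Prod>j\<in>Y. psi w (s - 1 - j)) = psi w s * (\<Prod>j\<in>X. psi w (s - 1 - j))"
      using X(1) \<open>-1 \<notin> X\<close> by (simp add: Y_def)
    also have "(\<Prod>j\<in>X. psi w (s - 1 - j)) = - psi w 1 * (\<Prod>j\<in>X-{s}. psi w (s - 1 - j))"
      using prod.remove[OF X(1) s, of "\<lambda>j. psi w (s - 1 - j)"] psi_uminus[of 1] by simp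
    finally show ?thesis using s by (subst Fv) (simp_all add: prod_dividef)
  qed
  ultimately have "1 = psi w 1 * (\<Sum>s\<in>X. (\<Prod>j\<in>X-{s}. psi w (s + 1 - j) / psi w (s - j)) / psi w (s + 1))
     - psi w 1 * (\<Sum>s\<in>X. (\<Prod>j\<in>X-{s}. psi w (s - 1 - j) / psi w (s - j)) * psi w s)"
    using main X(1) \<open>-1 \<notin> X\<close> by (simp add: Y_def sum_distrib_left sum_negf)
  then show ?thesis using psi_eq_0_iff[of 1] by (simp add: field_simps)
qed

end

text \<open>The monic polynomial with factors \<open>X + 1 - b\<close> has degree one less than the
  number of nodes in \<open>insert (-1) A\<close>, and it vanishes at the added node because
  \<open>0 \<in> A\<close>. The added node supplies the denominator \<open>a + 1\<close>.\<close>

lemma sum_up_moves: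
  fixes A :: "'a::field set"
  assumes "finite A" "0 \<in> A" "-1 \<notin> A"
  shows "(\<Sum>a\<in>A. (\<Prod>b\<in>A-{a}. (a + 1 - b) / (a - b)) / (a + 1)) = 1"
proof -
  define p where "p = (\<Prod>b\<in>A. [:1 - b, 1:])"
  have deg: "degree p = card A" and lead: "coeff p (card A) = 1"
    using assms(1) degree_prod_linear[of A "\<lambda>a. 1 - a"] lead_coeff_prod_linear[of A "\<lambda>a. 1 - a"]
    by (simp_all add: p_def)
  have "(\<Prod>b\<in>A-{a}. (a + 1 - b) / (a - b)) / (a + 1) = poly p a / (\<Prod>b\<in>insert (-1) A-{a}. a - b)"
    if a: "a \<in> A" for a
  proof -
    have "insert (-1) A - {a} = insert (-1) (A - {a})" using a assms by auto
    then have "(\<Prod>b\<in>insert (-1) A-{a}. a - b) = (a + 1) * (\<Prod>b\<in>A-{a}. a - b)"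
      using assms by simp
    moreover have "poly p a = (\<Prod>b\<in>A-{a}. a + 1 - b)"
      using prod.remove[OF assms(1) a, of "\<lambda>b. a + 1 - b"] by (simp add: p_def poly_prod algebra_simps)
    ultimately show ?thesis by (simp add: prod_dividef)
  qed
  moreover have "(\<Sum>a\<in>insert (-1) A. poly p a / (\<Prod>b\<in>insert (-1) A-{a}. a - b)) = 1"
    using assms lagrange_sum[of "insert (-1) A" p] deg lead by simp
  moreover have "poly p (-1) = 0"
    using assms by (auto simp: p_def poly_prod intro!: prod_zero)
  ultimately show ?thesis using assms by simp
qed

text \<open>The numerator has degree one above the number of nodes, beyond the reach of
  \<open>lagrange_sum_next\<close>, hence the induction on \<open>A\<close>. Writing
  \<open>a - 1 - c = (a - c) - 1\<close> splits it into a part in which the new node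
  \<open>c\<close> cancels and a part whose degree equals the number of nodes.\<close>

lemma sum_down_moves:
  fixes A :: "'a::field_char_0 set"
  assumes "finite A"
  shows "(\<Sum>a\<in>A. (\<Prod>b\<in>A-{a}. (a - 1 - b) / (a - b)) * a) =
    \<Sum>A - of_nat (card A) * (of_nat (card A) - 1) / 2"
proof -
  define p where "p = (\<lambda>A::'a set. \<Prod>b\<in>A. [:- (b + 1), 1:])"
  have "(\<Sum>a\<in>A. a * poly (p A) a / (\<Prod>b\<in>A-{a}. a - b)) =
     of_nat (card A) * (of_nat (card A) - 1) / 2 - \<Sum>A"
    using assms
  proof (induction A rule: finite_induct)
    case (insert c A)
    let ?D = "\<lambda>a. \<Prod>b\<in>insert c A-{a}. a - b"
    have deg: "degree (p A) = card A" and lead: "coeff (p A) (card A) = 1"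
      using insert.hyps degree_prod_linear[of A "\<lambda>a. - (a + 1)"] lead_coeff_prod_linear[of A "\<lambda>a. - (a + 1)"]
      by (simp_all add: p_def)
    have poly_eq: "a * poly (p (insert c A)) a / ?D a =
      a * poly (p A) a * (a - c) / ?D a - poly (pCons 0 (p A)) a / ?D a" for a
      using insert.hyps by (simp add: p_def poly_prod flip: diff_divide_distrib) (simp add: algebra_simps)
    have D: "a * poly (p A) a * (a - c) / ?D a = a * poly (p A) a / (\<Prod>b\<in>A-{a}. a - b)" if "a \<in> A" for a
    proof -
      have "insert c A - {a} = insert c (A - {a})" "a \<noteq> c" using that insert.hyps by auto
      then show ?thesis using insert.hyps by simp
    qed
    have c: "coeff (pCons 0 (p A)) (card A) = - \<Sum>A - of_nat (card A)"
    proof (cases "A = {}")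
      case True
      then show ?thesis by simp
    next
      case False
      then obtain m where "card A = Suc m"
        using insert.hyps by (metis card_eq_0_iff not0_implies_Suc)
      with coeff_prod_linear_second[OF insert.hyps(1) False, of "\<lambda>a. a + 1"]
      show ?thesis by (simp add: p_def coeff_pCons sum.distrib)
    qed
    have "(\<Sum>a\<in>insert c A. poly (pCons 0 (p A)) a / ?D a) = c - of_nat (card A)"
      using lagrange_sum_next[of "insert c A" "pCons 0 (p A)"] insert.hyps deg lead c
      by (simp add: degree_pCons_eq_if)
    moreover have "(\<Sum>a\<in>insert c A. a * poly (p A) a * (a - c) / ?D a) =
        of_nat (card A) * (of_nat (card A) - 1) / 2 - \<Sum>A"
    proof -
      have "(\<Sum>a\<in>insert c A. a * poly (p A) a * (a - c) / ?D a) =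
        (\<Sum>a\<in>A. a * poly (p A) a * (a - c) / ?D a)"
        using insert.hyps by simp
      also have "\<dots> = (\<Sum>a\<in>A. a * poly (p A) a / (\<Prod>b\<in>A-{a}. a - b))"
        by (intro sum.cong refl D)
      finally show ?thesis using insert.IH by simp
    qed
    ultimately have "(\<Sum>a\<in>insert c A. a * poly (p (insert c A)) a / ?D a) =
       of_nat (card A) * (of_nat (card A) - 1) / 2 - \<Sum>A - (c - of_nat (card A))"
      unfolding poly_eq sum_subtractf by simp
    then show ?case using insert.hyps by (simp add: field_simps)
  qed simp
  \<comment> \<open>The factor \<open>b = a\<close> of \<open>p A\<close>, evaluated at
    \<open>a\<close>, is -1; this is the sign.\<close>
  moreover have "a * poly (p A) a / (\<Prod>b\<in>A-{a}. a - b) = - ((\<Prod>b\<in>A-{a}. (a - 1 - b) / (a - b)) * a)"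
    if "a \<in> A" for a
    using prod.remove[OF assms that, of "\<lambda>b. a - 1 - b"]
    by (simp add: p_def poly_prod prod_dividef algebra_simps)
  ultimately have "- (\<Sum>a\<in>A. (\<Prod>b\<in>A-{a}. (a - 1 - b) / (a - b)) * a) =
     of_nat (card A) * (of_nat (card A) - 1) / 2 - \<Sum>A"
    by (simp add: sum_negf)
  from arg_cong[OF this, of uminus] show ?thesis by (simp only: minus_minus minus_diff_eq)
qed

section \<open>Hooks of finite sets of beads\<close>

text \<open>A set \<open>X\<close> of \<open>k\<close> natural numbers is the set of first-column hook lengths (the \<open>\<beta>\<close>-set) of a
  partition with at most \<open>k\<close> parts; its hooks are the pairs of a bead and a smaller gap.\<close>

definition nhooks :: "nat set \<Rightarrow> (nat \<times> nat) set" where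
  "nhooks X = {(s, g). s \<in> X \<and> g \<notin> X \<and> g < s}"

definition beta_sets :: "nat \<Rightarrow> nat \<Rightarrow> nat set set" where
  "beta_sets k n = {X. finite X \<and> card X = k \<and> card (nhooks X) = n}"

definition hook_prod :: "(nat \<Rightarrow> 'a) \<Rightarrow> nat set \<Rightarrow> 'a::comm_monoid_mult" where
  "hook_prod f X = (\<Prod>(s, g)\<in>nhooks X. f (s - g))"

definition hook_sum :: "(nat \<Rightarrow> 'a) \<Rightarrow> nat \<Rightarrow> nat \<Rightarrow> 'a::comm_semiring_1" where
  "hook_sum f k n = (\<Sum>X\<in>beta_sets k n. hook_prod f X)"

lemma nhooks_eq_Sigma: "nhooks X = Sigma X (\<lambda>s. {..<s} - X)"
  by (auto simp: nhooks_def)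

lemma finite_nhooks: "finite X \<Longrightarrow> finite (nhooks X)"
  by (simp add: nhooks_eq_Sigma)

text \<open>A new largest bead \<open>m\<close> forms hooks with the \<open>m - card X\<close> gaps
  below it. So the number of hooks is the sum of the beads minus 0 + ... + (k - 1), its value for
  the empty partition.\<close>

lemma card_nhooks: "finite X \<Longrightarrow> card (nhooks X) + (card X choose 2) = \<Sum>X"
proof (induction X rule: finite_linorder_max_induct)
  case (insert m X)
  have "m \<notin> X" using insert.hyps by auto
  have "nhooks (insert m X) = nhooks X \<union> {m} \<times> ({..<m} - X)"
    using insert.hyps by (force simp: nhooks_def)
  moreover have "nhooks X \<inter> {m} \<times> ({..<m} - X) = {}"
    using \<open>m \<notin> X\<close> by (auto simp: nhooks_def)
  ultimately have "card (nhooks (insert m X)) = card (nhooks X) + card ({m} \<times> ({..<m} - X))"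
    using card_Un_disjoint[of "nhooks X" "{m} \<times> ({..<m} - X)"] insert.hyps(1) finite_nhooks[of X] by simp
  also have "card ({m} \<times> ({..<m} - X)) = m - card X"
    using insert.hyps by (simp add: card_cartesian_product card_Diff_subset subset_iff)
  finally have "card (nhooks (insert m X)) = card (nhooks X) + (m - card X)" .
  moreover have "card X \<le> m"
    using card_mono[of "{..<m}" X] insert.hyps by auto
  ultimately show ?case using insert \<open>m \<notin> X\<close> by (simp add: numeral_2_eq_2)
qed (simp add: nhooks_def)

lemma finite_beta_sets: "finite (beta_sets k n)"
proof (rule finite_subset)
  show "beta_sets k n \<subseteq> Pow {..n + (k choose 2)}"
  proof (intro subsetI PowI)
    fix X x assume X: "X \<in> beta_sets k n" and x: "x \<in> X"
    then have "\<Sum>X = n + (k choose 2)" using card_nhooks[of X] by (simp add: beta_sets_def)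
    then show "x \<in> {..n + (k choose 2)}"
      using x member_le_sum[of x X "\<lambda>x. x"] X unfolding beta_sets_def by auto
  qed
qed simp

text \<open>If 0 were a gap, each of the \<open>k\<close> beads would form a hook with it. Bead 0
  stands for an empty row, which the identities for up moves require.\<close>

lemma zero_in_beta_set:
  assumes "X \<in> beta_sets k n" "n < k"
  shows "0 \<in> X"
proof (rule ccontr)
  assume *: "0 \<notin> X"
  have fin: "finite X" using assms by (simp add: beta_sets_def)
  have "X \<times> {0} \<subseteq> nhooks X" using * by (auto simp: nhooks_def intro: gr0I)
  from card_mono[OF finite_nhooks[OF fin] this] show False
    using assms by (simp add: card_cartesian_product beta_sets_def)
qed

lemma nhooks_lessThan [simp]: "nhooks {..<k} = {}"
  by (auto simp: nhooks_def)

lemma eq_lessThan_card_if_nhooks_empty: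
  assumes fin: "finite X" and emp: "nhooks X = {}"
  shows "X = {..<card X}"
proof (cases "X = {}")
  case False
  have "X = {..<Suc (Max X)}"
  proof (intro equalityI subsetI)
    fix x assume "x \<in> {..<Suc (Max X)}"
    then have "x < Max X \<or> x = Max X" "Max X \<in> X" using fin False by auto
    then show "x \<in> X" using emp unfolding nhooks_def by blast
  qed (use fin in \<open>auto simp: less_Suc_eq_le\<close>)
  then show ?thesis by (metis card_lessThan)
qed simp

lemma beta_sets_0: "beta_sets k 0 = {{..<k}}"
proof (intro equalityI subsetI)
  fix X assume "X \<in> beta_sets k 0"
  then have "finite X" "card X = k" "nhooks X = {}"
    using finite_nhooks[of X] by (auto simp: beta_sets_def)
  then show "X \<in> {{..<k}}" using eq_lessThan_card_if_nhooks_empty[of X] by blast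
qed (simp add: beta_sets_def)

lemma hook_sum_0: "hook_sum f k 0 = 1"
  by (simp add: hook_sum_def beta_sets_0 hook_prod_def)

lemma hook_prod_mult: "hook_prod (\<lambda>h. f h * g h) X = hook_prod f X * hook_prod g X"
  by (simp add: hook_prod_def prod.distrib case_prod_unfold)

text \<open>The gaps below \<open>s\<close> are all smaller positions except the smaller beads.
  Trading gaps for differences of beads makes hook products accessible to interpolation with the
  beads as nodes.\<close>

lemma hook_prod_eq:
  fixes f :: "nat \<Rightarrow> 'a::field"
  assumes "finite X" "\<And>h. h > 0 \<Longrightarrow> f h \<noteq> 0"
  shows "hook_prod f X = (\<Prod>s\<in>X. (\<Prod>h=1..s. f h) / (\<Prod>j\<in>{j\<in>X. j < s}. f (s - j)))"
proof -
  have "(\<Prod>g\<in>{..<s} - X. f (s - g)) = (\<Prod>h=1..s. f h) / (\<Prod>j\<in>{j\<in>X. j < s}. f (s - j))" for s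
  proof -
    have "(\<Prod>h=1..s. f h) = (\<Prod>g\<in>{..<s}. f (s - g))"
      by (rule prod.reindex_bij_witness[of _ "\<lambda>g. s - g" "\<lambda>h. s - h"]) auto
    also have "\<dots> = (\<Prod>g\<in>{..<s} - X. f (s - g)) * (\<Prod>g\<in>{..<s} \<inter> X. f (s - g))"
      by (subst prod.union_disjoint[symmetric]) (auto intro!: prod.cong)
    also have "{..<s} \<inter> X = {j\<in>X. j < s}" by auto
    finally have "(\<Prod>h=1..s. f h) = (\<Prod>g\<in>{..<s} - X. f (s - g)) * (\<Prod>j\<in>{j\<in>X. j < s}. f (s - j))" .
    moreover have "(\<Prod>j\<in>{j\<in>X. j < s}. f (s - j)) \<noteq> 0" using assms by auto
    ultimately show ?thesis by simp
  qed
  then show ?thesis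
    using assms(1) by (simp add: hook_prod_def nhooks_eq_Sigma prod.Sigma[symmetric])
qed

section \<open>Adding and removing a box as the move of one bead\<close>

definition up :: "nat \<Rightarrow> nat set \<Rightarrow> nat set" where
  "up s X = insert (Suc s) (X - {s})"

definition down :: "nat \<Rightarrow> nat set \<Rightarrow> nat set" where
  "down s X = insert (s - 1) (X - {s})"

definition upset :: "nat set \<Rightarrow> nat set" where
  "upset X = {s \<in> X. Suc s \<notin> X}"

definition downset :: "nat set \<Rightarrow> nat set" where
  "downset X = {s \<in> X. s > 0 \<and> s - 1 \<notin> X}"

lemma up_in_beta_sets:
  assumes "X \<in> beta_sets k n" "s \<in> upset X"
  shows "up s X \<in> beta_sets k (Suc n)"
proof -
  have X: "finite X" "card X = k" "card (nhooks X) = n" "s \<in> X" "Suc s \<notin> X"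
    using assms by (auto simp: beta_sets_def upset_def)
  have "k > 0" using X by (auto simp: card_gt_0_iff)
  then have "card (up s X) = k" using X by (simp add: up_def)
  moreover have "\<Sum>(up s X) = Suc (\<Sum>X)"
    using X sum.remove[of X s "\<lambda>x. x"] by (simp add: up_def)
  ultimately show ?thesis
    using X card_nhooks[of X] card_nhooks[of "up s X"] by (simp add: beta_sets_def up_def)
qed

lemma down_in_beta_sets:
  assumes "X \<in> beta_sets k (Suc n)" "s \<in> downset X"
  shows "down s X \<in> beta_sets k n"
proof -
  have X: "finite X" "card X = k" "card (nhooks X) = Suc n" "s \<in> X" "s > 0" "s - 1 \<notin> X"
    using assms by (auto simp: beta_sets_def downset_def)
  have "k > 0" using X by (auto simp: card_gt_0_iff)
  then have "card (down s X) = k" using X by (simp add: down_def)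
  moreover have "Suc (\<Sum>(down s X)) = \<Sum>X"
    using X sum.remove[of X s "\<lambda>x. x"] by (simp add: down_def)
  ultimately show ?thesis
    using X card_nhooks[of X] card_nhooks[of "down s X"] by (simp add: beta_sets_def down_def)
qed

lemma up_down: "s \<in> downset X \<Longrightarrow> s - 1 \<in> upset (down s X) \<and> up (s - 1) (down s X) = X"
  by (auto simp: downset_def upset_def up_def down_def)

lemma down_up: "s \<in> upset X \<Longrightarrow> Suc s \<in> downset (up s X) \<and> down (Suc s) (up s X) = X"
  by (auto simp: downset_def upset_def up_def down_def)

text \<open>Both sides run over the pairs of beta-sets that differ by one box, grouped once by the
  larger and once by the smaller.\<close>

lemma sum_down_eq_sum_up:
  "(\<Sum>X\<in>beta_sets k (Suc n). \<Sum>s\<in>downset X. F X (down s X)) =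
   (\<Sum>Y\<in>beta_sets k n. \<Sum>s\<in>upset Y. F (up s Y) Y)"
proof -
  have fin: "finite X" if "X \<in> beta_sets k n" for X n
    using that by (simp add: beta_sets_def)
  have "(\<Sum>X\<in>beta_sets k (Suc n). \<Sum>s\<in>downset X. F X (down s X)) =
      (\<Sum>(X, s)\<in>Sigma (beta_sets k (Suc n)) downset. F X (down s X))"
    by (rule sum.Sigma) (auto simp: finite_beta_sets downset_def fin)
  also have "\<dots> = (\<Sum>(Y, s)\<in>Sigma (beta_sets k n) upset. F (up s Y) Y)"
    by (rule sum.reindex_bij_witness[of _ "\<lambda>(Y, s). (up s Y, Suc s)" "\<lambda>(X, s). (down s X, s - 1)"])
      (auto simp: up_down[unfolded One_nat_def] down_up up_in_beta_sets down_in_beta_sets, auto simp: downset_def)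
  also have "\<dots> = (\<Sum>Y\<in>beta_sets k n. \<Sum>s\<in>upset Y. F (up s Y) Y)"
    by (rule sum.Sigma[symmetric]) (auto simp: finite_beta_sets upset_def fin)
  finally show ?thesis .
qed

text \<open>Shared by \<open>psi w\<close> and by the embedding of the integers into the complex
  numbers, whose reciprocals are the two factors of the hook weight.\<close>

locale odd_weight =
  fixes \<psi> :: "int \<Rightarrow> 'a::field"
  assumes odd: "\<psi> (- m) = - \<psi> m" and eq_0: "\<psi> m = 0 \<longleftrightarrow> m = 0"
begin

definition recip :: "nat \<Rightarrow> 'a" where
  "recip h = 1 / \<psi> (int h)"

lemma recip_nonzero: "h > 0 \<Longrightarrow> recip h \<noteq> 0"
  by (simp add: recip_def eq_0)

text \<open>A new bead \<open>s\<close> contributes its own row, and it is no longer a gap for any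
  larger bead \<open>i\<close>, which cancels the factor \<open>recip (i - s)\<close>. Each other
  bead thus yields \<open>\<psi>\<close> of its distance to \<open>s\<close>.\<close>

lemma hook_prod_insert:
  assumes "finite Z" "s \<notin> Z"
  shows "hook_prod recip (insert s Z) =
    hook_prod recip Z * (\<Prod>h=1..s. recip h) * (\<Prod>j\<in>Z. \<psi> \<bar>int s - int j\<bar>)"
proof -
  let ?P = "\<lambda>s. \<Prod>h=1..s. recip h"
  have new: "?P s / (\<Prod>j\<in>{j\<in>insert s Z. j < s}. recip (s - j)) = ?P s * (\<Prod>j\<in>Z. if j < s then \<psi> \<bar>int s - int j\<bar> else 1)"
  proof -
    have "{j\<in>insert s Z. j < s} = {j\<in>Z. j < s}" by auto
    then have "1 / (\<Prod>j\<in>{j\<in>insert s Z. j < s}. recip (s - j)) = (\<Prod>j\<in>{j\<in>Z. j < s}. 1 / recip (s - j))"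
      by (simp add: prod_dividef)
    also have "\<dots> = (\<Prod>j\<in>{j\<in>Z. j < s}. \<psi> \<bar>int s - int j\<bar>)"
      by (intro prod.cong) (auto simp: recip_def of_nat_diff)
    also have "\<dots> = (\<Prod>j\<in>Z. if j < s then \<psi> \<bar>int s - int j\<bar> else 1)"
      by (rule prod.inter_filter[OF assms(1)])
    finally have "?P s * (1 / (\<Prod>j\<in>{j\<in>insert s Z. j < s}. recip (s - j))) =
      ?P s * (\<Prod>j\<in>Z. if j < s then \<psi> \<bar>int s - int j\<bar> else 1)"
      by (rule arg_cong)
    then show ?thesis by (simp only: times_divide_eq_right mult_1_right)
  qed
  have old: "?P i / (\<Prod>j\<in>{j\<in>insert s Z. j < i}. recip (i - j)) =
     ?P i / (\<Prod>j\<in>{j\<in>Z. j < i}. recip (i - j)) * (if s < i then \<psi> \<bar>int s - int i\<bar> else 1)" if "i \<in> Z" for i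
  proof (cases "s < i")
    case True
    then have "{j\<in>insert s Z. j < i} = insert s {j\<in>Z. j < i}" by auto
    then have "(\<Prod>j\<in>{j\<in>insert s Z. j < i}. recip (i - j)) = recip (i - s) * (\<Prod>j\<in>{j\<in>Z. j < i}. recip (i - j))"
      using assms by simp
    then show ?thesis using True by (simp add: recip_def of_nat_diff)
  next
    case False
    then have "{j\<in>insert s Z. j < i} = {j\<in>Z. j < i}" by auto
    then show ?thesis using False by simp
  qed
  have "hook_prod recip (insert s Z) = (\<Prod>i\<in>insert s Z. ?P i / (\<Prod>j\<in>{j\<in>insert s Z. j < i}. recip (i - j)))"
    using assms recip_nonzero by (intro hook_prod_eq) auto
  also have "\<dots> = ?P s * (\<Prod>j\<in>Z. if j < s then \<psi> \<bar>int s - int j\<bar> else 1) *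
     (\<Prod>i\<in>Z. ?P i / (\<Prod>j\<in>{j\<in>Z. j < i}. recip (i - j)) * (if s < i then \<psi> \<bar>int s - int i\<bar> else 1))"
    by (subst prod.insert[OF assms], rule arg_cong2[where f = "(*)"], rule new, intro prod.cong refl old)
  also have "\<dots> = ?P s * (\<Prod>i\<in>Z. ?P i / (\<Prod>j\<in>{j\<in>Z. j < i}. recip (i - j))) *
     ((\<Prod>j\<in>Z. if j < s then \<psi> \<bar>int s - int j\<bar> else 1) * (\<Prod>j\<in>Z. if s < j then \<psi> \<bar>int s - int j\<bar> else 1))"
    by (simp only: prod.distrib mult_ac)
  also have "(\<Prod>i\<in>Z. ?P i / (\<Prod>j\<in>{j\<in>Z. j < i}. recip (i - j))) = hook_prod recip Z"
    using assms recip_nonzero by (intro hook_prod_eq[symmetric]) auto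
  also have "(\<Prod>j\<in>Z. if j < s then \<psi> \<bar>int s - int j\<bar> else 1) * (\<Prod>j\<in>Z. if s < j then \<psi> \<bar>int s - int j\<bar> else 1)
    = (\<Prod>j\<in>Z. \<psi> \<bar>int s - int j\<bar>)"
    unfolding prod.distrib[symmetric] by (intro prod.cong) (use assms in auto)
  finally show ?thesis by (simp add: mult_ac)
qed

lemma hook_prod_up:
  assumes "finite X" "s \<in> upset X"
  shows "hook_prod recip (up s X) = hook_prod recip X *
    ((\<Prod>j\<in>X-{s}. \<psi> (int s + 1 - int j) / \<psi> (int s - int j)) / \<psi> (int s + 1))"
proof -
  define Z where "Z = X - {s}"
  have Z: "finite Z" "s \<notin> Z" "Suc s \<notin> Z" "X = insert s Z" "up s X = insert (Suc s) Z"
    using assms by (auto simp: Z_def upset_def up_def)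
  have nz: "(\<Prod>j\<in>Z. \<psi> \<bar>int s - int j\<bar>) \<noteq> 0"
    using Z by (auto simp: eq_0)
  have "(\<Prod>j\<in>Z. \<psi> \<bar>int (Suc s) - int j\<bar>) = (\<Prod>j\<in>Z. \<psi> \<bar>int s - int j\<bar>) * (\<Prod>j\<in>Z. \<psi> (int s + 1 - int j) / \<psi> (int s - int j))"
    unfolding prod.distrib[symmetric]
  proof (intro prod.cong refl)
    fix j assume "j \<in> Z"
    then have "j \<noteq> s" "j \<noteq> Suc s" using Z by auto
    \<comment> \<open>As \<open>j\<close> is neither \<open>s\<close> nor \<open>s + 1\<close>, no
      sign change occurs between the two differences, so the signs hidden in the absolute values
      cancel in the ratio.\<close>
    show "\<psi> \<bar>int (Suc s) - int j\<bar> = \<psi> \<bar>int s - int j\<bar> * (\<psi> (int s + 1 - int j) / \<psi> (int s - int j))"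
    proof (cases "j < s")
      case True
      then show ?thesis by (simp add: eq_0 add.commute)
    next
      case False
      with \<open>j \<noteq> s\<close> \<open>j \<noteq> Suc s\<close> have "\<bar>int (Suc s) - int j\<bar> = - (int s + 1 - int j)"
        "\<bar>int s - int j\<bar> = - (int s - int j)" "int s - int j \<noteq> 0" by auto
      then show ?thesis by (simp only: odd) (simp add: eq_0)
    qed
  qed
  moreover have "hook_prod recip X = hook_prod recip Z * (\<Prod>h=1..s. recip h) * (\<Prod>j\<in>Z. \<psi> \<bar>int s - int j\<bar>)"
    using hook_prod_insert[OF Z(1,2)] by (simp only: Z(4)[symmetric])
  ultimately show ?thesis
    using hook_prod_insert[OF Z(1,3)] nz
    unfolding Z(5) Z_def[symmetric] by (simp add: recip_def add.commute)
qed

lemma hook_prod_down: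
  assumes "finite X" "s \<in> downset X"
  shows "hook_prod recip (down s X) = hook_prod recip X *
    ((\<Prod>j\<in>X-{s}. \<psi> (int s - 1 - int j) / \<psi> (int s - int j)) * \<psi> (int s))"
proof -
  define Y where "Y = down s X"
  have Y: "finite Y" "s - 1 \<in> upset Y" "up (s - 1) Y = X" "Y - {s - 1} = X - {s}" "s > 0"
    using assms up_down[OF assms(2)] by (auto simp: Y_def down_def downset_def)
  have s: "int (s - 1) = int s - 1" using Y(5) by simp
  have ne: "s - 1 \<notin> X" using assms by (auto simp: downset_def)
  have "hook_prod recip X = hook_prod recip Y *
    ((\<Prod>j\<in>X-{s}. \<psi> (int s - int j) / \<psi> (int s - 1 - int j)) / \<psi> (int s))"
    using hook_prod_up[OF Y(1,2)] unfolding Y(3,4) s by simp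
  moreover have "(\<Prod>j\<in>X-{s}. \<psi> (int s - int j)) \<noteq> 0" "(\<Prod>j\<in>X-{s}. \<psi> (int s - 1 - int j)) \<noteq> 0" "\<psi> (int s) \<noteq> 0"
  proof -
    have "int s - 1 - int j \<noteq> 0" if "j \<in> X" for j
      using that ne Y(5) s by (metis eq_iff_diff_eq_0 of_nat_eq_iff)
    then show "(\<Prod>j\<in>X-{s}. \<psi> (int s - 1 - int j)) \<noteq> 0" using assms(1) by (simp add: eq_0)
  qed (use assms(1) Y(5) in \<open>auto simp: eq_0\<close>)
  ultimately show ?thesis by (simp add: Y_def prod_dividef)
qed

text \<open>The sum may run over all beads: if \<open>s + 1\<close> is occupied, the factor
  \<open>j = s + 1\<close> is \<open>\<psi> 0 = 0\<close>. Only the full sum is a Lagrange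
  sum.\<close>

lemma sum_hook_prod_up:
  assumes "finite X"
  shows "(\<Sum>s\<in>upset X. hook_prod recip (up s X)) = hook_prod recip X *
    (\<Sum>s\<in>int ` X. (\<Prod>j\<in>int ` X-{s}. \<psi> (s + 1 - j) / \<psi> (s - j)) / \<psi> (s + 1))"
proof -
  let ?T = "\<lambda>s. (\<Prod>j\<in>X-{s}. \<psi> (int s + 1 - int j) / \<psi> (int s - int j)) / \<psi> (int s + 1)"
  have im: "int ` X - {int s} = int ` (X - {s})" for s by auto
  have "(\<Sum>s\<in>upset X. hook_prod recip (up s X)) = hook_prod recip X * (\<Sum>s\<in>upset X. ?T s)"
    using assms by (simp add: hook_prod_up sum_distrib_left)
  also have "(\<Sum>s\<in>upset X. ?T s) = (\<Sum>s\<in>X. ?T s)"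
  proof (rule sum.mono_neutral_left)
    show "\<forall>s\<in>X - upset X. ?T s = 0"
    proof
      fix s assume "s \<in> X - upset X"
      then have "Suc s \<in> X - {s}" by (auto simp: upset_def)
      then have "(\<Prod>j\<in>X-{s}. \<psi> (int s + 1 - int j) / \<psi> (int s - int j)) = 0"
        using assms eq_0[of 0] by (intro prod_zero bexI[of _ "Suc s"]) auto
      then show "?T s = 0" by simp
    qed
  qed (use assms in \<open>auto simp: upset_def\<close>)
  also have "\<dots> = (\<Sum>s\<in>int ` X. (\<Prod>j\<in>int ` X-{s}. \<psi> (s + 1 - j) / \<psi> (s - j)) / \<psi> (s + 1))"
    by (simp add: sum.reindex im prod.reindex)
  finally show ?thesis .
qed

lemma sum_hook_prod_down:
  assumes "finite X"
  shows "(\<Sum>s\<in>downset X. hook_prod recip (down s X)) = hook_prod recip X *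
    (\<Sum>s\<in>int ` X. (\<Prod>j\<in>int ` X-{s}. \<psi> (s - 1 - j) / \<psi> (s - j)) * \<psi> s)"
proof -
  let ?T = "\<lambda>s. (\<Prod>j\<in>X-{s}. \<psi> (int s - 1 - int j) / \<psi> (int s - int j)) * \<psi> (int s)"
  have im: "int ` X - {int s} = int ` (X - {s})" for s by auto
  have "(\<Sum>s\<in>downset X. hook_prod recip (down s X)) = hook_prod recip X * (\<Sum>s\<in>downset X. ?T s)"
    using assms by (simp add: hook_prod_down sum_distrib_left)
  also have "(\<Sum>s\<in>downset X. ?T s) = (\<Sum>s\<in>X. ?T s)"
  proof (rule sum.mono_neutral_left)
    \<comment> \<open>A bead at 0 is killed by \<open>\<psi> (int s)\<close>, a bead right above
      another one by the factor \<open>j = s - 1\<close>.\<close>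
    show "\<forall>s\<in>X - downset X. ?T s = 0"
    proof
      fix s assume *: "s \<in> X - downset X"
      show "?T s = 0"
      proof (cases "s = 0")
        case True
        then show ?thesis using eq_0[of 0] by simp
      next
        case False
        then have "s - 1 \<in> X - {s}" "int (s - 1) = int s - 1" using * by (auto simp: downset_def)
        moreover from this(2) have "\<psi> (int s - 1 - int (s - 1)) / \<psi> (int s - int (s - 1)) = 0"
          by (simp only:) (simp add: eq_0)
        ultimately have "(\<Prod>j\<in>X-{s}. \<psi> (int s - 1 - int j) / \<psi> (int s - int j)) = 0"
          using assms by (intro prod_zero) blast+
        then show "?T s = 0" by simp
      qed
    qed
  qed (use assms in \<open>auto simp: downset_def\<close>)
  also have "\<dots> = (\<Sum>s\<in>int ` X. (\<Prod>j\<in>int ` X-{s}. \<psi> (s - 1 - j) / \<psi> (s - j)) * \<psi> s)"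
    by (simp add: sum.reindex im prod.reindex)
  finally show ?thesis .
qed

end

section \<open>The recurrence for weighted hook sums\<close>

definition hyp :: "complex \<Rightarrow> nat \<Rightarrow> complex" where
  "hyp w h = (1 + w ^ h) / (1 - w ^ h)"

lemma hyp_eq: "1 / psi w (int h) = hyp w h"
  by (simp add: psi_def hyp_def)

context no_root begin

lemma hyp_up_down:
  assumes "finite X" "0 \<in> X"
  shows "(\<Sum>s\<in>upset X. hook_prod (hyp w) (up s X)) =
    hyp w 1 * hook_prod (hyp w) X + (\<Sum>s\<in>downset X. hook_prod (hyp w) (down s X))"
proof -
  interpret odd_weight "psi w"
    using psi_uminus psi_eq_0_iff by unfold_locales auto
  have recip: "recip = hyp w" by (auto simp: recip_def hyp_eq)
  have "hook_prod recip X * (\<Sum>s\<in>int ` X. (\<Prod>j\<in>int ` X-{s}. psi w (s + 1 - j) / psi w (s - j)) / psi w (s + 1)) =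
    hook_prod recip X * (hyp w 1 + (\<Sum>s\<in>int ` X. (\<Prod>j\<in>int ` X-{s}. psi w (s - 1 - j) / psi w (s - j)) * psi w s))"
  proof -
    have "s \<ge> 0" if "s \<in> int ` X" for s using that by auto
    from psi_move_identity[OF _ _ this] show ?thesis using assms hyp_eq[of w 1] by simp
  qed
  then show ?thesis
    using sum_hook_prod_up[OF assms(1)] sum_hook_prod_down[OF assms(1)] unfolding recip
    by (simp add: distrib_left mult.commute)
qed

end

definition lin :: "nat \<Rightarrow> complex" where
  "lin h = 1 / of_nat h"

lemma of_nat_choose_2: "of_nat (k choose 2) = (of_nat k * (of_nat k - 1) / 2 :: 'a::field_char_0)"
  by (induction k) (simp_all add: numeral_2_eq_2 field_simps)

text \<open>For the weight \<open>1 / h\<close> the nodes are the beads themselves. The constant in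
  \<open>sum_down_moves\<close> is \<open>card X choose 2\<close>, so \<open>card_nhooks\<close>
  turns the sum over down moves into the number of hooks.\<close>

lemma
  assumes "finite X"
  shows lin_up: "0 \<in> X \<Longrightarrow> (\<Sum>s\<in>upset X. hook_prod lin (up s X)) = hook_prod lin X"
    and lin_down: "(\<Sum>s\<in>downset X. hook_prod lin (down s X)) = of_nat (card (nhooks X)) * hook_prod lin X"
proof -
  interpret odd_weight "of_int :: int \<Rightarrow> complex"
    by unfold_locales auto
  have recip: "recip = lin" by (auto simp: recip_def lin_def)
  define A where "A = (of_int :: int \<Rightarrow> complex) ` int ` X"
  have inj: "inj_on (of_int :: int \<Rightarrow> complex) B" for B by (auto simp: inj_on_def)
  have A: "finite A" "card A = card X" "\<Sum>A = of_nat (\<Sum>X)"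
    using assms by (auto simp: A_def card_image sum.reindex inj image_image inj_on_def)
  have im: "of_int ` int ` X - {of_int s} = (of_int :: int \<Rightarrow> complex) ` (int ` X - {s})" for s
    using image_set_diff[OF inj[of UNIV], of "int ` X" "{s}"] by simp
  show "(\<Sum>s\<in>upset X. hook_prod lin (up s X)) = hook_prod lin X" if "0 \<in> X"
  proof -
    have "-1 \<notin> A"
    proof
      assume "-1 \<in> A"
      then obtain x where "(of_nat x :: complex) = -1" by (auto simp: A_def)
      then have "(of_nat (Suc x) :: complex) = 0" by simp
      then show False by (simp only: of_nat_eq_0_iff)
    qed
    moreover have "0 \<in> A" using that by (auto simp: A_def intro!: image_eqI[of _ _ 0])
    ultimately have "(\<Sum>a\<in>A. (\<Prod>b\<in>A-{a}. (a + 1 - b) / (a - b)) / (a + 1)) = 1"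
      using A by (intro sum_up_moves) auto
    then have "(\<Sum>s\<in>int ` X. (\<Prod>j\<in>int ` X-{s}. of_int (s + 1 - j) / of_int (s - j)) / of_int (s + 1)) = (1 :: complex)"
      unfolding A_def by (simp add: sum.reindex[OF inj] im prod.reindex[OF inj])
    then show ?thesis using sum_hook_prod_up[OF assms] by (simp only: recip mult_1_right)
  qed
  have "(\<Sum>a\<in>A. (\<Prod>b\<in>A-{a}. (a - 1 - b) / (a - b)) * a) =
      of_nat (\<Sum>X) - of_nat (card X) * (of_nat (card X) - 1) / 2"
    using sum_down_moves[OF A(1)] by (simp only: A)
  also have "of_nat (card X) * (of_nat (card X) - 1) / 2 = (of_nat (card X choose 2) :: complex)"
    by (rule of_nat_choose_2[symmetric])
  also have "of_nat (\<Sum>X) - \<dots> = (of_nat (card (nhooks X)) :: complex)"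
    by (simp flip: card_nhooks[OF assms])
  finally have "(\<Sum>s\<in>int ` X. (\<Prod>j\<in>int ` X-{s}. of_int (s - 1 - j) / of_int (s - j)) * of_int s) =
      (of_nat (card (nhooks X)) :: complex)"
    unfolding A_def by (simp add: sum.reindex[OF inj] im prod.reindex[OF inj])
  then show "(\<Sum>s\<in>downset X. hook_prod lin (down s X)) = of_nat (card (nhooks X)) * hook_prod lin X"
    using sum_hook_prod_down[OF assms] by (simp only: recip mult.commute)
qed

definition han_weight :: "complex \<Rightarrow> nat \<Rightarrow> complex" where
  "han_weight w h = lin h * hyp w h"

text \<open>The bound on \<open>n\<close> puts 0 into every beta-set with \<open>n\<close> or
  \<open>n - 1\<close> hooks, so that \<open>hyp_up_down\<close> applies after the first regrouping
  and \<open>lin_up\<close> after the second.\<close>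

lemma (in no_root) hook_sum_rec_nonzero:
  assumes "Suc n < k"
  shows "of_nat (Suc n) * hook_sum (han_weight w) k (Suc n) =
    hyp w 1 * hook_sum (han_weight w) k n +
    (case n of 0 \<Rightarrow> 0 | Suc m \<Rightarrow> hook_sum (han_weight w) k m)"
proof -
  let ?d = "hook_prod lin" and ?g = "hook_prod (hyp w)"
  have hp: "hook_prod (han_weight w) X = ?d X * ?g X" for X
    unfolding hook_prod_mult[symmetric] han_weight_def[abs_def] ..
  have fin: "finite X" if "X \<in> beta_sets k n" for X n
    using that by (simp add: beta_sets_def)
  have "of_nat (Suc n) * hook_sum (han_weight w) k (Suc n) =
      (\<Sum>X\<in>beta_sets k (Suc n). (of_nat (Suc n) * ?d X) * ?g X)"
    unfolding hook_sum_def hp by (simp add: sum_distrib_left mult.assoc)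
  also have "\<dots> = (\<Sum>X\<in>beta_sets k (Suc n). \<Sum>s\<in>downset X. ?d (down s X) * ?g X)"
  proof (intro sum.cong refl)
    fix X assume X: "X \<in> beta_sets k (Suc n)"
    then show "of_nat (Suc n) * ?d X * ?g X = (\<Sum>s\<in>downset X. ?d (down s X) * ?g X)"
      using lin_down[OF fin[OF X]] by (simp add: beta_sets_def sum_distrib_right[symmetric])
  qed
  also have "\<dots> = (\<Sum>Y\<in>beta_sets k n. \<Sum>s\<in>upset Y. ?d Y * ?g (up s Y))"
    by (rule sum_down_eq_sum_up)
  also have "\<dots> = (\<Sum>Y\<in>beta_sets k n. hyp w 1 * (?d Y * ?g Y) + (\<Sum>s\<in>downset Y. ?d Y * ?g (down s Y)))"
  proof (intro sum.cong refl)
    fix Y assume Y: "Y \<in> beta_sets k n"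
    then have "0 \<in> Y" using assms by (auto intro: zero_in_beta_set)
    with hyp_up_down[OF fin[OF Y] this]
    show "(\<Sum>s\<in>upset Y. ?d Y * ?g (up s Y)) = hyp w 1 * (?d Y * ?g Y) + (\<Sum>s\<in>downset Y. ?d Y * ?g (down s Y))"
      by (simp add: sum_distrib_left[symmetric] algebra_simps)
  qed
  also have "\<dots> = hyp w 1 * hook_sum (han_weight w) k n + (\<Sum>Y\<in>beta_sets k n. \<Sum>s\<in>downset Y. ?d Y * ?g (down s Y))"
    unfolding hook_sum_def hp by (simp add: sum.distrib sum_distrib_left)
  also have "(\<Sum>Y\<in>beta_sets k n. \<Sum>s\<in>downset Y. ?d Y * ?g (down s Y)) =
     (case n of 0 \<Rightarrow> 0 | Suc m \<Rightarrow> hook_sum (han_weight w) k m)"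
  proof (cases n)
    case 0
    have "downset {..<k} = {}" by (auto simp: downset_def)
    with 0 show ?thesis by (simp add: beta_sets_0)
  next
    case (Suc m)
    have "(\<Sum>Y\<in>beta_sets k (Suc m). \<Sum>s\<in>downset Y. ?d Y * ?g (down s Y)) =
      (\<Sum>Y\<in>beta_sets k m. \<Sum>s\<in>upset Y. ?d (up s Y) * ?g Y)"
      by (rule sum_down_eq_sum_up)
    also have "\<dots> = (\<Sum>Y\<in>beta_sets k m. ?d Y * ?g Y)"
    proof (intro sum.cong refl)
      fix Y assume Y: "Y \<in> beta_sets k m"
      then have "0 \<in> Y" using assms Suc by (auto intro: zero_in_beta_set)
      with lin_up[OF fin[OF Y] this]
      show "(\<Sum>s\<in>upset Y. ?d (up s Y) * ?g Y) = ?d Y * ?g Y"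
        by (simp add: sum_distrib_right[symmetric])
    qed
    finally show ?thesis using Suc by (simp add: hook_sum_def hp)
  qed
  finally show ?thesis .
qed

text \<open>At \<open>w = 0\<close> the nodes of the partial-fraction identity collide, so the recurrence is
  carried over by continuity.\<close>

lemma isCont_hook_sum: "isCont (\<lambda>w. hook_sum (han_weight w) k n) 0"
proof -
  have "isCont (\<lambda>w. han_weight w h) 0" if "h > 0" for h
    unfolding han_weight_def hyp_def using that by (intro continuous_intros) (auto simp: power_0_left)
  then show ?thesis
    unfolding hook_sum_def hook_prod_def case_prod_unfold
    by (intro continuous_intros) (auto simp: nhooks_def)
qed

lemma hook_sum_rec:
  assumes "\<And>h. h > 0 \<Longrightarrow> w ^ h \<noteq> 1" "Suc n < k"
  shows "of_nat (Suc n) * hook_sum (han_weight w) k (Suc n) =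
    hyp w 1 * hook_sum (han_weight w) k n +
    (case n of 0 \<Rightarrow> 0 | Suc m \<Rightarrow> hook_sum (han_weight w) k m)"
proof (cases "w = 0")
  case False
  then interpret no_root w using assms by unfold_locales auto
  show ?thesis using assms by (intro hook_sum_rec_nonzero)
next
  case True
  let ?L = "\<lambda>w. of_nat (Suc n) * hook_sum (han_weight w) k (Suc n)"
  let ?R = "\<lambda>w. hyp w 1 * hook_sum (han_weight w) k n +
    (case n of 0 \<Rightarrow> 0 | Suc m \<Rightarrow> hook_sum (han_weight w) k m)"
  have "isCont ?L 0" by (intro continuous_intros isCont_hook_sum)
  then have L: "(?L \<longlongrightarrow> ?L 0) (at 0)" by (simp only: isCont_def)
  have "isCont (\<lambda>w. case n of 0 \<Rightarrow> 0 | Suc m \<Rightarrow> hook_sum (han_weight w) k m) 0"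
    by (cases n) (auto intro: isCont_hook_sum)
  then have "isCont ?R 0"
    unfolding hyp_def by (intro continuous_intros isCont_hook_sum) auto
  then have R: "(?R \<longlongrightarrow> ?R 0) (at 0)" by (simp only: isCont_def)
  have "\<forall>\<^sub>F w in at 0. ?L w = ?R w"
    unfolding eventually_at
  proof (intro exI[of _ 1] conjI ballI impI)
    \<comment> \<open>In the punctured unit disc no positive power of \<open>v\<close> is 1, so the
      nonzero case holds all around 0.\<close>
    fix v :: complex assume v: "v \<noteq> 0 \<and> dist v 0 < 1"
    have "v ^ h \<noteq> 1" if "h > 0" for h
    proof
      assume "v ^ h = 1"
      then have "norm v ^ h = 1" by (metis norm_one norm_power)
      moreover have "norm v ^ h < 1" using v that by (simp add: power_less_one_iff)
      ultimately show False by simp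
    qed
    then interpret no_root v using v by unfold_locales auto
    show "?L v = ?R v" using assms by (intro hook_sum_rec_nonzero)
  qed simp
  then have "(?L \<longlongrightarrow> ?R 0) (at 0)" using R by (simp add: filterlim_cong)
  with L show ?thesis unfolding True by (intro tendsto_unique[OF _ L]) auto
qed

section \<open>Counting partitions with a bounded number of parts\<close>

lemma card_nhooks_image_Suc:
  assumes "finite X"
  shows "card (nhooks (Suc ` X)) = card (nhooks X) + card X"
    and "card (nhooks (insert 0 (Suc ` X))) = card (nhooks X)"
proof -
  have sum: "\<Sum>(Suc ` X) = \<Sum>X + card X" by (simp add: sum.reindex sum_Suc)
  then show "card (nhooks (Suc ` X)) = card (nhooks X) + card X"
    using card_nhooks[of X] card_nhooks[of "Suc ` X"] assms by (simp add: card_image)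
  have "\<Sum>(insert 0 (Suc ` X)) = \<Sum>X + card X" using sum assms by simp
  moreover have "card (insert 0 (Suc ` X)) = Suc (card X)" using assms by (simp add: card_image)
  ultimately show "card (nhooks (insert 0 (Suc ` X))) = card (nhooks X)"
    using card_nhooks[of X] card_nhooks[of "insert 0 (Suc ` X)"] assms by (simp add: numeral_2_eq_2)
qed

text \<open>A beta-set containing 0 has an empty last row, which is dropped; otherwise 1 is
  subtracted from each of the \<open>k + 1\<close> parts.\<close>

lemma card_beta_sets_Suc:
  "card (beta_sets (Suc k) n) = card (beta_sets k n) +
     (if Suc k \<le> n then card (beta_sets (Suc k) (n - Suc k)) else 0)"
proof -
  let ?B = "if Suc k \<le> n then beta_sets (Suc k) (n - Suc k) else {}"
  have pred: "\<exists>Y. finite Y \<and> X - {0} = Suc ` Y" if "finite X" for X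
    using that by (intro exI[of _ "(\<lambda>x. x - 1) ` (X - {0})"]) (force simp: image_image)
  have "beta_sets (Suc k) n = (\<lambda>Y. insert 0 (Suc ` Y)) ` beta_sets k n \<union> (`) Suc ` ?B"
    (is "_ = ?U \<union> ?V")
  proof (intro equalityI subsetI)
    fix X assume X: "X \<in> beta_sets (Suc k) n"
    then obtain Y where Y: "finite Y" "X - {0} = Suc ` Y" using pred[of X] by (auto simp: beta_sets_def)
    show "X \<in> ?U \<union> ?V"
    proof (cases "0 \<in> X")
      case True
      then have eq: "X = insert 0 (Suc ` Y)" using Y(2) by blast
      have "Y \<in> beta_sets k n"
        using X Y(1) card_nhooks_image_Suc(2)[OF Y(1)] unfolding eq by (simp add: beta_sets_def card_image)
      then show ?thesis unfolding eq by blast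
    next
      case False
      then have eq: "X = Suc ` Y" using Y(2) by simp
      have "Y \<in> ?B"
        using X Y(1) card_nhooks_image_Suc(1)[OF Y(1)] unfolding eq by (auto simp: beta_sets_def card_image)
      then show ?thesis unfolding eq by blast
    qed
  next
    fix X assume "X \<in> ?U \<union> ?V"
    then show "X \<in> beta_sets (Suc k) n"
    proof
      assume "X \<in> ?U"
      then obtain Y where "X = insert 0 (Suc ` Y)" "Y \<in> beta_sets k n" by blast
      then show ?thesis using card_nhooks_image_Suc(2)[of Y] by (simp add: beta_sets_def card_image)
    next
      assume "X \<in> ?V"
      then obtain Y where "X = Suc ` Y" "Y \<in> ?B" by blast
      then show ?thesis using card_nhooks_image_Suc(1)[of Y] by (simp add: beta_sets_def card_image split: if_splits)
    qed
  qed
  moreover have "inj_on (\<lambda>Y. insert 0 (Suc ` Y)) (beta_sets k n)"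
    by (auto simp: inj_on_def)
  moreover have "inj_on ((`) Suc) ?B"
    by (simp add: inj_on_def inj_image_eq_iff)
  moreover have "?U \<inter> ?V = {}" by auto
  ultimately show ?thesis
    using finite_beta_sets by (simp add: card_Un_disjoint card_image)
qed

lemma card_beta_sets_0: "card (beta_sets 0 n) = (if n = 0 then 1 else 0)"
proof -
  have "beta_sets 0 n = (if n = 0 then {{}} else {})" by (auto simp: beta_sets_def nhooks_def)
  then show ?thesis by simp
qed

lemma hook_sum_one: "hook_sum (\<lambda>_. 1) k n = of_nat (card (beta_sets k n))"
  by (simp add: hook_sum_def hook_prod_def case_prod_unfold)

section \<open>Maya diagrams and their residue classes\<close>

definition maya :: "int set \<Rightarrow> bool" where
  "maya S \<longleftrightarrow> finite {s\<in>S. s \<ge> 0} \<and> finite {g. g \<notin> S \<and> g < 0}"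

text \<open>The sum of \<open>h\<close> over \<open>S\<close>, regularised by subtracting the sum over all negative integers.\<close>

definition rsum :: "(int \<Rightarrow> int) \<Rightarrow> int set \<Rightarrow> int" where
  "rsum h S = (\<Sum>s\<in>{s\<in>S. s \<ge> 0}. h s) - (\<Sum>g\<in>{g. g \<notin> S \<and> g < 0}. h g)"

definition charge :: "int set \<Rightarrow> int" where
  "charge S = rsum (\<lambda>_. 1) S"

definition hooks :: "int set \<Rightarrow> (int \<times> int) set" where
  "hooks S = {(s, g). s \<in> S \<and> g \<notin> S \<and> g < s}"

text \<open>The window from \<open>- N\<close> upwards, moved to the naturals. If a Maya diagram is
  filled below \<open>- N\<close>, this is a beta-set with the same hooks.\<close>

definition trunc :: "nat \<Rightarrow> int set \<Rightarrow> nat set" where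
  "trunc N S = {x. int x - int N \<in> S}"

definition filled_below :: "nat \<Rightarrow> int set \<Rightarrow> bool" where
  "filled_below N S \<longleftrightarrow> (\<forall>s < - int N. s \<in> S)"

lemma filled_belowD: "filled_below N S \<Longrightarrow> g \<notin> S \<Longrightarrow> - int N \<le> g"
  unfolding filled_below_def by (meson not_le)

lemma maya_lower_bound:
  assumes "maya S"
  obtains N :: nat where "filled_below N S"
proof -
  have fin: "finite {g. g \<notin> S \<and> g < 0}" using assms by (simp add: maya_def)
  define N where "N = nat (\<Sum>g\<in>{g. g \<notin> S \<and> g < 0}. - g)"
  have "s \<in> S" if "s < - int N" for s
  proof (rule ccontr)
    assume "s \<notin> S"
    then have "s \<in> {g. g \<notin> S \<and> g < 0}" using that by auto
    from member_le_sum[OF this _ fin, of uminus] have "- s \<le> (\<Sum>g\<in>{g. g \<notin> S \<and> g < 0}. - g)" by auto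
    then show False using that unfolding N_def by linarith
  qed
  then show ?thesis using that unfolding filled_below_def by blast
qed

lemma finite_trunc:
  assumes "maya S"
  shows "finite (trunc N S)"
proof -
  have "trunc N S \<subseteq> {..<N} \<union> nat ` ((\<lambda>s. s + int N) ` {s\<in>S. s \<ge> 0})"
  proof
    fix x assume "x \<in> trunc N S"
    then have "int x - int N \<in> S" "x = nat (int x - int N + int N)" by (auto simp: trunc_def)
    then show "x \<in> {..<N} \<union> nat ` ((\<lambda>s. s + int N) ` {s\<in>S. s \<ge> 0})"
      by (cases "x < N") (auto intro!: image_eqI)
  qed
  then show ?thesis using assms by (auto simp: maya_def intro: finite_subset)
qed

text \<open>The beads between \<open>- N\<close> and 0 occur in both sums on the right and
  cancel.\<close>

lemma rsum_trunc:
  assumes "maya S" and N: "filled_below N S"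
  shows "rsum h S = (\<Sum>x\<in>trunc N S. h (int x - int N)) - (\<Sum>x<N. h (int x - int N))"
proof -
  let ?P = "{s\<in>S. s \<ge> 0}" and ?G = "{g. g \<notin> S \<and> g < 0}" and ?I = "{- int N..<0} \<inter> S"
  have fin: "finite ?P" "finite ?G" using assms by (simp_all add: maya_def)
  have "(\<Sum>x\<in>trunc N S. h (int x - int N)) = (\<Sum>s\<in>?P \<union> ?I. h s)"
    by (rule sum.reindex_bij_witness[of _ "\<lambda>s. nat (s + int N)" "\<lambda>x. int x - int N"]) (auto simp: trunc_def)
  also have "\<dots> = sum h ?P + sum h ?I"
    using fin by (intro sum.union_disjoint) auto
  finally have 1: "(\<Sum>x\<in>trunc N S. h (int x - int N)) = sum h ?P + sum h ?I" .
  have "(\<Sum>x<N. h (int x - int N)) = (\<Sum>s\<in>?G \<union> ?I. h s)"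
  proof (rule sum.reindex_bij_witness[of _ "\<lambda>s. nat (s + int N)" "\<lambda>x. int x - int N"])
    fix s assume s: "s \<in> ?G \<union> ?I"
    then have "- int N \<le> s" "s < 0" using filled_belowD[OF N, of s] by auto
    then show "int (nat (s + int N)) - int N = s" "nat (s + int N) \<in> {..<N}" by auto
  qed auto
  also have "\<dots> = sum h ?G + sum h ?I"
    using fin by (intro sum.union_disjoint) auto
  finally show ?thesis using 1 by (simp add: rsum_def)
qed

lemma card_trunc:
  assumes "maya S" "filled_below N S"
  shows "int (card (trunc N S)) = int N + charge S"
  using rsum_trunc[OF assms, where h = "\<lambda>_. 1"] by (simp add: charge_def)

lemma bij_betw_hooks_trunc:
  assumes "filled_below N S"
  shows "bij_betw (\<lambda>(x, y). (int x - int N, int y - int N)) (nhooks (trunc N S)) (hooks S)"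
proof (rule bij_betw_byWitness[where f' = "\<lambda>(s, g). (nat (s + int N), nat (g + int N))"])
  note filled_belowD[OF assms]
  then show "(\<lambda>(s, g). (nat (s + int N), nat (g + int N))) ` hooks S \<subseteq> nhooks (trunc N S)"
    "\<forall>p\<in>hooks S. (\<lambda>(x, y). (int x - int N, int y - int N)) ((\<lambda>(s, g). (nat (s + int N), nat (g + int N))) p) = p"
    by (force simp: hooks_def nhooks_def trunc_def)+
qed (auto simp: hooks_def nhooks_def trunc_def)

lemma finite_hooks: "maya S \<Longrightarrow> finite (hooks S)"
  by (metis maya_lower_bound bij_betw_hooks_trunc bij_betw_finite finite_nhooks finite_trunc)

lemma card_hooks_trunc:
  assumes "filled_below N S"
  shows "card (hooks S) = card (nhooks (trunc N S))"
  using bij_betw_same_card[OF bij_betw_hooks_trunc[OF assms]] by simp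

definition hooks_prod :: "(nat \<Rightarrow> 'a) \<Rightarrow> int set \<Rightarrow> 'a::comm_monoid_mult" where
  "hooks_prod f S = (\<Prod>(s, g)\<in>hooks S. f (nat (s - g)))"

lemma hooks_prod_trunc:
  assumes "filled_below N S"
  shows "hooks_prod f S = hook_prod f (trunc N S)"
proof -
  have "hooks_prod f S = (\<Prod>(x, y)\<in>nhooks (trunc N S). f (nat (int x - int y)))"
    unfolding hooks_prod_def prod.reindex_bij_betw[OF bij_betw_hooks_trunc[OF assms], symmetric]
    by (simp add: case_prod_unfold)
  also have "\<dots> = hook_prod f (trunc N S)"
    unfolding hook_prod_def by (intro prod.cong refl) (auto simp: nhooks_def nat_diff_distrib)
  finally show ?thesis .
qed

text \<open>The vacuum of charge \<open>c\<close>, all integers below \<open>c\<close>, has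
  regularised sum c(c-1)/2, and every hook adds 1. Doubling avoids a division.\<close>

lemma rsum_id:
  assumes "maya S"
  shows "2 * rsum (\<lambda>s. s) S = 2 * int (card (hooks S)) + charge S * (charge S - 1)"
proof -
  obtain N where N: "filled_below N S" using maya_lower_bound[OF assms] by blast
  let ?X = "trunc N S"
  have tri: "2 * int (k choose 2) = int k * (int k - 1)" for k
    by (induction k) (simp_all add: numeral_2_eq_2 algebra_simps)
  have gauss: "2 * (\<Sum>x<N. int x - int N) = - int N * (int N + 1)"
  proof -
    have "(\<Sum>x<N. int x) = int (N choose 2)"
      by (induction N) (simp_all add: numeral_2_eq_2)
    then show ?thesis using tri[of N] by (simp add: sum_subtractf algebra_simps)
  qed
  have "rsum (\<lambda>s. s) S = int (\<Sum>?X) - int (card ?X) * int N - (\<Sum>x<N. int x - int N)"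
  proof -
    have "(\<Sum>x\<in>X. int x - int N) = int (\<Sum>X) - int (card X) * int N" for X
      by (simp add: sum_subtractf)
    then show ?thesis using rsum_trunc[OF assms N, of "\<lambda>s. s"] by simp
  qed
  also have "int (\<Sum>?X) = int (card (hooks S)) + int (card ?X choose 2)"
    using arg_cong[OF card_nhooks[OF finite_trunc[OF assms], of N], of int] by (simp add: card_hooks_trunc[OF N])
  finally have "2 * rsum (\<lambda>s. s) S = 2 * int (card (hooks S)) + int (card ?X) * (int (card ?X) - 1)
     - 2 * int (card ?X) * int N + int N * (int N + 1)"
    using tri[of "card ?X"] gauss by (simp add: algebra_simps)
  then show ?thesis unfolding card_trunc[OF assms N] by (simp add: algebra_simps)
qed

definition mayas :: "int \<Rightarrow> nat \<Rightarrow> int set set" where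
  "mayas c n = {S. maya S \<and> charge S = c \<and> card (hooks S) = n}"

text \<open>A gap forms a hook with every bead above it, so with \<open>n\<close> hooks in all it
  cannot lie below \<open>c - n\<close>. The bound depends on \<open>c\<close> and \<open>n\<close>
  alone, which lets one window serve the whole family.\<close>

lemma mayas_lower_bound:
  assumes S: "S \<in> mayas c n" and N: "int N \<ge> int n - c" and s: "s < - int N"
  shows "s \<in> S"
proof (rule ccontr)
  assume "s \<notin> S"
  have m: "maya S" "charge S = c" "card (hooks S) = n" using S by (auto simp: mayas_def)
  obtain M0 where M0: "filled_below M0 S" using maya_lower_bound[OF m(1)] by blast
  define g where "g = nat (s + int M0)"
  have g: "int g = s + int M0" using filled_belowD[OF M0 \<open>s \<notin> S\<close>] by (simp add: g_def)
  let ?X = "trunc M0 S"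
  have fin: "finite ?X" by (rule finite_trunc[OF m(1)])
  have "g \<notin> ?X" using \<open>s \<notin> S\<close> g by (simp add: trunc_def)
  have "card ?X = card ({x\<in>?X. x > g} \<union> {x\<in>?X. x < g})"
    using \<open>g \<notin> ?X\<close> by (intro arg_cong[of _ _ card]) (auto, metis linorder_neqE_nat)
  also have "\<dots> \<le> card {x\<in>?X. x > g} + card {x\<in>?X. x < g}" by (rule card_Un_le)
  also have "card {x\<in>?X. x < g} \<le> card {..<g}" by (intro card_mono) auto
  finally have "card ?X \<le> card {x\<in>?X. x > g} + g" by simp
  moreover have "card ({x\<in>?X. x > g} \<times> {g}) \<le> card (nhooks ?X)"
    using \<open>g \<notin> ?X\<close> by (intro card_mono finite_nhooks fin) (auto simp: nhooks_def)
  ultimately have "card ?X \<le> n + g" using card_hooks_trunc[OF M0] m by (simp add: card_cartesian_product)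
  then show False using card_trunc[OF m(1) M0] m(2) N s g by linarith
qed

lemma bij_betw_trunc:
  assumes N: "int N \<ge> int n - c" and k: "int k = int N + c"
  shows "bij_betw (trunc N) (mayas c n) (beta_sets k n)"
proof (rule bij_betw_byWitness[where f' = "\<lambda>X. {s. s < - int N} \<union> (\<lambda>x. int x - int N) ` X"])
  have lb: "s \<in> S" if "S \<in> mayas c n" "s < - int N" for S s
    using mayas_lower_bound[OF that(1) N that(2)] .
  show "\<forall>S\<in>mayas c n. {s. s < - int N} \<union> (\<lambda>x. int x - int N) ` trunc N S = S"
  proof
    fix S assume "S \<in> mayas c n"
    show "{s. s < - int N} \<union> (\<lambda>x. int x - int N) ` trunc N S = S"
    proof (intro equalityI subsetI)
      fix s assume "s \<in> S"
      show "s \<in> {s. s < - int N} \<union> (\<lambda>x. int x - int N) ` trunc N S"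
      proof (cases "s < - int N")
        case False
        then have "s = int (nat (s + int N)) - int N" by simp
        with \<open>s \<in> S\<close> have "nat (s + int N) \<in> trunc N S" by (simp add: trunc_def)
        then show ?thesis using \<open>s = _\<close> by blast
      qed simp
    qed (auto simp: trunc_def lb[OF \<open>S \<in> mayas c n\<close>])
  qed
  have inv: "trunc N ({s. s < - int N} \<union> (\<lambda>x. int x - int N) ` X) = X" for X
    by (auto simp: trunc_def)
  then show "\<forall>X\<in>beta_sets k n. trunc N ({s. s < - int N} \<union> (\<lambda>x. int x - int N) ` X) = X" by simp
  show "trunc N ` mayas c n \<subseteq> beta_sets k n"
  proof
    fix X assume "X \<in> trunc N ` mayas c n"
    then obtain S where S: "S \<in> mayas c n" "X = trunc N S" by blast
    then have "maya S" "charge S = c" "card (hooks S) = n" by (auto simp: mayas_def)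
    then show "X \<in> beta_sets k n"
      using S k finite_trunc[of S N] card_trunc[of S N] card_hooks_trunc[of N S] lb[OF S(1)]
      by (auto simp: beta_sets_def filled_below_def)
  qed
  show "(\<lambda>X. {s. s < - int N} \<union> (\<lambda>x. int x - int N) ` X) ` beta_sets k n \<subseteq> mayas c n"
  proof
    fix S assume "S \<in> (\<lambda>X. {s. s < - int N} \<union> (\<lambda>x. int x - int N) ` X) ` beta_sets k n"
    then obtain X where X: "X \<in> beta_sets k n" and S: "S = {s. s < - int N} \<union> (\<lambda>x. int x - int N) ` X"
      by blast
    have fin: "finite X" using X by (simp add: beta_sets_def)
    have "{s\<in>S. s \<ge> 0} \<subseteq> (\<lambda>x. int x - int N) ` X" "{g. g \<notin> S \<and> g < 0} \<subseteq> {- int N..<0}"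
      by (auto simp: S)
    then have "maya S" using fin by (auto simp: maya_def intro: finite_subset)
    moreover have "filled_below N S" by (simp add: S filled_below_def)
    moreover have "trunc N S = X" unfolding S by (rule inv)
    ultimately show "S \<in> mayas c n"
      using card_trunc[of S N] card_hooks_trunc[of N S] X k by (auto simp: mayas_def beta_sets_def)
  qed
qed

lemma finite_mayas: "finite (mayas c n)"
  using bij_betw_finite[OF bij_betw_trunc[of n c "nat (\<bar>c\<bar> + int n)" "nat (\<bar>c\<bar> + int n + c)"]] finite_beta_sets
  by auto

text \<open>The charge affects only the number \<open>k\<close> of beads. It is chosen above
  \<open>n\<close>, the range in which the hook sums to be used do not depend on it.\<close>

lemma sum_hooks_prod_mayas:
  fixes f :: "nat \<Rightarrow> 'a::comm_semiring_1"
  obtains k where "k > n" "(\<Sum>S\<in>mayas c n. hooks_prod f S) = hook_sum f k n"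
proof -
  define N where "N = nat (\<bar>c\<bar> + int n + 1)"
  define k where "k = nat (int N + c)"
  have N: "int N \<ge> int n - c" and k: "int k = int N + c" "k > n" by (auto simp: N_def k_def)
  have "(\<Sum>S\<in>mayas c n. hooks_prod f S) = (\<Sum>S\<in>mayas c n. hook_prod f (trunc N S))"
    by (intro sum.cong refl hooks_prod_trunc) (auto simp: filled_below_def intro: mayas_lower_bound[OF _ N])
  also have "\<dots> = hook_sum f k n"
    unfolding hook_sum_def by (rule sum.reindex_bij_betw[OF bij_betw_trunc[OF N k(1)]])
  finally show ?thesis using that k by blast
qed

section \<open>Reflection of Maya diagrams, and their runners\<close>

definition reflect :: "int set \<Rightarrow> int set" where
  "reflect S = {m. - 1 - m \<notin> S}"

lemma reflect_reflect [simp]: "reflect (reflect S) = S"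
  by (simp add: reflect_def)

lemma bij_betw_reflect_gaps: "bij_betw (\<lambda>m. - 1 - m) {g. g \<notin> S \<and> g < 0} {s \<in> reflect S. s \<ge> 0}"
  by (rule bij_betw_byWitness[where f' = "\<lambda>m. - 1 - m"]) (auto simp: reflect_def)

lemma bij_betw_reflect_beads: "bij_betw (\<lambda>m. - 1 - m) {s \<in> S. s \<ge> 0} {g. g \<notin> reflect S \<and> g < 0}"
  by (rule bij_betw_byWitness[where f' = "\<lambda>m. - 1 - m"]) (auto simp: reflect_def)

lemma maya_reflect: "maya S \<Longrightarrow> maya (reflect S)"
  unfolding maya_def
  using bij_betw_finite[OF bij_betw_reflect_gaps[of S]] bij_betw_finite[OF bij_betw_reflect_beads[of S]] by simp

lemma rsum_reflect: "rsum h (reflect S) = - rsum (\<lambda>m. h (- 1 - m)) S"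
  unfolding rsum_def
  by (simp add: sum.reindex_bij_betw[OF bij_betw_reflect_gaps, symmetric]
      sum.reindex_bij_betw[OF bij_betw_reflect_beads, symmetric])

lemma hooks_prod_reflect: "hooks_prod f (reflect S) = hooks_prod f S"
  unfolding hooks_prod_def
  by (rule prod.reindex_bij_witness[of _ "\<lambda>(s, g). (- 1 - g, - 1 - s)" "\<lambda>(s, g). (- 1 - g, - 1 - s)"])
    (auto simp: hooks_def reflect_def)

definition sym_mayas :: "int set set" where
  "sym_mayas = {S. maya S \<and> reflect S = S}"

lemma sym_mayas_iff: "S \<in> sym_mayas \<Longrightarrow> - 1 - m \<in> S \<longleftrightarrow> m \<notin> S"
  by (auto simp: sym_mayas_def reflect_def)

text \<open>The \<open>r\<close>-th runner of the \<open>t\<close>-abacus. The charges of the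
  runners encode the \<open>t\<close>-core, their hooks the \<open>t\<close>-quotient.\<close>

definition runner :: "nat \<Rightarrow> nat \<Rightarrow> int set \<Rightarrow> int set" where
  "runner t r S = {m. int t * m + int r \<in> S}"

context
  fixes t :: nat
  assumes t: "t > 0"
begin

lemma runner_nonneg_iff: "r < t \<Longrightarrow> int t * m + int r \<ge> 0 \<longleftrightarrow> m \<ge> 0"
proof
  assume r: "r < t" and *: "int t * m + int r \<ge> 0"
  show "m \<ge> 0"
  proof (rule ccontr)
    assume "\<not> m \<ge> 0"
    then have "int t * (m + 1) \<le> 0" using t by (intro mult_nonneg_nonpos) auto
    then show False using r * by (simp add: algebra_simps)
  qed
qed simp

lemma runner_coords: "r < t \<Longrightarrow> (int t * m + int r) div int t = m \<and> nat ((int t * m + int r) mod int t) = r"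
  by simp

lemma runner_recombine: "int t * (s div int t) + int (nat (s mod int t)) = s \<and> nat (s mod int t) < t"
  using t pos_mod_bound[of "int t" s] pos_mod_sign[of "int t" s]
  by (auto simp: nat_less_iff)

lemma inj_runner: "inj (\<lambda>m. int t * m + int r)"
  using t by (auto simp: inj_on_def)

lemma maya_runner:
  assumes "maya S" "r < t"
  shows "maya (runner t r S)"
proof -
  let ?f = "\<lambda>m. int t * m + int r"
  have "{m \<in> runner t r S. m \<ge> 0} = ?f -` {s\<in>S. s \<ge> 0}"
    using runner_nonneg_iff[OF assms(2)] by (auto simp: runner_def)
  moreover have "finite (?f -` A)" if "finite A" for A
    by (rule finite_vimageI[OF that inj_runner])
  moreover have "{m. m \<notin> runner t r S \<and> m < 0} = ?f -` {g. g \<notin> S \<and> g < 0}"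
    using runner_nonneg_iff[OF assms(2)] by (auto simp: runner_def simp flip: not_le)
  ultimately show ?thesis
    using assms(1) unfolding maya_def by presburger
qed

lemma sum_split_residues:
  assumes "finite A"
  shows "(\<Sum>s\<in>A. h s) = (\<Sum>r<t. \<Sum>m\<in>{m. int t * m + int r \<in> A}. h (int t * m + int r))"
proof -
  have fin: "finite {m. int t * m + int r \<in> A}" for r
    using finite_vimageI[OF assms inj_runner, of r] by (simp add: vimage_def)
  have "(\<Sum>s\<in>A. h s) = (\<Sum>(r, m)\<in>(SIGMA r:{..<t}. {m. int t * m + int r \<in> A}). h (int t * m + int r))"
    by (rule sum.reindex_bij_witness[of _ "\<lambda>(r, m). int t * m + int r" "\<lambda>s. (nat (s mod int t), s div int t)"])
      (auto simp: runner_recombine simp del: int_nat_eq)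
  then show ?thesis using fin by (simp add: sum.Sigma)
qed

lemma rsum_runners:
  assumes "maya S"
  shows "rsum h S = (\<Sum>r<t. rsum (\<lambda>m. h (int t * m + int r)) (runner t r S))"
proof -
  have fin: "finite {s\<in>S. s \<ge> 0}" "finite {g. g \<notin> S \<and> g < 0}" using assms by (auto simp: maya_def)
  show ?thesis
    unfolding rsum_def sum_split_residues[OF fin(1)] sum_split_residues[OF fin(2)] sum_subtractf[symmetric]
    by (intro sum.cong refl arg_cong2[of _ _ _ _ "(-)"])
      (auto simp: runner_def runner_nonneg_iff simp flip: not_le)
qed

lemma hooks_prod_runners:
  assumes "maya S"
  shows "(\<Prod>(s, g)\<in>{(s, g)\<in>hooks S. int t dvd s - g}. f (nat (s - g))) =
    (\<Prod>r<t. hooks_prod (\<lambda>h. f (t * h)) (runner t r S))"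
proof -
  let ?c = "\<lambda>r m. int t * m + int r"
  have "(\<Prod>r<t. hooks_prod (\<lambda>h. f (t * h)) (runner t r S)) =
      (\<Prod>(r, p)\<in>(SIGMA r:{..<t}. hooks (runner t r S)). f (t * nat (fst p - snd p)))"
    unfolding hooks_prod_def using maya_runner[OF assms]
    by (simp add: prod.Sigma finite_hooks case_prod_unfold)
  also have "\<dots> = (\<Prod>(s, g)\<in>{(s, g)\<in>hooks S. int t dvd s - g}. f (nat (s - g)))"
  proof (rule prod.reindex_bij_witness[of _ "\<lambda>(s, g). (nat (s mod int t), (s div int t, g div int t))"
      "\<lambda>(r, (m, m')). (?c r m, ?c r m')"], goal_cases)
    case (1 p)
    then show ?case by (auto simp: runner_coords)
  next
    case (2 p)
    then show ?case using t
      by (auto simp: hooks_def runner_def simp flip: right_diff_distrib)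
  next
    case (3 p)
    then obtain s g where p: "p = (s, g)" "(s, g) \<in> hooks S" "int t dvd s - g" by auto
    then have "s mod int t = g mod int t" by (simp add: mod_eq_dvd_iff)
    then show ?case using runner_recombine[of s] runner_recombine[of g] p by auto
  next
    case (4 p)
    then obtain s g where p: "p = (s, g)" "(s, g) \<in> hooks S" "int t dvd s - g" by auto
    then have eq: "s mod int t = g mod int t" by (simp add: mod_eq_dvd_iff)
    have rs: "int t * (s div int t) + int (nat (s mod int t)) = s" "nat (s mod int t) < t"
      using runner_recombine[of s] by auto
    have rg: "int t * (g div int t) + int (nat (s mod int t)) = g"
      using runner_recombine[of g] eq by auto
    have "g div int t < s div int t"
    proof (rule ccontr)
      assume "\<not> g div int t < s div int t"
      then have "int t * (s div int t) \<le> int t * (g div int t)" by (intro mult_left_mono) auto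
      moreover have "g < s" using p by (simp add: hooks_def)
      ultimately show False using rs(1) rg by linarith
    qed
    then show ?case using p rs rg by (auto simp: hooks_def runner_def)
  next
    case (5 p)
    then show ?case using t
      by (auto simp: nat_mult_distrib simp flip: right_diff_distrib)
  qed
  finally show ?thesis by simp
qed

lemma runner_reflect:
  assumes "r < t"
  shows "runner t (t - Suc r) (reflect S) = reflect (runner t r S)"
proof -
  have "- 1 - (int t * m + int (t - Suc r)) = int t * (- 1 - m) + int r" for m
    using assms by (simp add: of_nat_diff algebra_simps)
  then show ?thesis by (auto simp: runner_def reflect_def)
qed

lemma eq_if_runners_eq:
  assumes "\<And>r. r < t \<Longrightarrow> runner t r S = runner t r S'"
  shows "S = S'"
proof (rule set_eqI)
  fix s
  have "s \<in> T \<longleftrightarrow> s div int t \<in> runner t (nat (s mod int t)) T" for T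
    using runner_recombine[of s] by (simp only: runner_def mem_Collect_eq)
  then show "s \<in> S \<longleftrightarrow> s \<in> S'" using assms runner_recombine[of s] by blast
qed

lemma maya_if_runners:
  assumes "\<And>r. r < t \<Longrightarrow> maya (runner t r S)"
  shows "maya S"
proof -
  let ?c = "\<lambda>r m. int t * m + int r"
  have "{s\<in>S. s \<ge> 0} \<subseteq> (\<Union>r<t. ?c r ` {m\<in>runner t r S. m \<ge> 0})"
    "{g. g \<notin> S \<and> g < 0} \<subseteq> (\<Union>r<t. ?c r ` {m. m \<notin> runner t r S \<and> m < 0})"
  proof safe
    fix s
    have s: "s = ?c (nat (s mod int t)) (s div int t)" "nat (s mod int t) < t"
      using runner_recombine[of s] by auto
    {
      assume "s \<in> S" "s \<ge> 0"
      then have "s div int t \<in> {m\<in>runner t (nat (s mod int t)) S. m \<ge> 0}"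
        using s t by (simp add: runner_def pos_imp_zdiv_nonneg_iff)
      then show "s \<in> (\<Union>r<t. ?c r ` {m\<in>runner t r S. m \<ge> 0})" using s by blast
    }
    {
      assume "s \<notin> S" "s < 0"
      then have "s div int t \<in> {m. m \<notin> runner t (nat (s mod int t)) S \<and> m < 0}"
        using s t by (simp add: runner_def pos_imp_zdiv_neg_iff)
      then show "s \<in> (\<Union>r<t. ?c r ` {m. m \<notin> runner t r S \<and> m < 0})" using s by blast
    }
  qed
  moreover have "finite (\<Union>r<t. ?c r ` {m\<in>runner t r S. m \<ge> 0})"
    "finite (\<Union>r<t. ?c r ` {m. m \<notin> runner t r S \<and> m < 0})"
    using assms by (auto simp: maya_def)
  ultimately show ?thesis unfolding maya_def by (blast intro: finite_subset)
qed

end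

lemma rsum_diff: "rsum (\<lambda>m. f m - g m) S = rsum f S - rsum g S"
  by (simp add: rsum_def sum_subtractf)

text \<open>The nonnegative beads \<open>d\<close> are the arm lengths of the diagonal boxes; by
  symmetry the negative gaps are their mirror images \<open>- 1 - d\<close>.\<close>

lemma rsum_sym_mayas:
  assumes "S \<in> sym_mayas"
  shows "rsum h S = (\<Sum>d\<in>{d. int d \<in> S}. h (int d) - h (- 1 - int d))"
proof -
  have "(\<Sum>s\<in>{s\<in>S. s \<ge> 0}. h s) = (\<Sum>d\<in>{d. int d \<in> S}. h (int d))"
    by (rule sum.reindex_bij_witness[of _ int nat]) auto
  moreover have "(\<Sum>g\<in>{g. g \<notin> S \<and> g < 0}. h g) = (\<Sum>d\<in>{d. int d \<in> S}. h (- 1 - int d))"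
    using sym_mayas_iff[OF assms]
    by (intro sum.reindex_bij_witness[of _ "\<lambda>d. - 1 - int d" "\<lambda>g. nat (- 1 - g)"]) auto
  ultimately show ?thesis by (simp add: rsum_def sum_subtractf)
qed

text \<open>Pairs each runner with its mirror image; the general monoid makes this available for
  sums and for products.\<close>

lemma (in comm_monoid_set) lessThan_pair_up:
  assumes "even (t :: nat)"
  shows "F h {..<t} = F (\<lambda>r. f (h r) (h (t - Suc r))) {..<t div 2}"
proof -
  have "F h {..<t} = F h ({..<t div 2} \<union> {t div 2..<t})"
    by (rule arg_cong[of _ _ "F h"]) auto
  also have "\<dots> = f (F h {..<t div 2}) (F h {t div 2..<t})"
    by (rule union_disjoint) auto
  also have "F h {t div 2..<t} = F (\<lambda>r. h (t - Suc r)) {..<t div 2}"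
    using assms by (intro reindex_bij_witness[of _ "\<lambda>r. t - Suc r" "\<lambda>r. t - Suc r"]) (auto elim!: evenE)
  finally show ?thesis by (simp add: distrib)
qed

context
  fixes t :: nat
  assumes t: "t > 0" "even t"
begin

lemma half_less: "r < t div 2 \<Longrightarrow> r < t"
  by auto

lemma runner_sym:
  assumes "S \<in> sym_mayas" "r < t"
  shows "runner t (t - Suc r) S = reflect (runner t r S)"
  using runner_reflect[OF t(1) assms(2), of S] assms(1) by (simp add: sym_mayas_def)

lemma rsum_sym_runners:
  assumes "S \<in> sym_mayas"
  shows "rsum F S = (\<Sum>r<t div 2. rsum (\<lambda>m. F (int t * m + int r) - F (- 1 - (int t * m + int r))) (runner t r S))"
proof -
  have "rsum F S = (\<Sum>r<t div 2. rsum (\<lambda>m. F (int t * m + int r)) (runner t r S) +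
     rsum (\<lambda>m. F (int t * m + int (t - Suc r))) (runner t (t - Suc r) S))"
    using assms rsum_runners[OF t(1), of S F] by (simp add: sym_mayas_def sum.lessThan_pair_up[OF t(2)])
  also have "\<dots> = (\<Sum>r<t div 2. rsum (\<lambda>m. F (int t * m + int r) - F (- 1 - (int t * m + int r))) (runner t r S))"
  proof (intro sum.cong refl)
    fix r assume "r \<in> {..<t div 2}"
    then have r: "r < t" using half_less by auto
    have "int t * (- 1 - m) + int (t - Suc r) = - 1 - (int t * m + int r)" for m
      using r by (simp add: of_nat_diff algebra_simps)
    then show "rsum (\<lambda>m. F (int t * m + int r)) (runner t r S) +
        rsum (\<lambda>m. F (int t * m + int (t - Suc r))) (runner t (t - Suc r) S) =
      rsum (\<lambda>m. F (int t * m + int r) - F (- 1 - (int t * m + int r))) (runner t r S)"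
      by (simp add: runner_sym[OF assms r] rsum_reflect rsum_diff)
  qed
  finally show ?thesis .
qed

lemma hooks_prod_sym_runners:
  fixes f :: "nat \<Rightarrow> 'a::comm_monoid_mult"
  assumes "S \<in> sym_mayas"
  shows "(\<Prod>(s, g)\<in>{(s, g)\<in>hooks S. int t dvd s - g}. f (nat (s - g))) =
    (\<Prod>r<t div 2. hooks_prod (\<lambda>h. f (t * h) ^ 2) (runner t r S))"
proof -
  have "hooks_prod (\<lambda>h. f (t * h)) T * hooks_prod (\<lambda>h. f (t * h)) T = hooks_prod (\<lambda>h. f (t * h) ^ 2) T" for T
    by (simp add: hooks_prod_def prod.distrib[symmetric] power2_eq_square case_prod_unfold)
  moreover have "(\<Prod>(s, g)\<in>{(s, g)\<in>hooks S. int t dvd s - g}. f (nat (s - g))) =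
    (\<Prod>r<t div 2. hooks_prod (\<lambda>h. f (t * h)) (runner t r S) * hooks_prod (\<lambda>h. f (t * h)) (runner t (t - Suc r) S))"
    using assms hooks_prod_runners[OF t(1), of S f] by (simp add: sym_mayas_def prod.lessThan_pair_up[OF t(2)])
  ultimately show ?thesis
    using half_less by (simp add: runner_sym[OF assms] hooks_prod_reflect)
qed

lemma bij_betw_runners:
  "bij_betw (\<lambda>S. \<lambda>r\<in>{..<t div 2}. runner t r S) sym_mayas ({..<t div 2} \<rightarrow>\<^sub>E Collect maya)"
proof -
  \<comment> \<open>\<open>R'\<close> completes the given lower half of the runners by reflection,
    and \<open>C\<close> reassembles the diagram.\<close>
  define R' where "R' = (\<lambda>R r. if r < t div 2 then R r else reflect (R (t - Suc r)))"
  define C where "C = (\<lambda>R. {s. s div int t \<in> R' R (nat (s mod int t))})"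
  have run_C: "runner t r (C R) = R' R r" if "r < t" for r R
    using runner_coords[OF t(1) that] by (simp add: runner_def C_def)
  have half: "t - Suc r < t div 2" if "\<not> r < t div 2" "r < t" for r
    using that t by (auto elim!: evenE)
  have C_sym: "C R \<in> sym_mayas" if "R \<in> {..<t div 2} \<rightarrow>\<^sub>E Collect maya" for R
  proof -
    have "reflect (C R) = C R"
    proof (rule eq_if_runners_eq[OF t(1)])
      fix r assume r: "r < t"
      then have r': "t - Suc r < t" "t - Suc (t - Suc r) = r" using t by auto
      have "runner t r (reflect (C R)) = reflect (R' R (t - Suc r))"
        using runner_reflect[OF t(1) r'(1), of "C R"] r' by (simp add: run_C)
      also have "\<dots> = R' R r"
      proof (cases "r < t div 2")
        case True
        then have "\<not> t - Suc r < t div 2" using t by (auto elim!: evenE)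
        then show ?thesis using True r' by (simp add: R'_def)
      next
        case False
        then show ?thesis using half[OF False r] by (simp add: R'_def)
      qed
      finally show "runner t r (reflect (C R)) = runner t r (C R)" using run_C[OF r] by simp
    qed
    moreover have "maya (C R)"
    proof (rule maya_if_runners[OF t(1)])
      fix r assume r: "r < t"
      show "maya (runner t r (C R))"
        unfolding run_C[OF r] R'_def using half[OF _ r] that by (auto intro!: maya_reflect)
    qed
    ultimately show ?thesis by (simp add: sym_mayas_def)
  qed
  show ?thesis
  proof (rule bij_betw_byWitness[where f' = C])
    show "\<forall>S\<in>sym_mayas. C (\<lambda>r\<in>{..<t div 2}. runner t r S) = S"
    proof
      fix S assume S: "S \<in> sym_mayas"
      show "C (\<lambda>r\<in>{..<t div 2}. runner t r S) = S"
      proof (rule eq_if_runners_eq[OF t(1)])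
        fix r assume r: "r < t"
        then show "runner t r (C (\<lambda>r\<in>{..<t div 2}. runner t r S)) = runner t r S"
          using run_C[OF r] half[OF _ r] runner_sym[OF S r] by (auto simp: R'_def)
      qed
    qed
    show "\<forall>R\<in>{..<t div 2} \<rightarrow>\<^sub>E Collect maya. (\<lambda>r\<in>{..<t div 2}. runner t r (C R)) = R"
    proof (intro ballI ext)
      fix R r assume R: "R \<in> {..<t div 2} \<rightarrow>\<^sub>E Collect maya"
      show "(\<lambda>r\<in>{..<t div 2}. runner t r (C R)) r = R r"
        using run_C[OF half_less] PiE_arb[OF R, of r] by (auto simp: R'_def restrict_def)
    qed
    show "(\<lambda>S. \<lambda>r\<in>{..<t div 2}. runner t r S) ` sym_mayas \<subseteq> {..<t div 2} \<rightarrow>\<^sub>E Collect maya"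
      using half_less by (auto simp: sym_mayas_def intro!: maya_runner[OF t(1)])
    show "C ` ({..<t div 2} \<rightarrow>\<^sub>E Collect maya) \<subseteq> sym_mayas"
      using C_sym by blast
  qed
qed

end

text \<open>This is the bijection with partitions into distinct odd parts: \<open>d\<close> stands
  for the diagonal hook of length \<open>2 * d + 1\<close>, and symmetry forces the negative half of
  \<open>S\<close>.\<close>

lemma bij_betw_sym_mayas: "bij_betw (\<lambda>S. {d. int d \<in> S}) sym_mayas {D. finite D}"
proof (rule bij_betw_byWitness[where f' = "\<lambda>D. {s. if s \<ge> 0 then nat s \<in> D else nat (- 1 - s) \<notin> D}"])
  show "\<forall>S\<in>sym_mayas. {s. if s \<ge> 0 then nat s \<in> {d. int d \<in> S} else nat (- 1 - s) \<notin> {d. int d \<in> S}} = S"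
    using sym_mayas_iff by auto
  show "(\<lambda>S. {d. int d \<in> S}) ` sym_mayas \<subseteq> {D. finite D}"
  proof safe
    fix S assume "S \<in> sym_mayas"
    then have "finite {s\<in>S. s \<ge> 0}" by (simp add: sym_mayas_def maya_def)
    moreover have "{d. int d \<in> S} \<subseteq> nat ` {s\<in>S. s \<ge> 0}" by force
    ultimately show "finite {d. int d \<in> S}" by (blast intro: finite_subset)
  qed
  show "(\<lambda>D. {s. if s \<ge> 0 then nat s \<in> D else nat (- 1 - s) \<notin> D}) ` {D. finite D} \<subseteq> sym_mayas"
  proof safe
    fix D :: "nat set" assume "finite D"
    let ?S = "{s. if s \<ge> 0 then nat s \<in> D else nat (- 1 - s) \<notin> D}"
    have "{s\<in>?S. s \<ge> 0} \<subseteq> int ` D" "{g. g \<notin> ?S \<and> g < 0} \<subseteq> (\<lambda>d. - 1 - int d) ` D"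
      by (auto intro!: image_eqI[of _ int "nat _"] image_eqI[of _ "\<lambda>d. - 1 - int d" "nat (- 1 - _)"])
    then have "maya ?S" using \<open>finite D\<close> unfolding maya_def by (blast intro: finite_subset)
    moreover have "reflect ?S = ?S" by (auto simp: reflect_def)
    ultimately show "?S \<in> sym_mayas" by (simp add: sym_mayas_def)
  qed
qed auto

section \<open>Partitions as Maya diagrams\<close>

definition maya_of :: "nat list \<Rightarrow> int set" where
  "maya_of \<mu> = {int (part \<mu> i) - int i | i. i \<ge> 1}"

lemma part_eq_0: "i > length \<mu> \<Longrightarrow> part \<mu> i = 0"
  by (simp add: part_def)

lemma part_pos_iff: "is_partition \<mu> \<Longrightarrow> i \<ge> 1 \<Longrightarrow> part \<mu> i > 0 \<longleftrightarrow> i \<le> length \<mu>"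
  by (auto simp: is_partition_def part_def)

lemma part_antimono:
  assumes "is_partition \<mu>" "1 \<le> i" "i \<le> i'"
  shows "part \<mu> i' \<le> part \<mu> i"
  using assms sorted_wrt_nth_less[of "(\<ge>)" \<mu> "i - 1" "i' - 1"]
  by (cases "i = i'") (auto simp: is_partition_def part_def)

lemma partition_eqI:
  assumes "is_partition \<mu>" "is_partition \<nu>" "\<And>i. i \<ge> 1 \<Longrightarrow> part \<mu> i = part \<nu> i"
  shows "\<mu> = \<nu>"
proof (rule nth_equalityI)
  have le: "i \<le> length \<mu> \<longleftrightarrow> i \<le> length \<nu>" if "i \<ge> 1" for i
    using assms part_pos_iff[of _ i] that by metis
  show len: "length \<mu> = length \<nu>"
    using le[of "length \<mu>"] le[of "length \<nu>"] by (cases "length \<mu> = 0"; cases "length \<nu> = 0") auto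
  fix i assume "i < length \<mu>"
  then show "\<mu> ! i = \<nu> ! i" using assms(3)[of "Suc i"] len by (simp add: part_def)
qed

lemma initial_segment_eq:
  assumes "finite A" "0 \<notin> A" "\<And>i j. j \<in> A \<Longrightarrow> 1 \<le> i \<Longrightarrow> i \<le> j \<Longrightarrow> i \<in> A"
  shows "A = {1..card A}"
proof (cases "A = {}")
  case False
  have "A = {1..Max A}"
  proof (intro equalityI subsetI)
    fix i assume "i \<in> {1..Max A}"
    then show "i \<in> A" using assms(3)[OF Max_in[OF assms(1) False]] by auto
  next
    fix i assume "i \<in> A"
    then show "i \<in> {1..Max A}" using assms(1,2) by (cases i) auto
  qed
  then show ?thesis by (metis card_atLeastAtMost add_diff_cancel_right' Suc_eq_plus1)
qed simp

lemma part_conjugate: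
  assumes "is_partition \<mu>" "j \<ge> 1"
  shows "part (conjugate \<mu>) j = card {i. 1 \<le> i \<and> i \<le> length \<mu> \<and> part \<mu> i \<ge> j}"
proof (cases "j \<le> part \<mu> 1")
  case True
  then have "[1..<Suc (part \<mu> 1)] ! (j - 1) = j" using assms by (subst nth_upt) auto
  then show ?thesis
    using True assms unfolding part_def[of "conjugate \<mu>"] unfolding conjugate_def by (simp del: upt_Suc)
next
  case False
  then have "{i. 1 \<le> i \<and> i \<le> length \<mu> \<and> part \<mu> i \<ge> j} = {}"
    using part_antimono[OF assms(1), of 1] by (force dest: le_trans)
  moreover have "part (conjugate \<mu>) j = 0"
    using False by (intro part_eq_0) (simp add: conjugate_def del: upt_Suc)
  ultimately show ?thesis by simp
qed

text \<open>The rows of length at least \<open>j\<close> form an initial segment, so membership of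
  \<open>i\<close> is a comparison of \<open>i\<close> with their number.\<close>

lemma le_part_conjugate_iff:
  assumes "is_partition \<mu>" "i \<ge> 1" "j \<ge> 1"
  shows "i \<le> part (conjugate \<mu>) j \<longleftrightarrow> j \<le> part \<mu> i"
proof -
  let ?A = "{i. 1 \<le> i \<and> i \<le> length \<mu> \<and> part \<mu> i \<ge> j}"
  have "?A = {1..card ?A}"
    using part_antimono[OF assms(1)] by (intro initial_segment_eq) (auto dest: le_trans)
  moreover have "i \<in> ?A \<longleftrightarrow> j \<le> part \<mu> i"
    using assms by (auto simp: part_def split: if_splits)
  ultimately have "i \<in> {1..card ?A} \<longleftrightarrow> j \<le> part \<mu> i" by (rule subst)
  then show ?thesis using assms by (simp add: part_conjugate)
qed

lemma is_partition_conjugate: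
  assumes "is_partition \<mu>"
  shows "is_partition (conjugate \<mu>)"
proof -
  let ?c = "\<lambda>j. card {i. 1 \<le> i \<and> i \<le> length \<mu> \<and> part \<mu> i \<ge> j}"
  have "?c j \<ge> ?c j'" if "j \<le> j'" for j j'
    using that by (intro card_mono) auto
  then have "sorted_wrt (\<ge>) (map ?c [1..<Suc (part \<mu> 1)])"
    by (auto simp: sorted_wrt_map intro!: sorted_wrt_mono_rel[OF _ sorted_wrt_upt] simp del: upt_Suc)
  moreover have "?c j > 0" if "1 \<le> j" "j \<le> part \<mu> 1" for j
  proof -
    have "1 \<in> {i. 1 \<le> i \<and> i \<le> length \<mu> \<and> part \<mu> i \<ge> j}"
      using that by (auto simp: part_def split: if_splits)
    then show ?thesis by (subst card_gt_0_iff) auto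
  qed
  ultimately show ?thesis
    unfolding is_partition_def conjugate_def by (auto simp del: upt_Suc)
qed

text \<open>Along the boundary of the diagram the beads are the steps that end a row and the gaps
  the steps that end a column.\<close>

lemma notin_maya_of_iff:
  assumes "is_partition \<mu>"
  shows "m \<notin> maya_of \<mu> \<longleftrightarrow> (\<exists>j\<ge>1. m = int j - 1 - int (part (conjugate \<mu>) j))"
proof
  assume m: "m \<notin> maya_of \<mu>"
  define A where "A = {i. i \<ge> 1 \<and> m < int (part \<mu> i) - int i}"
  have "i \<le> length \<mu> + nat (- m)" if "i \<in> A" for i
    using that part_eq_0[of \<mu> i] by (cases "i \<le> length \<mu>") (auto simp: A_def)
  then have "finite A" by (meson finite_nat_set_iff_bounded_le)
  moreover have "0 \<notin> A" by (simp add: A_def)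
  moreover have "i \<in> A" if "j \<in> A" "1 \<le> i" "i \<le> j" for i j
    using that part_antimono[OF assms, of i j] by (auto simp: A_def)
  ultimately have A: "A = {1..card A}" by (rule initial_segment_eq)
  define i where "i = Suc (card A)"
  have "i \<notin> A" by (subst A) (simp add: i_def)
  then have "int (part \<mu> i) - int i \<le> m" by (simp add: A_def) (simp add: i_def)
  moreover have "i \<ge> 1" by (simp add: i_def)
  then have "int (part \<mu> i) - int i \<in> maya_of \<mu>" unfolding maya_of_def by blast
  ultimately have lt: "int (part \<mu> i) - int i < m" using m by (metis le_less)
  \<comment> \<open>Exactly the first \<open>i - 1\<close> rows have their bead above
    \<open>m\<close>. A column with its gap at \<open>m\<close> must have height
    \<open>i - 1\<close>, which forces \<open>j = m + i\<close>.\<close>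
  define j where "j = nat (m + int i)"
  have j: "int j = m + int i" "j \<ge> 1" using lt by (auto simp: j_def)
  have "\<not> i \<le> part (conjugate \<mu>) j"
    using lt j le_part_conjugate_iff[OF assms _ j(2), of i] by (auto simp: i_def)
  moreover have "card A \<le> part (conjugate \<mu>) j"
  proof (cases "card A = 0")
    case False
    then have "card A \<in> A" by (subst A) auto
    then show ?thesis
      using j le_part_conjugate_iff[OF assms _ j(2), of "card A"] by (auto simp: A_def i_def)
  qed simp
  ultimately have "part (conjugate \<mu>) j = card A" by (simp add: i_def)
  then show "\<exists>j\<ge>1. m = int j - 1 - int (part (conjugate \<mu>) j)"
    using j by (intro exI[of _ j]) (simp add: i_def)
next
  assume "\<exists>j\<ge>1. m = int j - 1 - int (part (conjugate \<mu>) j)"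
  then obtain j where j: "j \<ge> 1" "m = int j - 1 - int (part (conjugate \<mu>) j)" by blast
  show "m \<notin> maya_of \<mu>"
  proof
    assume "m \<in> maya_of \<mu>"
    then obtain i where i: "i \<ge> 1" "m = int (part \<mu> i) - int i" by (auto simp: maya_of_def)
    then show False using le_part_conjugate_iff[OF assms i(1) j(1)] j by linarith
  qed
qed

lemma reflect_maya_of:
  assumes "is_partition \<mu>"
  shows "reflect (maya_of \<mu>) = maya_of (conjugate \<mu>)"
proof (rule set_eqI)
  fix m
  have "m \<in> reflect (maya_of \<mu>) \<longleftrightarrow> (\<exists>j\<ge>1. - 1 - m = int j - 1 - int (part (conjugate \<mu>) j))"
    unfolding reflect_def mem_Collect_eq by (rule notin_maya_of_iff[OF assms])
  also have "\<dots> \<longleftrightarrow> (\<exists>j\<ge>1. m = int (part (conjugate \<mu>) j) - int j)"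
    by (intro ex_cong1 conj_cong refl) linarith
  also have "\<dots> \<longleftrightarrow> m \<in> maya_of (conjugate \<mu>)"
    by (auto simp: maya_of_def)
  finally show "m \<in> reflect (maya_of \<mu>) \<longleftrightarrow> m \<in> maya_of (conjugate \<mu>)" .
qed

lemma maya_of_strict:
  assumes "is_partition \<mu>" "1 \<le> i" "i < i'"
  shows "int (part \<mu> i') - int i' < int (part \<mu> i) - int i"
  using part_antimono[OF assms(1,2), of i'] assms(3) by simp

lemma inj_on_maya_of_part:
  assumes "is_partition \<mu>"
  shows "inj_on (\<lambda>i. int (part \<mu> i) - int i) {1..}"
proof (rule linorder_inj_onI)
  fix i i' :: nat assume "i < i'" "i \<in> {1..}"
  then show "int (part \<mu> i) - int i \<noteq> int (part \<mu> i') - int i'"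
    using maya_of_strict[OF assms, of i i'] by simp
qed (use nat_le_linear in blast)

text \<open>Pigeonhole: if the \<open>i\<close>-th part of \<open>\<mu>\<close> were larger, the
  first \<open>i\<close> beads of \<open>\<mu>\<close> would all exceed the \<open>i\<close>-th bead
  of \<open>\<nu>\<close> and so lie among the first \<open>i - 1\<close> beads of
  \<open>\<nu>\<close>.\<close>

lemma part_le_if_maya_of_eq:
  assumes "is_partition \<mu>" "is_partition \<nu>" "maya_of \<mu> = maya_of \<nu>" "i \<ge> 1"
  shows "part \<mu> i \<le> part \<nu> i"
proof (rule ccontr)
  let ?a = "\<lambda>i. int (part \<mu> i) - int i" and ?b = "\<lambda>i. int (part \<nu> i) - int i"
  assume "\<not> part \<mu> i \<le> part \<nu> i"
  have "?a ` {1..i} \<subseteq> ?b ` {1..<i}"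
  proof (rule image_subsetI)
    fix j assume j: "j \<in> {1..i}"
    then have "?a j \<in> maya_of \<nu>" unfolding assms(3)[symmetric] by (auto simp: maya_of_def)
    then obtain k where k: "k \<ge> 1" "?a j = ?b k" by (auto simp: maya_of_def)
    have "?a i \<le> ?a j" using j maya_of_strict[OF assms(1), of j i] by (cases "j = i") auto
    then have "?b i < ?b k" using k \<open>\<not> part \<mu> i \<le> part \<nu> i\<close> by simp
    then have "k < i"
      using maya_of_strict[OF assms(2,4), of k] by (cases k i rule: linorder_cases) auto
    then show "?a j \<in> ?b ` {1..<i}" using k by auto
  qed
  from card_mono[OF _ this] have "card (?a ` {1..i}) \<le> card (?b ` {1..<i})" by simp
  also have "\<dots> \<le> card {1..<i}" by (intro card_image_le) simp
  also have "card (?a ` {1..i}) = card {1..i}"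
    by (intro card_image inj_on_subset[OF inj_on_maya_of_part[OF assms(1)]]) auto
  finally show False using assms(4) by simp
qed

lemma maya_of_inject:
  assumes "is_partition \<mu>" "is_partition \<nu>" "maya_of \<mu> = maya_of \<nu>"
  shows "\<mu> = \<nu>"
  using assms by (intro partition_eqI antisym part_le_if_maya_of_eq) auto

lemma filled_below_maya_of: "filled_below (length \<mu>) (maya_of \<mu>)"
  unfolding filled_below_def
proof (intro allI impI)
  fix s assume "s < - int (length \<mu>)"
  then have "s = int (part \<mu> (nat (- s))) - int (nat (- s))" "nat (- s) \<ge> 1"
    using part_eq_0[of \<mu> "nat (- s)"] by auto
  then show "s \<in> maya_of \<mu>" unfolding maya_of_def by blast
qed

lemma trunc_maya_of: "trunc (length \<mu>) (maya_of \<mu>) = (\<lambda>i. part \<mu> i + length \<mu> - i) ` {1..length \<mu>}"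
proof (intro equalityI subsetI)
  fix x assume "x \<in> trunc (length \<mu>) (maya_of \<mu>)"
  then obtain i where i: "i \<ge> 1" "int x - int (length \<mu>) = int (part \<mu> i) - int i"
    by (auto simp: trunc_def maya_of_def)
  then have "i \<le> length \<mu>" using part_eq_0[of \<mu> i] by (cases "i \<le> length \<mu>") auto
  then show "x \<in> (\<lambda>i. part \<mu> i + length \<mu> - i) ` {1..length \<mu>}" using i by (intro image_eqI[of _ _ i]) auto
next
  fix x assume "x \<in> (\<lambda>i. part \<mu> i + length \<mu> - i) ` {1..length \<mu>}"
  then obtain i where i: "1 \<le> i" "i \<le> length \<mu>" "x = part \<mu> i + length \<mu> - i" by auto
  then have "int x - int (length \<mu>) = int (part \<mu> i) - int i" by auto
  then show "x \<in> trunc (length \<mu>) (maya_of \<mu>)" using i(1) unfolding trunc_def maya_of_def by blast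
qed

lemma maya_maya_of: "maya (maya_of \<mu>)"
proof -
  have "{s\<in>maya_of \<mu>. s \<ge> 0} \<subseteq> (\<lambda>x. int x - int (length \<mu>)) ` trunc (length \<mu>) (maya_of \<mu>)"
  proof
    fix s assume s: "s \<in> {s\<in>maya_of \<mu>. s \<ge> 0}"
    then have "s = int (nat (s + int (length \<mu>))) - int (length \<mu>)" by simp
    moreover from this s have "nat (s + int (length \<mu>)) \<in> trunc (length \<mu>) (maya_of \<mu>)" by (simp add: trunc_def)
    ultimately show "s \<in> (\<lambda>x. int x - int (length \<mu>)) ` trunc (length \<mu>) (maya_of \<mu>)" by blast
  qed
  moreover have "{g. g \<notin> maya_of \<mu> \<and> g < 0} \<subseteq> {- int (length \<mu>)..<0}"
    using filled_belowD[OF filled_below_maya_of[of \<mu>]] by auto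
  ultimately show ?thesis unfolding maya_def trunc_maya_of by (blast intro: finite_subset)
qed

lemma rsum_maya_of:
  assumes "is_partition \<mu>"
  shows "rsum h (maya_of \<mu>) = (\<Sum>i=1..length \<mu>. h (int (part \<mu> i) - int i) - h (- int i))"
proof -
  let ?N = "length \<mu>"
  have "inj_on (\<lambda>i. part \<mu> i + ?N - i) {1..?N}"
  proof (rule inj_onI)
    fix i j assume *: "i \<in> {1..?N}" "j \<in> {1..?N}" "part \<mu> i + ?N - i = part \<mu> j + ?N - j"
    then have "int (part \<mu> i) - int i = int (part \<mu> j) - int j" by auto
    with * inj_onD[OF inj_on_maya_of_part[OF assms], of i j] show "i = j" by simp
  qed
  then have "(\<Sum>x\<in>trunc ?N (maya_of \<mu>). h (int x - int ?N)) =
      (\<Sum>i=1..?N. h (int (part \<mu> i + ?N - i) - int ?N))"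
    unfolding trunc_maya_of by (simp add: sum.reindex)
  also have "\<dots> = (\<Sum>i=1..?N. h (int (part \<mu> i) - int i))"
    by (intro sum.cong refl arg_cong[of _ _ h]) auto
  finally have 1: "(\<Sum>x\<in>trunc ?N (maya_of \<mu>). h (int x - int ?N)) = (\<Sum>i=1..?N. h (int (part \<mu> i) - int i))" .
  have 2: "(\<Sum>x<?N. h (int x - int ?N)) = (\<Sum>i=1..?N. h (- int i))"
    by (rule sum.reindex_bij_witness[of _ "\<lambda>i. ?N - i" "\<lambda>x. ?N - x"]) (auto simp: of_nat_diff)
  show ?thesis
    unfolding rsum_trunc[OF maya_maya_of filled_below_maya_of] 1 2 by (simp add: sum_subtractf)
qed

lemma sum_list_eq_rsum:
  assumes "is_partition \<mu>"
  shows "int (sum_list \<mu>) = rsum (\<lambda>s. s) (maya_of \<mu>)"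
proof -
  have "sum_list \<mu> = (\<Sum>i<length \<mu>. \<mu> ! i)" by (simp add: sum_list_sum_nth atLeast0LessThan)
  also have "\<dots> = (\<Sum>i=1..length \<mu>. part \<mu> i)"
    by (rule sum.reindex_bij_witness[of _ "\<lambda>i. i - 1" Suc]) (auto simp: part_def)
  finally show ?thesis by (simp add: rsum_maya_of[OF assms])
qed

lemma ferrers_eq_Sigma: "ferrers \<mu> = Sigma {1..length \<mu>} (\<lambda>i. {1..part \<mu> i})"
  by (auto simp: ferrers_def)

lemma finite_ferrers: "finite (ferrers \<mu>)"
  by (simp add: ferrers_eq_Sigma)

text \<open>The alternating sum along row \<open>i\<close> telescopes, since
  \<open>(-1) ^ c = of_bool (even c) - of_bool (even (c - 1))\<close>.\<close>

lemma BG_rank_eq_rsum: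
  assumes "is_partition \<mu>"
  shows "BG_rank \<mu> = rsum (\<lambda>s. of_bool (even s)) (maya_of \<mu>)"
proof -
  have row: "(\<Sum>j=1..p. (-1) ^ (i + j)) = (of_bool (even (int p - int i)) - of_bool (even (- int i)) :: int)" for p i
    by (induction p) auto
  have "BG_rank \<mu> = (\<Sum>i=1..length \<mu>. \<Sum>j=1..part \<mu> i. (-1) ^ (i + j))"
    unfolding BG_rank_def ferrers_eq_Sigma by (simp add: sum.Sigma)
  then show ?thesis by (simp only: row rsum_maya_of[OF assms])
qed

text \<open>A row determines a bead and a column a gap. By \<open>le_part_conjugate_iff\<close> they
  meet in a box of the diagram exactly when the gap is below the bead.\<close>

lemma bij_betw_ferrers_hooks:
  assumes "is_partition \<mu>"
  shows "bij_betw (\<lambda>(i, j). (int (part \<mu> i) - int i, int j - 1 - int (part (conjugate \<mu>) j)))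
    (ferrers \<mu>) (hooks (maya_of \<mu>))"
proof -
  let ?s = "\<lambda>i. int (part \<mu> i) - int i" and ?g = "\<lambda>j. int j - 1 - int (part (conjugate \<mu>) j)"
  have g_eq: "?g j = - 1 - (int (part (conjugate \<mu>) j) - int j)" for j by simp
  have inj_g: "j = j'" if "?g j = ?g j'" "j \<ge> 1" "j' \<ge> 1" for j j'
    using that inj_onD[OF inj_on_maya_of_part[OF is_partition_conjugate[OF assms]], of j j'] by auto
  have inj_s: "i = i'" if "?s i = ?s i'" "i \<ge> 1" "i' \<ge> 1" for i i'
    using that inj_onD[OF inj_on_maya_of_part[OF assms], of i i'] by auto
  have less_iff: "?g j < ?s i \<longleftrightarrow> j \<le> part \<mu> i" if "i \<ge> 1" "j \<ge> 1" for i j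
    using le_part_conjugate_iff[OF assms that] by linarith
  have len: "i \<le> length \<mu>" if "1 \<le> j" "j \<le> part \<mu> i" for i j
    using that by (auto simp: part_def split: if_splits)
  show ?thesis
    unfolding bij_betw_def
  proof
    show "inj_on (\<lambda>(i, j). (?s i, ?g j)) (ferrers \<mu>)"
      using inj_g inj_s by (auto simp: inj_on_def ferrers_def)
    show "(\<lambda>(i, j). (?s i, ?g j)) ` ferrers \<mu> = hooks (maya_of \<mu>)"
    proof (intro equalityI subsetI)
      fix p assume "p \<in> (\<lambda>(i, j). (?s i, ?g j)) ` ferrers \<mu>"
      then obtain i j where p: "p = (?s i, ?g j)" "i \<ge> 1" "j \<ge> 1" "j \<le> part \<mu> i"
        by (auto simp: ferrers_def)
      have "?s i \<in> maya_of \<mu>" using p(2) by (auto simp: maya_of_def)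
      moreover have "?g j \<notin> maya_of \<mu>" unfolding notin_maya_of_iff[OF assms] using p(3) by blast
      ultimately show "p \<in> hooks (maya_of \<mu>)" using p less_iff[OF p(2,3)] by (simp add: hooks_def)
    next
      fix p assume "p \<in> hooks (maya_of \<mu>)"
      then obtain s g where p: "p = (s, g)" "s \<in> maya_of \<mu>" "g \<notin> maya_of \<mu>" "g < s" by (auto simp: hooks_def)
      obtain i where i: "i \<ge> 1" "s = ?s i" using p(2) by (auto simp: maya_of_def)
      obtain j where j: "j \<ge> 1" "g = ?g j" using p(3) notin_maya_of_iff[OF assms] by blast
      have "j \<le> part \<mu> i" using less_iff[OF i(1) j(1)] p i j by simp
      then have "(i, j) \<in> ferrers \<mu>" using i j len by (simp add: ferrers_def)
      then show "p \<in> (\<lambda>(i, j). (?s i, ?g j)) ` ferrers \<mu>" using p i j by force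
    qed
  qed
qed

lemma hook_length_eq:
  assumes "is_partition \<mu>" "(i, j) \<in> ferrers \<mu>"
  shows "int (hook_length \<mu> (i, j)) = (int (part \<mu> i) - int i) - (int j - 1 - int (part (conjugate \<mu>) j))"
proof -
  have "1 \<le> i" "1 \<le> j" "j \<le> part \<mu> i" using assms(2) by (auto simp: ferrers_def)
  then show ?thesis
    using le_part_conjugate_iff[OF assms(1), of i j] by (simp add: hook_length_def of_nat_diff)
qed

lemma prod_mset_hooks_div:
  assumes "is_partition \<mu>"
  shows "(\<Prod>h\<in>#hooks_div t \<mu>. f h) =
    (\<Prod>(s, g)\<in>{(s, g)\<in>hooks (maya_of \<mu>). int t dvd s - g}. f (nat (s - g)))"
proof -
  let ?b = "\<lambda>(i, j). (int (part \<mu> i) - int i, int j - 1 - int (part (conjugate \<mu>) j))"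
  let ?F = "{p \<in> ferrers \<mu>. t dvd hook_length \<mu> p}"
  have "(\<Prod>h\<in>#hooks_div t \<mu>. f h) = (\<Prod>p\<in>?F. f (hook_length \<mu> p))"
    unfolding hooks_div_def using finite_ferrers[of \<mu>]
    by (simp add: filter_mset_image_mset image_mset.compositionality o_def prod_unfold_prod_mset)
  also have "\<dots> = (\<Prod>p\<in>?F. f (nat (fst (?b p) - snd (?b p))))"
    by (intro prod.cong refl arg_cong[of _ _ f]) (use hook_length_eq[OF assms] in \<open>force simp del: int_nat_eq\<close>)
  also have "\<dots> = (\<Prod>p\<in>?b ` ?F. f (nat (fst p - snd p)))"
    using bij_betw_ferrers_hooks[OF assms] by (subst prod.reindex) (auto simp: bij_betw_def intro: inj_on_subset)
  also have "?b ` ?F = {(s, g)\<in>hooks (maya_of \<mu>). int t dvd s - g}"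
  proof -
    have "t dvd hook_length \<mu> p \<longleftrightarrow> int t dvd fst (?b p) - snd (?b p)" if "p \<in> ferrers \<mu>" for p
      using hook_length_eq[OF assms, of "fst p" "snd p"] that
      by (simp add: case_prod_unfold int_dvd_int_iff[symmetric] del: int_dvd_int_iff)
    then have "?b ` ?F = {p \<in> ?b ` ferrers \<mu>. int t dvd fst p - snd p}" by blast
    then show ?thesis using bij_betw_ferrers_hooks[OF assms] by (auto simp: bij_betw_def)
  qed
  finally show ?thesis by (simp add: case_prod_unfold)
qed

text \<open>Choosing the least \<open>N\<close> below which \<open>S\<close> is full makes \<open>-N\<close> a gap (or \<open>N = 0\<close>), so all
  parts read off from the \<open>N\<close> remaining beads are positive.\<close>

lemma ex_partition_of_sym_maya:
  assumes "S \<in> sym_mayas"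
  shows "\<exists>\<mu>. is_partition \<mu> \<and> maya_of \<mu> = S"
proof -
  have maya: "maya S" using assms by (simp add: sym_mayas_def)
  define N where "N = (LEAST N. filled_below N S)"
  have N: "filled_below N S" unfolding N_def using maya_lower_bound[OF maya] by (metis LeastI)
  define X where "X = trunc N S"
  define L where "L = sorted_list_of_set X"
  \<comment> \<open>A symmetric diagram has charge 0, so exactly \<open>N\<close> beads remain in
    the window.\<close>
  have X: "finite X" "card X = N"
    using finite_trunc[OF maya] card_trunc[OF maya N] rsum_sym_mayas[OF assms, of "\<lambda>_. 1"]
    by (simp_all add: X_def charge_def)
  have "0 \<notin> X"
  proof
    assume 0: "0 \<in> X"
    then have "N > 0" using X by (auto simp: card_gt_0_iff)
    have "- int N \<in> S" using 0 by (simp add: X_def trunc_def)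
    then have "filled_below (N - 1) S"
      using N \<open>N > 0\<close> unfolding filled_below_def
      by (metis Suc_pred' One_nat_def add_diff_cancel_left' int_ops(4) le_less linorder_not_less minus_diff_eq neg_le_iff_le
          of_nat_Suc plus_1_eq_Suc zle_diff1_eq minus_le_iff)
    then have "N \<le> N - 1" unfolding N_def by (rule Least_le)
    then show False using \<open>N > 0\<close> by simp
  qed
  have L: "length L = N" "set L = X" "sorted_wrt (<) L"
    using X by (simp_all add: L_def)
  have L_less: "L ! k < L ! k'" if "k < k'" "k' < N" for k k'
    using sorted_wrt_nth_less[OF L(3)] that L(1) by simp
  have gap: "L ! k + (k' - k) \<le> L ! k'" if "k \<le> k'" "k' < N" for k k'
    using that
  proof (induction k' rule: dec_induct)
    case (step n)
    then show ?case using L_less[of n "Suc n"] by simp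
  qed simp
  have L_pos: "k < L ! k" if "k < N" for k
  proof -
    have "L ! 0 \<in> X" using that L nth_mem[of 0 L] by simp
    then have "L ! 0 > 0" using \<open>0 \<notin> X\<close> by (metis gr0I)
    then show ?thesis using gap[of 0 k] that by simp
  qed
  have L_mono: "L ! k - k \<le> L ! k' - k'" if "k \<le> k'" "k' < N" for k k'
    using gap[OF that] that(1) by linarith
  \<comment> \<open>\<open>L ! k - k\<close> counts the gaps in the window below bead number
    \<open>k\<close>. The first row belongs to the largest bead, hence the reversed index.\<close>
  define \<mu> where "\<mu> = map (\<lambda>i. L ! (N - 1 - i) - (N - 1 - i)) [0..<N]"
  have len: "length \<mu> = N" by (simp add: \<mu>_def)
  have part: "part \<mu> i = L ! (N - i) - (N - i)" if "1 \<le> i" "i \<le> N" for i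
  proof -
    have "\<mu> ! (i - 1) = L ! (N - 1 - (i - 1)) - (N - 1 - (i - 1))"
      unfolding \<mu>_def by (subst nth_map) (use that in auto)
    moreover have "N - 1 - (i - 1) = N - i" using that by simp
    ultimately show ?thesis using that by (simp add: part_def len)
  qed
  have "is_partition \<mu>"
    unfolding is_partition_def
  proof
    show "sorted_wrt (\<ge>) \<mu>"
      unfolding sorted_wrt_iff_nth_less
    proof (intro allI impI)
      fix i j assume "i < j" "j < length \<mu>"
      then show "\<mu> ! i \<ge> \<mu> ! j"
        using L_mono[of "N - 1 - j" "N - 1 - i"] by (simp add: \<mu>_def)
    qed
    show "\<forall>p\<in>set \<mu>. p > 0"
    proof
      fix p assume "p \<in> set \<mu>"
      then obtain i where "i < N" and p: "p = L ! (N - 1 - i) - (N - 1 - i)" by (auto simp: \<mu>_def)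
      then show "p > 0" using L_pos[of "N - 1 - i"] unfolding p zero_less_diff by linarith
    qed
  qed
  moreover have "maya_of \<mu> = S"
  proof (rule set_eqI)
    fix s
    show "s \<in> maya_of \<mu> \<longleftrightarrow> s \<in> S"
    proof (cases "s < - int N")
      case True
      then show ?thesis using N filled_below_maya_of[of \<mu>] by (simp add: filled_below_def len)
    next
      case False
      then have s: "s = int (nat (s + int N)) - int N" by simp
      have "(\<lambda>i. part \<mu> i + N - i) ` {1..N} = X"
      proof -
        have "(\<lambda>i. part \<mu> i + N - i) ` {1..N} = (\<lambda>i. L ! (N - i)) ` {1..N}"
        proof (intro image_cong refl)
          fix i assume "i \<in> {1..N}"
          then have "1 \<le> i" "i \<le> N" "N - i < L ! (N - i)" using L_pos[of "N - i"] by auto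
          then show "part \<mu> i + N - i = L ! (N - i)" using part[of i] by linarith
        qed
        also have "\<dots> = (!) L ` {..<N}"
        proof -
          have "(\<lambda>i. N - i) ` {1..N} = {..<N}"
          proof (intro equalityI subsetI)
            fix k assume "k \<in> {..<N}"
            then show "k \<in> (\<lambda>i. N - i) ` {1..N}" by (intro image_eqI[of _ _ "N - k"]) auto
          qed auto
          then show ?thesis by (metis image_image)
        qed
        also have "\<dots> = X" using L(1,2) by (auto simp: in_set_conv_nth)
        finally show ?thesis .
      qed
      then have "trunc N (maya_of \<mu>) = trunc N S"
        using trunc_maya_of[of \<mu>] by (simp add: len X_def)
      then have "nat (s + int N) \<in> trunc N (maya_of \<mu>) \<longleftrightarrow> nat (s + int N) \<in> trunc N S" by simp
      then show ?thesis using s by (simp add: trunc_def)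
    qed
  qed
  ultimately show ?thesis by blast
qed

lemma bij_betw_maya_of: "bij_betw maya_of self_conjugate_partitions sym_mayas"
  unfolding bij_betw_def
proof
  show "inj_on maya_of self_conjugate_partitions"
    using maya_of_inject by (auto simp: inj_on_def self_conjugate_partitions_def)
  show "maya_of ` self_conjugate_partitions = sym_mayas"
  proof (intro equalityI subsetI)
    fix S assume "S \<in> maya_of ` self_conjugate_partitions"
    then show "S \<in> sym_mayas"
      using reflect_maya_of maya_maya_of by (auto simp: self_conjugate_partitions_def sym_mayas_def)
  next
    fix S assume S: "S \<in> sym_mayas"
    then obtain \<mu> where \<mu>: "is_partition \<mu>" "maya_of \<mu> = S" using ex_partition_of_sym_maya by blast
    then have "maya_of (conjugate \<mu>) = maya_of \<mu>" using reflect_maya_of[OF \<mu>(1)] S by (simp add: sym_mayas_def)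
    then have "conjugate \<mu> = \<mu>" using \<mu>(1) is_partition_conjugate by (intro maya_of_inject)
    then show "S \<in> maya_of ` self_conjugate_partitions"
      using \<mu> by (auto simp: self_conjugate_partitions_def)
  qed
qed

section \<open>Generating functions of graded families\<close>

definition gf :: "'i set \<Rightarrow> ('i \<Rightarrow> nat) \<Rightarrow> ('i \<Rightarrow> 'a) \<Rightarrow> 'a::comm_ring_1 fps" where
  "gf A w c = Abs_fps (\<lambda>n. \<Sum>a\<in>{a\<in>A. w a = n}. c a)"

text \<open>Guards \<open>gf\<close>, since \<open>sum\<close> over an infinite set of objects of
  one weight would return 0.\<close>

definition fin_graded :: "'i set \<Rightarrow> ('i \<Rightarrow> nat) \<Rightarrow> bool" where
  "fin_graded A w \<longleftrightarrow> (\<forall>n. finite {a\<in>A. w a = n})"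

lemma gf_cong:
  assumes "\<And>a. a \<in> A \<Longrightarrow> w a = w' a" "\<And>a. a \<in> A \<Longrightarrow> c a = c' a"
  shows "gf A w c = gf A w' c'"
  unfolding gf_def using assms by (intro arg_cong[of _ _ Abs_fps] ext sum.cong) auto

lemma gf_bij_betw:
  assumes "bij_betw h A B"
  shows "gf B w c = gf A (w \<circ> h) (c \<circ> h)"
proof -
  have "bij_betw h {a\<in>A. w (h a) = n} {b\<in>B. w b = n}" for n
    using assms by (auto simp: bij_betw_def inj_on_def)
  from sum.reindex_bij_betw[OF this, of c] show ?thesis
    by (simp add: gf_def o_def)
qed

lemma fin_graded_bij_betw:
  assumes "bij_betw h A B"
  shows "fin_graded B w \<longleftrightarrow> fin_graded A (w \<circ> h)"
proof -
  have "bij_betw h {a\<in>A. w (h a) = n} {b\<in>B. w b = n}" for n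
    using assms by (auto simp: bij_betw_def inj_on_def)
  from bij_betw_finite[OF this] show ?thesis by (simp add: fin_graded_def)
qed

lemma gf_times:
  assumes A: "fin_graded A v" and B: "fin_graded B w"
  shows "gf A v c * gf B w d = gf (A \<times> B) (\<lambda>(a, b). v a + w b) (\<lambda>(a, b). c a * d b)"
    and "fin_graded (A \<times> B) (\<lambda>(a, b). v a + w b)"
proof -
  have eq: "{p\<in>A \<times> B. (case p of (a, b) \<Rightarrow> v a + w b) = n} =
      (\<Union>i\<in>{..n}. {a\<in>A. v a = i} \<times> {b\<in>B. w b = n - i})" for n
    by auto
  have fin: "finite {a\<in>A. v a = i}" "finite {b\<in>B. w b = i}" for i
    using A B by (auto simp: fin_graded_def)
  show "fin_graded (A \<times> B) (\<lambda>(a, b). v a + w b)"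
    unfolding fin_graded_def eq using fin by auto
  show "gf A v c * gf B w d = gf (A \<times> B) (\<lambda>(a, b). v a + w b) (\<lambda>(a, b). c a * d b)"
  proof (rule fps_ext)
    fix n
    have "fps_nth (gf A v c * gf B w d) n =
        (\<Sum>i\<le>n. \<Sum>(a, b)\<in>{a\<in>A. v a = i} \<times> {b\<in>B. w b = n - i}. c a * d b)"
      by (simp add: fps_mult_nth gf_def atLeast0AtMost sum_product sum.cartesian_product)
    also have "\<dots> = (\<Sum>(a, b)\<in>(\<Union>i\<in>{..n}. {a\<in>A. v a = i} \<times> {b\<in>B. w b = n - i}). c a * d b)"
      using fin by (intro sum.UNION_disjoint[symmetric]) auto
    finally show "fps_nth (gf A v c * gf B w d) n =
        fps_nth (gf (A \<times> B) (\<lambda>(a, b). v a + w b) (\<lambda>(a, b). c a * d b)) n"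
      by (simp only: gf_def eq fps_nth_Abs_fps)
  qed
qed

lemma bij_betw_PiE_insert:
  assumes "i \<notin> I"
  shows "bij_betw (\<lambda>(y, g). g(i := y)) (A i \<times> PiE I A) (PiE (insert i I) A)"
  using assms unfolding PiE_insert_eq bij_betw_def by (simp add: inj_combinator)

lemma gf_PiE:
  assumes "finite I" "\<And>i. i \<in> I \<Longrightarrow> fin_graded (A i) (w i)"
  shows "gf (PiE I A) (\<lambda>g. \<Sum>i\<in>I. w i (g i)) (\<lambda>g. \<Prod>i\<in>I. c i (g i)) = (\<Prod>i\<in>I. gf (A i) (w i) (c i)) \<and>
    fin_graded (PiE I A) (\<lambda>g. \<Sum>i\<in>I. w i (g i))"
  using assms
proof (induction I rule: finite_induct)
  case empty
  show ?case by (auto simp: gf_def fin_graded_def fps_eq_iff)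
next
  case (insert i I)
  let ?h = "\<lambda>(y, g). g(i := y)"
  let ?w = "\<lambda>I g. \<Sum>i\<in>I. w i (g i)" and ?c = "\<lambda>I g. \<Prod>i\<in>I. c i (g i)"
  have upd: "(\<Sum>j\<in>I. w j ((g(i := y)) j)) = ?w I g" "(\<Prod>j\<in>I. c j ((g(i := y)) j)) = ?c I g" for g y
    using insert.hyps by (auto intro!: sum.cong prod.cong)
  have comp: "?w (insert i I) \<circ> ?h = (\<lambda>(y, g). w i y + ?w I g)" "?c (insert i I) \<circ> ?h = (\<lambda>(y, g). c i y * ?c I g)"
    using insert.hyps upd by (auto simp: fun_eq_iff)
  have i: "fin_graded (A i) (w i)" and I: "fin_graded (PiE I A) (?w I)"
    and IH: "gf (PiE I A) (?w I) (?c I) = (\<Prod>i\<in>I. gf (A i) (w i) (c i))"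
    using insert by auto
  have "gf (PiE (insert i I) A) (?w (insert i I)) (?c (insert i I)) =
      gf (A i) (w i) (c i) * gf (PiE I A) (?w I) (?c I)"
    unfolding gf_bij_betw[OF bij_betw_PiE_insert[OF insert.hyps(2)]] comp gf_times(1)[OF i I] ..
  moreover have "fin_graded (PiE (insert i I) A) (?w (insert i I))"
    unfolding fin_graded_bij_betw[OF bij_betw_PiE_insert[OF insert.hyps(2)]] comp by (rule gf_times(2)[OF i I])
  ultimately show ?case using insert.hyps IH by simp
qed

lemma gf_fibers:
  assumes B: "fin_graded B w" and \<pi>: "\<And>a. a \<in> A \<Longrightarrow> \<pi> a \<in> B"
    and fin: "\<And>b. b \<in> B \<Longrightarrow> finite {a\<in>A. \<pi> a = b}"
  shows "gf A (\<lambda>a. w (\<pi> a)) c = gf B w (\<lambda>b. \<Sum>a\<in>{a\<in>A. \<pi> a = b}. c a)"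
    and "fin_graded A (\<lambda>a. w (\<pi> a))"
proof -
  have eq: "{a\<in>A. w (\<pi> a) = n} = (\<Union>b\<in>{b\<in>B. w b = n}. {a\<in>A. \<pi> a = b})" for n
    using \<pi> by auto
  show "fin_graded A (\<lambda>a. w (\<pi> a))"
    unfolding fin_graded_def eq using B fin by (auto simp: fin_graded_def)
  show "gf A (\<lambda>a. w (\<pi> a)) c = gf B w (\<lambda>b. \<Sum>a\<in>{a\<in>A. \<pi> a = b}. c a)"
  proof (rule fps_ext)
    fix n
    have "(\<Sum>a\<in>(\<Union>b\<in>{b\<in>B. w b = n}. {a\<in>A. \<pi> a = b}). c a) =
      (\<Sum>b\<in>{b\<in>B. w b = n}. \<Sum>a\<in>{a\<in>A. \<pi> a = b}. c a)"
      using B fin by (intro sum.UNION_disjoint) (auto simp: fin_graded_def)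
    then show "fps_nth (gf A (\<lambda>a. w (\<pi> a)) c) n = fps_nth (gf B w (\<lambda>b. \<Sum>a\<in>{a\<in>A. \<pi> a = b}. c a)) n"
      by (simp only: gf_def eq fps_nth_Abs_fps)
  qed
qed

text \<open>In the q-adic topology a coefficient is final once the finite set contains all objects
  of that weight.\<close>

lemma has_sum_gf:
  assumes "fin_graded A w"
  shows "((\<lambda>a. fps_X ^ w a * fps_const (c a)) has_sum gf A w c) A"
  unfolding has_sum_def tendsto_fps_iff eventually_finite_subsets_at_top
proof (intro allI exI conjI impI)
  fix n
  let ?X = "{a\<in>A. w a = n}"
  show fin: "finite ?X" using assms by (simp add: fin_graded_def)
  show "?X \<subseteq> A" by auto
  fix Y assume Y: "finite Y \<and> ?X \<subseteq> Y \<and> Y \<subseteq> A"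
  have "fps_nth (fps_X ^ w a * fps_const (c a)) n = (if w a = n then c a else 0)" for a
    by (simp add: fps_X_power_iff)
  then have "fps_nth (\<Sum>a\<in>Y. fps_X ^ w a * fps_const (c a)) n = (\<Sum>a\<in>Y. if w a = n then c a else 0)"
    by (simp only: fps_sum_nth)
  also have "\<dots> = (\<Sum>a\<in>?X. c a)"
    using Y by (intro sum.mono_neutral_cong_right) auto
  finally show "fps_nth (\<Sum>a\<in>Y. fps_X ^ w a * fps_const (c a)) n = fps_nth (gf A w c) n"
    by (simp add: gf_def)
qed

lemma gf_multiples:
  assumes "m > 0"
  shows "gf UNIV (\<lambda>n. m * n) C = Abs_fps C oo fps_X ^ m" and "fin_graded UNIV (\<lambda>n. m * n)"
proof -
  have eq: "{n \<in> UNIV. m * n = k} = (if m dvd k then {k div m} else {})" for k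
    using assms by auto
  show "gf UNIV (\<lambda>n. m * n) C = Abs_fps C oo fps_X ^ m"
    by (rule fps_ext) (simp only: gf_def eq fps_nth_compose_X_power fps_nth_Abs_fps, simp)
  show "fin_graded UNIV (\<lambda>n. m * n)"
    unfolding fin_graded_def eq by simp
qed

text \<open>The equation determines coefficient \<open>n + 1\<close> from the earlier ones, as
  \<open>n + 1\<close> is invertible in characteristic 0.\<close>

lemma fps_eq_exp_series:
  fixes F :: "'a::field_char_0 fps"
  assumes F0: "fps_nth F 0 = 1" and f0: "fps_nth f 0 = 0" and ode: "fps_deriv F = F * fps_deriv f"
  shows "F = exp_series f"
proof (rule fps_ext)
  have E0: "fps_nth (exp_series f) 0 = 1" by (simp add: exp_series_def)
  have ode': "fps_deriv (exp_series f) = exp_series f * fps_deriv f"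
    using f0 by (simp add: exp_series_def fps_compose_deriv)
  have rec: "of_nat (Suc n) * fps_nth G (Suc n) = (\<Sum>i\<le>n. fps_nth G i * fps_nth (fps_deriv f) (n - i))"
    if "fps_deriv G = G * fps_deriv f" for G n
    using arg_cong[OF that, of "\<lambda>G. fps_nth G n"] by (simp add: fps_mult_nth atLeast0AtMost)
  fix n
  show "fps_nth F n = fps_nth (exp_series f) n"
  proof (induction n rule: less_induct)
    case (less n)
    show ?case
    proof (cases n)
      case (Suc m)
      have "of_nat (Suc m) * fps_nth F (Suc m) = of_nat (Suc m) * fps_nth (exp_series f) (Suc m)"
        unfolding rec[OF ode] rec[OF ode'] using less Suc by (intro sum.cong) auto
      moreover have "of_nat (Suc m) \<noteq> (0 :: 'a)" by (simp only: of_nat_eq_0_iff)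
      ultimately show ?thesis using Suc by (metis mult_left_cancel)
    qed (use F0 E0 in simp)
  qed
qed

lemma exp_series_power:
  fixes f :: "'a::field_char_0 fps"
  assumes "fps_nth f 0 = 0"
  shows "exp_series f ^ m = exp_series (of_nat m * f)"
proof (rule fps_eq_exp_series)
  show "fps_deriv (exp_series f ^ m) = exp_series f ^ m * fps_deriv (of_nat m * f)"
  proof (cases m)
    case (Suc k)
    have "fps_deriv (exp_series f) = exp_series f * fps_deriv f"
      using assms by (simp add: exp_series_def fps_compose_deriv)
    then have "fps_deriv (exp_series f ^ Suc k) = of_nat (Suc k) * (exp_series f * fps_deriv f) * exp_series f ^ k"
      by (simp only: fps_deriv_power' diff_Suc_1)
    moreover have "fps_deriv (of_nat (Suc k) * f) = of_nat (Suc k) * fps_deriv f"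
      by (simp only: fps_of_nat[symmetric] fps_deriv_mult_const_left)
    ultimately show ?thesis unfolding Suc by (simp only: power_Suc mult_ac)
  qed simp
qed (use assms in \<open>simp_all add: exp_series_def fps_power_zeroth\<close>)

lemma exp_series_compose:
  fixes f g :: "'a::field_char_0 fps"
  assumes "fps_nth f 0 = 0" "fps_nth g 0 = 0"
  shows "exp_series f oo g = exp_series (f oo g)"
  unfolding exp_series_def using assms by (simp add: fps_compose_assoc)

lemma fps_eq_exp_quadratic:
  fixes F :: "'a::field_char_0 fps"
  assumes "fps_nth F 0 = 1"
    and "\<And>n. of_nat (Suc n) * fps_nth F (Suc n) = \<alpha> * fps_nth F n + (case n of 0 \<Rightarrow> 0 | Suc m \<Rightarrow> \<beta> * fps_nth F m)"
  shows "F = exp_series (fps_const \<alpha> * fps_X + fps_const (\<beta> / 2) * fps_X ^ 2)"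
proof (rule fps_eq_exp_series)
  have "fps_deriv (fps_X ^ 2) = (fps_const 2 * fps_X :: 'a fps)"
    by (rule fps_ext) (simp add: power2_eq_square fps_numeral_nth)
  then have "fps_deriv (fps_const (\<beta> / 2) * fps_X ^ 2) = (fps_const (\<beta> / 2) * fps_const 2) * fps_X"
    by (simp only: fps_deriv_mult_const_left mult.assoc)
  also have "fps_const (\<beta> / 2) * fps_const 2 = fps_const \<beta>"
    by (simp only: fps_const_mult) simp
  finally have "fps_deriv (fps_const \<alpha> * fps_X + fps_const (\<beta> / 2) * fps_X ^ 2) = fps_const \<alpha> + fps_const \<beta> * fps_X"
    by (simp only: fps_deriv_add fps_deriv_mult_const_left fps_deriv_fps_X mult_1_right)
  moreover have "fps_deriv F = F * (fps_const \<alpha> + fps_const \<beta> * fps_X)"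
  proof (rule fps_ext)
    fix n
    have "F * (fps_const \<alpha> + fps_const \<beta> * fps_X) = fps_const \<alpha> * F + fps_const \<beta> * (fps_X * F)"
      by (simp add: algebra_simps)
    then show "fps_nth (fps_deriv F) n = fps_nth (F * (fps_const \<alpha> + fps_const \<beta> * fps_X)) n"
      using assms(2)[of n] by (cases n) simp_all
  qed
  ultimately show "fps_deriv F = F * fps_deriv (fps_const \<alpha> * fps_X + fps_const (\<beta> / 2) * fps_X ^ 2)"
    by simp
qed (use assms(1) in simp_all)

text \<open>Factor \<open>j\<close> is 1 up to terms of order above \<open>j\<close>, so the later
  factors leave coefficient \<open>n\<close> unchanged.\<close>

lemma
  fixes a q :: "'a::idom fps"
  assumes a: "fps_nth a 0 = 0" and q: "fps_nth q 0 = 0"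
  shows qpoch_inf_nth: "n \<le> J \<Longrightarrow> fps_nth (qpoch_inf a q) n = fps_nth (\<Prod>j<J. 1 - a * q ^ j) n"
proof -
  define P where "P = (\<lambda>J. \<Prod>j<J. 1 - a * q ^ j)"
  define L where "L = Abs_fps (\<lambda>n. fps_nth (P n) n)"
  have low: "fps_nth (a * q ^ j * G) i = 0" if "i \<le> j" for i j G
  proof -
    have X: "f = fps_X * fps_shift 1 f" if "fps_nth f 0 = 0" for f :: "'a fps"
    proof (rule fps_ext)
      fix n show "fps_nth f n = fps_nth (fps_X * fps_shift 1 f) n" using that by (cases n) simp_all
    qed
    obtain a' q' where a': "a = fps_X * a'" and q': "q = fps_X * q'"
      using X[OF a] X[OF q] by blast
    have "a * q ^ j * G = fps_X ^ Suc j * (a' * q' ^ j * G)"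
      by (simp add: a' q' power_mult_distrib algebra_simps)
    then show ?thesis using that by (simp only: fps_X_power_mult_nth) simp
  qed
  have step: "fps_nth (P (Suc J)) n = fps_nth (P J) n" if "n \<le> J" for n J
    using low[OF that, of "P J"] by (simp add: P_def algebra_simps)
  have stable: "fps_nth (P J) n = fps_nth L n" if "n \<le> J" for n J
    using that by (induction J rule: dec_induct) (simp_all add: L_def step)
  have "(\<lambda>n. \<Prod>i\<le>n. 1 - a * q ^ i) \<longlonglongrightarrow> L"
    unfolding tendsto_fps_iff
  proof
    fix n
    show "\<forall>\<^sub>F N in sequentially. fps_nth (\<Prod>i\<le>N. 1 - a * q ^ i) n = fps_nth L n"
      using eventually_ge_at_top[of n]
    proof eventually_elim
      case (elim N)
      then show ?case using stable[of n "Suc N"] by (simp add: P_def lessThan_Suc_atMost)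
    qed
  qed
  \<comment> \<open>\<open>raw_has_prod\<close> demands a nonzero limit; the constant term of this
    one is 1.\<close>
  moreover have "L \<noteq> 0"
  proof
    assume "L = 0"
    then have "fps_nth L 0 = 0" by simp
    then show False by (simp add: L_def P_def)
  qed
  ultimately have "(\<lambda>j. 1 - a * q ^ j) has_prod L"
    by (simp add: has_prod_def raw_has_prod_def)
  then have "qpoch_inf a q = L" by (simp add: qpoch_inf_def has_prod_unique[symmetric])
  then show "n \<le> J \<Longrightarrow> fps_nth (qpoch_inf a q) n = fps_nth (\<Prod>j<J. 1 - a * q ^ j) n"
    using stable by (simp add: P_def)
qed

lemma fps_nth_mult_cong:
  assumes "\<And>i. i \<le> n \<Longrightarrow> fps_nth a i = fps_nth a' i" "\<And>i. i \<le> n \<Longrightarrow> fps_nth b i = fps_nth b' i"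
  shows "fps_nth (a * b) n = fps_nth (a' * b') n"
  unfolding fps_mult_nth using assms by (intro sum.cong) auto

text \<open>Since \<open>d < u d\<close>, a set of weight at most \<open>J\<close> lies below
  \<open>J\<close> and appears in the expansion of the first \<open>J\<close> factors.\<close>

lemma gf_finite_subsets:
  fixes c :: "nat \<Rightarrow> 'a::comm_ring_1"
  assumes u: "\<And>d. d < u d"
  shows "fin_graded {D. finite D} (\<lambda>D. \<Sum>d\<in>D. u d)"
    and "n \<le> J \<Longrightarrow> fps_nth (gf {D. finite D} (\<lambda>D. \<Sum>d\<in>D. u d) (\<lambda>D. \<Prod>d\<in>D. c d)) n =
      fps_nth (\<Prod>d<J. 1 + fps_const (c d) * fps_X ^ u d) n"
proof -
  have sub: "D \<subseteq> {..<J}" if "finite D" "(\<Sum>d\<in>D. u d) \<le> J" for D J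
  proof
    fix d assume "d \<in> D"
    then have "u d \<le> (\<Sum>d\<in>D. u d)" using that by (intro member_le_sum) auto
    then show "d \<in> {..<J}" using u[of d] that by simp
  qed
  then have "{D \<in> {D. finite D}. (\<Sum>d\<in>D. u d) = n} \<subseteq> Pow {..<n}" for n by auto
  then show "fin_graded {D. finite D} (\<lambda>D. \<Sum>d\<in>D. u d)"
    unfolding fin_graded_def by (meson finite_Pow_iff finite_lessThan finite_subset)
  assume "n \<le> J"
  have "(\<Prod>d<J. 1 + fps_const (c d) * fps_X ^ u d) = (\<Prod>d<J. fps_const (c d) * fps_X ^ u d + 1)"
    by (simp add: add.commute)
  also have "\<dots> = (\<Sum>D\<in>Pow {..<J}. \<Prod>d\<in>D. fps_const (c d) * fps_X ^ u d)"
    by (subst prod_add) simp_all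
  also have "\<dots> = (\<Sum>D\<in>Pow {..<J}. fps_const (\<Prod>d\<in>D. c d) * fps_X ^ (\<Sum>d\<in>D. u d))"
  proof (intro sum.cong refl)
    fix D
    show "(\<Prod>d\<in>D. fps_const (c d) * fps_X ^ u d) = fps_const (\<Prod>d\<in>D. c d) * fps_X ^ (\<Sum>d\<in>D. u d)"
      by (induction D rule: infinite_finite_induct) (simp_all add: power_add mult_ac flip: fps_const_mult)
  qed
  finally have "fps_nth (\<Prod>d<J. 1 + fps_const (c d) * fps_X ^ u d) n =
    (\<Sum>D\<in>Pow {..<J}. if (\<Sum>d\<in>D. u d) = n then \<Prod>d\<in>D. c d else 0)"
    by (simp add: fps_sum_nth fps_X_power_iff if_distrib eq_commute cong: if_cong)
  also have "\<dots> = (\<Sum>D\<in>{D \<in> {D. finite D}. (\<Sum>d\<in>D. u d) = n}. \<Prod>d\<in>D. c d)"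
    using sub \<open>n \<le> J\<close> finite_subset[of _ "{..<J}"] by (intro sum.mono_neutral_cong_right) auto
  finally show "fps_nth (gf {D. finite D} (\<lambda>D. \<Sum>d\<in>D. u d) (\<lambda>D. \<Prod>d\<in>D. c d)) n =
      fps_nth (\<Prod>d<J. 1 + fps_const (c d) * fps_X ^ u d) n"
    by (simp add: gf_def)
qed

text \<open>\<open>2 * d + 1\<close> is 1 modulo 4 for even \<open>d\<close> and 3 for odd
  \<open>d\<close>, so the two products together run over all odd exponents.\<close>

lemma qpoch_inf_odd_parts:
  fixes b b' :: "'a::idom"
  shows "qpoch_inf (- (fps_const b * fps_X)) (fps_X ^ 4) * qpoch_inf (- (fps_const b' * fps_X ^ 3)) (fps_X ^ 4) =
    gf {D. finite D} (\<lambda>D. \<Sum>d\<in>D. 2 * d + 1) (\<lambda>D. \<Prod>d\<in>D. if even d then b else b')"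
    (is "?A * ?B = _")
proof (rule fps_ext)
  fix n
  let ?c = "\<lambda>d. if even d then b else b'"
  let ?P = "\<lambda>J. \<Prod>j<J. 1 - (- (fps_const b * fps_X)) * (fps_X ^ 4) ^ j"
  let ?Q = "\<lambda>J. \<Prod>j<J. 1 - (- (fps_const b' * fps_X ^ 3)) * (fps_X ^ 4) ^ j"
  have prod: "?P J * ?Q J = (\<Prod>d<2 * J. 1 + fps_const (?c d) * fps_X ^ (2 * d + 1))" for J
  proof (induction J)
    case (Suc J)
    have 1: "1 - (- (fps_const b * fps_X)) * (fps_X ^ 4) ^ J = 1 + fps_const (?c (2 * J)) * fps_X ^ (2 * (2 * J) + 1)"
      by (simp add: power_mult[symmetric] mult.assoc flip: power_Suc)
    have 2: "1 - (- (fps_const b' * fps_X ^ 3)) * (fps_X ^ 4) ^ J =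
        1 + fps_const (?c (Suc (2 * J))) * fps_X ^ (2 * Suc (2 * J) + 1)"
    proof -
      have "2 * Suc (2 * J) + 1 = 3 + 4 * J" by simp
      then show ?thesis unfolding \<open>2 * Suc (2 * J) + 1 = 3 + 4 * J\<close> power_add power_mult by (simp add: mult.assoc)
    qed
    have "?P (Suc J) * ?Q (Suc J) = (?P J * ?Q J) * ((1 + fps_const (?c (2 * J)) * fps_X ^ (2 * (2 * J) + 1)) *
        (1 + fps_const (?c (Suc (2 * J))) * fps_X ^ (2 * Suc (2 * J) + 1)))"
      unfolding prod.lessThan_Suc 1 2 by (simp only: mult_ac)
    also have "\<dots> = (\<Prod>d<Suc (Suc (2 * J)). 1 + fps_const (?c d) * fps_X ^ (2 * d + 1))"
      unfolding Suc prod.lessThan_Suc by (simp only: mult_ac)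
    finally show ?case by (simp only: mult_Suc_right add_2_eq_Suc)
  qed simp
  have "fps_nth (?A * ?B) n = fps_nth (?P n * ?Q n) n"
    by (intro fps_nth_mult_cong qpoch_inf_nth) simp_all
  also have "\<dots> = fps_nth (gf {D. finite D} (\<lambda>D. \<Sum>d\<in>D. 2 * d + 1) (\<lambda>D. \<Prod>d\<in>D. ?c d)) n"
    unfolding prod by (rule gf_finite_subsets(2)[symmetric]) auto
  finally show "fps_nth (?A * ?B) n =
    fps_nth (gf {D. finite D} (\<lambda>D. \<Sum>d\<in>D. 2 * d + 1) (\<lambda>D. \<Prod>d\<in>D. ?c d)) n" .
qed

lemma card_beta_sets_stable:
  assumes "n \<le> k" "k \<le> k'"
  shows "card (beta_sets k' n) = card (beta_sets k n)"
  using assms(2,1) by (induction k' rule: dec_induct) (simp_all add: card_beta_sets_Suc)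

text \<open>By \<open>card_beta_sets_Suc\<close> the series \<open>p k\<close> for at most
  \<open>k\<close> parts satisfies \<open>p (Suc k) * (1 - fps_X ^ Suc k) = p k\<close>, so the
  product telescopes. Each \<open>C n\<close> has its own number of beads, hence the comparison with
  \<open>p n\<close> only up to coefficient \<open>n\<close>.\<close>

lemma euler_partition_identity:
  fixes C :: "nat \<Rightarrow> 'a::idom"
  assumes m: "m > 0" and C: "\<And>n. \<exists>k\<ge>n. C n = of_nat (card (beta_sets k n))"
  shows "(Abs_fps C oo fps_X ^ m) * qpoch_inf (fps_X ^ m) (fps_X ^ m) = 1"
proof -
  define y :: "'a fps" where "y = fps_X ^ m"
  define p :: "nat \<Rightarrow> 'a fps" where "p = (\<lambda>k. Abs_fps (\<lambda>n. of_nat (card (beta_sets k n))))"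
  have y0: "fps_nth y 0 = 0" using m by (simp add: y_def)
  have "p (Suc k) = p k + fps_X ^ Suc k * p (Suc k)" for k
  proof (rule fps_ext)
    fix n
    have "fps_nth (fps_X ^ Suc k * p (Suc k)) n = (if Suc k \<le> n then of_nat (card (beta_sets (Suc k) (n - Suc k))) else 0)"
      by (simp only: fps_X_power_mult_nth p_def fps_nth_Abs_fps not_less[symmetric] if_not_P if_P) simp
    then show "fps_nth (p (Suc k)) n = fps_nth (p k + fps_X ^ Suc k * p (Suc k)) n"
      by (simp only: fps_add_nth) (simp only: p_def fps_nth_Abs_fps card_beta_sets_Suc[of k n] of_nat_add of_nat_0 split: if_split, simp)
  qed
  then have "p (Suc k) * (1 - fps_X ^ Suc k) = p k" for k
    by (metis (no_types, lifting) add_diff_cancel_right' mult.commute mult.right_neutral right_diff_distrib)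
  moreover have "fps_X ^ Suc k oo y = y * y ^ k" for k
    using fps_X_power_compose[OF y0, of "Suc k"] by (simp only: power_Suc)
  ultimately have step: "(p (Suc k) oo y) * (1 - y * y ^ k) = p k oo y" for k
    using fps_compose_mult_distrib[OF y0, of "p (Suc k)" "1 - fps_X ^ Suc k"]
    by (simp only: fps_compose_sub_distrib fps_compose_1)
  have prod: "(p k oo y) * (\<Prod>j<k. 1 - y * y ^ j) = 1" for k
  proof (induction k)
    case 0
    have "p 0 = 1" by (rule fps_ext) (simp add: p_def card_beta_sets_0)
    then show ?case by simp
  next
    case (Suc k)
    have "(p (Suc k) oo y) * (\<Prod>j<Suc k. 1 - y * y ^ j) =
        ((p (Suc k) oo y) * (1 - y * y ^ k)) * (\<Prod>j<k. 1 - y * y ^ j)"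
      by (simp only: prod.lessThan_Suc mult_ac)
    then show ?case using Suc by (simp only: step)
  qed
  have C_eq: "C i = of_nat (card (beta_sets n i))" if "i \<le> n" for i n
    using C[of i] card_beta_sets_stable[of i i] that by (metis order_refl)
  have "fps_nth ((Abs_fps C oo y) * qpoch_inf y y) n = fps_nth ((p n oo y) * (\<Prod>j<n. 1 - y * y ^ j)) n" for n
  proof (intro fps_nth_mult_cong qpoch_inf_nth y0)
    fix i assume "i \<le> n"
    then have "i div m \<le> n" by (meson div_le_dividend le_trans)
    then show "fps_nth (Abs_fps C oo y) i = fps_nth (p n oo y) i"
      unfolding y_def fps_nth_compose_X_power p_def by (simp add: C_eq)
  qed
  then show ?thesis unfolding prod y_def[symmetric] by (simp add: fps_eq_iff)
qed

section \<open>Self-conjugate partitions\<close>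

lemma rsum_affine: "rsum (\<lambda>m. a * m + d) S = a * rsum (\<lambda>m. m) S + d * charge S"
  by (simp add: rsum_def charge_def sum.distrib sum_distrib_left algebra_simps)

text \<open>A bead \<open>s\<close> and its mirror gap count together as
  \<open>s - (- 1 - s) = 2 * s + 1\<close>. Summing this over the positions \<open>t * m + r\<close>
  with \<open>0 \<le> m < c\<close> gives the size due to a hook-free runner of charge
  \<open>c \<ge> 0\<close>.\<close>

definition theta_exponent :: "nat \<Rightarrow> nat \<Rightarrow> int \<Rightarrow> int" where
  "theta_exponent t r c = int t * (c * (c - 1)) + (2 * int r + 1) * c"

text \<open>For even \<open>t\<close> all positions of a runner have the parity of \<open>r\<close>,
  so each unit of charge adds \<open>(-1) ^ r\<close> to the BG-rank.\<close>

definition theta :: "'a::field \<Rightarrow> nat \<Rightarrow> nat \<Rightarrow> 'a fps" where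
  "theta b t r = gf UNIV (\<lambda>c. nat (theta_exponent t r c)) (\<lambda>c. b powi ((-1) ^ r * c))"

text \<open>Ensures that \<open>nat\<close> in \<open>theta\<close> loses nothing and that each
  exponent has finitely many charges. For negative \<open>c\<close> it rests on
  \<open>2 * r + 1 < t\<close>, that is, on taking the lower half of the runners.\<close>

lemma abs_le_theta_exponent:
  assumes "r < t div 2"
  shows "\<bar>c\<bar> \<le> theta_exponent t r c"
proof (cases "c \<ge> 0")
  case True
  have "c * (c - 1) \<ge> 0" using True by (cases "c = 0") auto
  then have "int t * (c * (c - 1)) \<ge> 0" by simp
  moreover have "(2 * int r + 1) * c \<ge> 1 * c" using True by (intro mult_right_mono) auto
  ultimately show ?thesis using True by (simp add: theta_exponent_def)
next
  case False
  define a where "a = - c"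
  have a: "a \<ge> 1" "c = - a" using False by (simp_all add: a_def)
  have "int t * 2 \<le> int t * (a + 1)" using a by (intro mult_left_mono) auto
  moreover have "2 * int r + 1 < int t" using assms by linarith
  ultimately have "int t * (a + 1) - (2 * int r + 1) \<ge> 1" by linarith
  then have "a * 1 \<le> a * (int t * (a + 1) - (2 * int r + 1))" using a by (intro mult_left_mono) auto
  also have "\<dots> = theta_exponent t r c" by (simp add: theta_exponent_def a algebra_simps)
  finally show ?thesis using a by simp
qed

lemma rsum_runner_weight:
  assumes "maya S"
  shows "rsum (\<lambda>m. 2 * (int t * m + int r) + 1) S = theta_exponent t r (charge S) + 2 * int t * int (card (hooks S))"
proof -
  have "rsum (\<lambda>m. 2 * (int t * m + int r) + 1) S = int t * (2 * rsum (\<lambda>m. m) S) + (2 * int r + 1) * charge S"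
    using rsum_affine[of "2 * int t" "2 * int r + 1" S] by (simp add: algebra_simps)
  then show ?thesis unfolding rsum_id[OF assms] by (simp add: theta_exponent_def algebra_simps)
qed

text \<open>The weight is a function of the charge plus \<open>2 * t\<close> times the number of
  hooks. As \<open>C n\<close> is the same for all charges, grouping by these two numbers factors
  the series.\<close>

lemma gf_maya:
  fixes b :: "'a::field"
  assumes r: "r < t div 2" and C: "\<And>c n. (\<Sum>S\<in>mayas c n. hooks_prod f S) = C n"
  defines "w \<equiv> \<lambda>S. nat (rsum (\<lambda>m. 2 * (int t * m + int r) + 1) S)"
  shows "gf (Collect maya) w (\<lambda>S. b powi ((-1) ^ r * charge S) * hooks_prod f S) =
      theta b t r * gf UNIV (\<lambda>n. 2 * t * n) C"
    and "fin_graded (Collect maya) w"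
proof -
  let ?u = "\<lambda>c. nat (theta_exponent t r c)"
  let ?v = "\<lambda>(c, n). ?u c + 2 * t * n"
  let ?\<pi> = "\<lambda>S. (charge S, card (hooks S))"
  have t: "2 * t > 0" using r by auto
  have nonneg: "theta_exponent t r c \<ge> 0" for c using abs_le_theta_exponent[OF r, of c] by linarith
  have u: "fin_graded UNIV ?u"
    unfolding fin_graded_def
  proof
    fix n
    have "{c \<in> UNIV. ?u c = n} \<subseteq> {- int n..int n}"
    proof safe
      fix c
      show "c \<in> {- int (?u c)..int (?u c)}" using abs_le_theta_exponent[OF r, of c] by auto
    qed
    then show "finite {c \<in> UNIV. ?u c = n}" by (rule finite_subset) simp
  qed
  note v = gf_times[OF u gf_multiples(2)[OF t]]
  have v_fin: "fin_graded UNIV ?v" using v(2) by simp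
  have fiber: "{S \<in> Collect maya. ?\<pi> S = (c, n)} = mayas c n" for c n
    by (auto simp: mayas_def)
  have fin: "finite {S \<in> Collect maya. ?\<pi> S = p}" for p
    by (cases p) (simp only: fiber finite_mayas)
  have w: "w S = ?v (?\<pi> S)" if "S \<in> Collect maya" for S
  proof -
    have "maya S" using that by simp
    from rsum_runner_weight[OF this, of t r] have "int (w S) = int (?v (?\<pi> S))"
      using nonneg[of "charge S"] by (simp add: w_def)
    then show ?thesis by (simp only: of_nat_eq_iff)
  qed
  note fibers = gf_fibers[where A = "Collect maya" and B = UNIV and w = ?v and \<pi> = ?\<pi>, OF v_fin UNIV_I fin]
  have "gf (Collect maya) w (\<lambda>S. b powi ((-1) ^ r * charge S) * hooks_prod f S) =
    gf (Collect maya) (\<lambda>S. ?v (?\<pi> S)) (\<lambda>S. b powi ((-1) ^ r * charge S) * hooks_prod f S)"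
    by (rule gf_cong) (simp_all only: w)
  also have "\<dots> = gf UNIV ?v (\<lambda>p. \<Sum>S\<in>{S \<in> Collect maya. ?\<pi> S = p}. b powi ((-1) ^ r * charge S) * hooks_prod f S)"
    by (rule fibers(1))
  also have "\<dots> = gf UNIV ?v (\<lambda>(c, n). b powi ((-1) ^ r * c) * C n)"
  proof (rule gf_cong)
    fix p :: "int \<times> nat"
    obtain c n where p: "p = (c, n)" by (cases p)
    have "(\<Sum>S\<in>mayas c n. b powi ((-1) ^ r * charge S) * hooks_prod f S) =
        (\<Sum>S\<in>mayas c n. b powi ((-1) ^ r * c) * hooks_prod f S)"
      by (intro sum.cong) (auto simp: mayas_def)
    then show "(\<Sum>S\<in>{S \<in> Collect maya. ?\<pi> S = p}. b powi ((-1) ^ r * charge S) * hooks_prod f S) =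
        (case p of (c, n) \<Rightarrow> b powi ((-1) ^ r * c) * C n)"
      unfolding p fiber by (simp add: sum_distrib_left[symmetric] C)
  qed simp
  also have "\<dots> = theta b t r * gf UNIV (\<lambda>n. 2 * t * n) C"
    unfolding theta_def v(1) by simp
  finally show "gf (Collect maya) w (\<lambda>S. b powi ((-1) ^ r * charge S) * hooks_prod f S) =
      theta b t r * gf UNIV (\<lambda>n. 2 * t * n) C" .
  have "{S \<in> Collect maya. w S = n} = {S \<in> Collect maya. ?v (?\<pi> S) = n}" for n
    using w by auto
  then show "fin_graded (Collect maya) w" using fibers(2) unfolding fin_graded_def by simp
qed

lemma power_int_sum:
  fixes b :: "'a::field"
  assumes "b \<noteq> 0"
  shows "b powi (\<Sum>i\<in>I. f i) = (\<Prod>i\<in>I. b powi f i)"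
  using assms by (induction I rule: infinite_finite_induct) (simp_all add: power_int_add)

text \<open>The hook weight \<open>f\<close> stays free because the factorisation is applied twice,
  to the constant 1 and to the weight of the theorem.\<close>

lemma gf_self_conjugate:
  fixes b :: "'a::field" and f :: "nat \<Rightarrow> 'a"
  assumes t: "even t" "t > 0" and b: "b \<noteq> 0"
    and C: "\<And>c n. (\<Sum>S\<in>mayas c n. hooks_prod (\<lambda>h. f (t * h) ^ 2) S) = C n"
  shows "gf self_conjugate_partitions sum_list (\<lambda>\<mu>. b powi BG_rank \<mu> * (\<Prod>h\<in>#hooks_div t \<mu>. f h)) =
      (\<Prod>r<t div 2. theta b t r) * gf UNIV (\<lambda>n. 2 * t * n) C ^ (t div 2)"
    and "fin_graded self_conjugate_partitions sum_list"
proof -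
  let ?I = "{..<t div 2}"
  let ?w = "\<lambda>r S. nat (rsum (\<lambda>m. 2 * (int t * m + int r) + 1) S)"
  let ?c = "\<lambda>r S. b powi ((-1) ^ r * charge S) * hooks_prod (\<lambda>h. f (t * h) ^ 2) S"
  let ?h = "(\<lambda>S. \<lambda>r\<in>?I. runner t r S) \<circ> maya_of"
  have bij: "bij_betw ?h self_conjugate_partitions (?I \<rightarrow>\<^sub>E Collect maya)"
    by (rule bij_betw_trans[OF bij_betw_maya_of bij_betw_runners[OF t(2,1)]])
  have sc: "is_partition \<mu>" "maya_of \<mu> \<in> sym_mayas" if "\<mu> \<in> self_conjugate_partitions" for \<mu>
    using that bij_betw_maya_of by (auto simp: self_conjugate_partitions_def bij_betw_def)
  have weight: "((\<lambda>g. \<Sum>r<t div 2. ?w r (g r)) \<circ> ?h) \<mu> = sum_list \<mu>" if \<mu>: "\<mu> \<in> self_conjugate_partitions" for \<mu>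
  proof -
    let ?R = "\<lambda>r. runner t r (maya_of \<mu>)"
    have "int (sum_list \<mu>) = (\<Sum>r<t div 2. rsum (\<lambda>m. 2 * (int t * m + int r) + 1) (?R r))"
      using rsum_sym_runners[OF t(2,1) sc(2)[OF \<mu>], of "\<lambda>s. s"]
      by (simp add: sum_list_eq_rsum[OF sc(1)[OF \<mu>]] algebra_simps)
    also have "\<dots> = (\<Sum>r<t div 2. int (?w r (?R r)))"
    proof (intro sum.cong refl)
      fix r assume "r \<in> ?I"
      then have r: "r < t div 2" "r < t" by auto
      have "maya (?R r)" by (rule maya_runner[OF t(2) maya_maya_of r(2)])
      then have "rsum (\<lambda>m. 2 * (int t * m + int r) + 1) (?R r) \<ge> 0"
        using abs_le_theta_exponent[OF r(1), of "charge (?R r)"] by (subst rsum_runner_weight) auto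
      then show "rsum (\<lambda>m. 2 * (int t * m + int r) + 1) (?R r) = int (?w r (?R r))" by simp
    qed
    finally have "int (sum_list \<mu>) = int (\<Sum>r<t div 2. ?w r (?R r))" by (simp only: of_nat_sum)
    then show ?thesis by (simp only: of_nat_eq_iff) simp
  qed
  have coeff: "((\<lambda>g. \<Prod>r<t div 2. ?c r (g r)) \<circ> ?h) \<mu> = b powi BG_rank \<mu> * (\<Prod>h\<in>#hooks_div t \<mu>. f h)"
    if \<mu>: "\<mu> \<in> self_conjugate_partitions" for \<mu>
  proof -
    let ?R = "\<lambda>r. runner t r (maya_of \<mu>)"
    have "of_bool (even (int t * m + int r)) - of_bool (even (- 1 - (int t * m + int r))) = ((-1) ^ r :: int)" for m r
      using t(1) by (cases "even r") auto
    then have "BG_rank \<mu> = (\<Sum>r<t div 2. rsum (\<lambda>m. (-1) ^ r) (?R r))"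
      using rsum_sym_runners[OF t(2,1) sc(2)[OF \<mu>], of "\<lambda>s. of_bool (even s)"]
      by (simp add: BG_rank_eq_rsum[OF sc(1)[OF \<mu>]])
    also have "\<dots> = (\<Sum>r<t div 2. (-1) ^ r * charge (?R r))"
      using rsum_affine[of 0] by simp
    finally have "b powi BG_rank \<mu> = (\<Prod>r<t div 2. b powi ((-1) ^ r * charge (?R r)))"
      by (simp add: power_int_sum[OF b])
    moreover have "(\<Prod>h\<in>#hooks_div t \<mu>. f h) = (\<Prod>r<t div 2. hooks_prod (\<lambda>h. f (t * h) ^ 2) (?R r))"
      unfolding prod_mset_hooks_div[OF sc(1)[OF \<mu>]] by (rule hooks_prod_sym_runners[OF t(2,1) sc(2)[OF \<mu>]])
    ultimately show ?thesis by (simp add: prod.distrib)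
  qed
  have r_gf: "gf (Collect maya) (?w r) (?c r) = theta b t r * gf UNIV (\<lambda>n. 2 * t * n) C" "fin_graded (Collect maya) (?w r)"
    if "r \<in> ?I" for r
    using gf_maya(1)[OF _ C, of r t b] gf_maya(2)[OF _ C, of r t] that by auto
  have PiE: "gf (?I \<rightarrow>\<^sub>E Collect maya) (\<lambda>g. \<Sum>r<t div 2. ?w r (g r)) (\<lambda>g. \<Prod>r<t div 2. ?c r (g r)) =
      (\<Prod>r<t div 2. gf (Collect maya) (?w r) (?c r))"
    and fin: "fin_graded (?I \<rightarrow>\<^sub>E Collect maya) (\<lambda>g. \<Sum>r<t div 2. ?w r (g r))"
    using gf_PiE[of ?I "\<lambda>_. Collect maya" ?w ?c] r_gf(2) by auto
  have "gf self_conjugate_partitions sum_list (\<lambda>\<mu>. b powi BG_rank \<mu> * (\<Prod>h\<in>#hooks_div t \<mu>. f h)) =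
    gf self_conjugate_partitions ((\<lambda>g. \<Sum>r<t div 2. ?w r (g r)) \<circ> ?h) ((\<lambda>g. \<Prod>r<t div 2. ?c r (g r)) \<circ> ?h)"
    by (rule gf_cong[symmetric]) (rule weight coeff, assumption)+
  also have "\<dots> = (\<Prod>r<t div 2. gf (Collect maya) (?w r) (?c r))"
    unfolding gf_bij_betw[OF bij, symmetric] by (rule PiE)
  also have "\<dots> = (\<Prod>r<t div 2. theta b t r * gf UNIV (\<lambda>n. 2 * t * n) C)"
    by (intro prod.cong refl r_gf(1))
  also have "\<dots> = (\<Prod>r<t div 2. theta b t r) * gf UNIV (\<lambda>n. 2 * t * n) C ^ (t div 2)"
    by (simp add: prod.distrib)
  finally show "gf self_conjugate_partitions sum_list (\<lambda>\<mu>. b powi BG_rank \<mu> * (\<Prod>h\<in>#hooks_div t \<mu>. f h)) =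
      (\<Prod>r<t div 2. theta b t r) * gf UNIV (\<lambda>n. 2 * t * n) C ^ (t div 2)" .
  have "fin_graded self_conjugate_partitions ((\<lambda>g. \<Sum>r<t div 2. ?w r (g r)) \<circ> ?h)"
    using fin unfolding fin_graded_bij_betw[OF bij] .
  moreover have "{\<mu> \<in> self_conjugate_partitions. ((\<lambda>g. \<Sum>r<t div 2. ?w r (g r)) \<circ> ?h) \<mu> = n} =
      {\<mu> \<in> self_conjugate_partitions. sum_list \<mu> = n}" for n
    using weight by auto
  ultimately show "fin_graded self_conjugate_partitions sum_list" unfolding fin_graded_def by simp
qed

text \<open>Read off from the diagonal hooks: \<open>d\<close> contributes \<open>2 * d + 1\<close>
  to the size and \<open>(-1) ^ d\<close> to the BG-rank.\<close>

lemma gf_self_conjugate_BG_rank: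
  fixes b :: "'a::field"
  assumes "b \<noteq> 0"
  shows "gf self_conjugate_partitions sum_list (\<lambda>\<mu>. b powi BG_rank \<mu>) =
    qpoch_inf (- (fps_const b * fps_X)) (fps_X ^ 4) * qpoch_inf (- (fps_const (inverse b) * fps_X ^ 3)) (fps_X ^ 4)"
proof -
  let ?h = "(\<lambda>S. {d. int d \<in> S}) \<circ> maya_of"
  have bij: "bij_betw ?h self_conjugate_partitions {D. finite D}"
    by (rule bij_betw_trans[OF bij_betw_maya_of bij_betw_sym_mayas])
  show ?thesis
    unfolding qpoch_inf_odd_parts gf_bij_betw[OF bij]
  proof (rule gf_cong)
    fix \<mu> assume "\<mu> \<in> self_conjugate_partitions"
    then have \<mu>: "is_partition \<mu>" "maya_of \<mu> \<in> sym_mayas"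
      using bij_betw_maya_of by (auto simp: self_conjugate_partitions_def bij_betw_def)
    have "int (sum_list \<mu>) = int (\<Sum>d\<in>?h \<mu>. 2 * d + 1)"
      unfolding sum_list_eq_rsum[OF \<mu>(1)] rsum_sym_mayas[OF \<mu>(2)] by (simp add: algebra_simps)
    then show "sum_list \<mu> = ((\<lambda>D. \<Sum>d\<in>D. 2 * d + 1) \<circ> ?h) \<mu>" by (simp only: of_nat_eq_iff) simp
    have "BG_rank \<mu> = (\<Sum>d\<in>?h \<mu>. (-1) ^ d)"
      unfolding BG_rank_eq_rsum[OF \<mu>(1)] rsum_sym_mayas[OF \<mu>(2)] by (auto intro!: sum.cong)
    then have "b powi BG_rank \<mu> = (\<Prod>d\<in>?h \<mu>. b powi ((-1) ^ d))"
      by (simp only: power_int_sum[OF assms])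
    also have "\<dots> = (\<Prod>d\<in>?h \<mu>. if even d then b else inverse b)"
      by (intro prod.cong refl) (simp add: power_int_minus)
    finally show "b powi BG_rank \<mu> = ((\<lambda>D. \<Prod>d\<in>D. if even d then b else inverse b) \<circ> ?h) \<mu>" by simp
  qed
qed

text \<open>Instead of Jacobi's triple product, the product of the theta series is read off from the
  factorisation with all hook weights equal to 1.\<close>

lemma prod_theta:
  fixes b :: "'a::field"
  assumes t: "even t" "t > 0" and b: "b \<noteq> 0"
  shows "(\<Prod>r<t div 2. theta b t r) =
    qpoch_inf (fps_X ^ (2 * t)) (fps_X ^ (2 * t)) ^ (t div 2) *
    (qpoch_inf (- (fps_const b * fps_X)) (fps_X ^ 4) * qpoch_inf (- (fps_const (inverse b) * fps_X ^ 3)) (fps_X ^ 4))"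
proof -
  define C where "C = (\<lambda>n. of_nat (card (beta_sets n n)) :: 'a)"
  have hs: "(\<Sum>S\<in>mayas c n. hooks_prod (\<lambda>h. 1 ^ 2) S) = C n" for c n
  proof -
    obtain k where "k > n" "(\<Sum>S\<in>mayas c n. hooks_prod (\<lambda>h. 1 :: 'a) S) = hook_sum (\<lambda>h. 1) k n"
      by (rule sum_hooks_prod_mayas)
    then show ?thesis using card_beta_sets_stable[of n n k] by (simp add: hook_sum_one C_def)
  qed
  let ?P = "gf UNIV (\<lambda>n. 2 * t * n) C" and ?Q = "qpoch_inf (fps_X ^ (2 * t)) (fps_X ^ (2 * t)) :: 'a fps"
  have t2: "2 * t > 0" using t by simp
  have "?P * ?Q = 1"
    unfolding gf_multiples(1)[OF t2] by (rule euler_partition_identity[OF t2]) (auto simp: C_def)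
  then have PQ: "?P ^ (t div 2) * ?Q ^ (t div 2) = 1" by (simp add: power_mult_distrib[symmetric])
  have "gf self_conjugate_partitions sum_list (\<lambda>\<mu>. b powi BG_rank \<mu>) = (\<Prod>r<t div 2. theta b t r) * ?P ^ (t div 2)"
    using gf_self_conjugate(1)[OF t b, of "\<lambda>_. 1" C] hs by simp
  then have "?Q ^ (t div 2) * gf self_conjugate_partitions sum_list (\<lambda>\<mu>. b powi BG_rank \<mu>) =
      (\<Prod>r<t div 2. theta b t r) * (?P ^ (t div 2) * ?Q ^ (t div 2))"
    by (simp only: mult_ac)
  then show ?thesis unfolding PQ gf_self_conjugate_BG_rank[OF b] by simp
qed

section \<open>Scalars, stability in the number of beads, and the final specialisation\<close>

lemma scalar_mult: "scalar (a * b) = scalar a * scalar b"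
  by simp

lemma scalar_add: "scalar (a + b) = scalar a + scalar b"
  by (simp add: fls_plus_const)

lemma scalar_prod: "scalar (\<Prod>i\<in>I. g i) = (\<Prod>i\<in>I. scalar (g i))"
  by (induction I rule: infinite_finite_induct) (simp_all add: scalar_mult del: fls_const_mult_const)

lemma scalar_sum: "scalar (\<Sum>i\<in>I. g i) = (\<Sum>i\<in>I. scalar (g i))"
  by (induction I rule: infinite_finite_induct) (simp_all add: scalar_add)

lemma scalar_of_nat: "scalar (of_nat n) = of_nat n"
  by (simp add: fls_of_nat)

lemma prod_mset_scalar: "(\<Prod>h\<in>#M. x * scalar (g h)) = x ^ size M * scalar (\<Prod>h\<in>#M. g h)"
  by (induction M) (simp_all add: scalar_mult mult_ac del: fls_const_mult_const)

lemma hooks_prod_scalar: "hooks_prod (\<lambda>h. \<kappa> * scalar (g h)) S = \<kappa> ^ card (hooks S) * scalar (hooks_prod g S)"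
  by (simp add: hooks_prod_def prod.distrib scalar_prod case_prod_unfold)

text \<open>Neither the recurrence nor the initial value 1 mentions \<open>k\<close>, so they
  determine the same numbers for all \<open>k > n\<close>.\<close>

lemma hook_sum_han_weight_stable:
  assumes w: "\<And>h. h > 0 \<Longrightarrow> w ^ h \<noteq> 1" and "n < k"
  shows "hook_sum (han_weight w) k n = hook_sum (han_weight w) (Suc n) n"
  using assms(2)
proof (induction n arbitrary: k rule: less_induct)
  case (less n)
  show ?case
  proof (cases n)
    case (Suc m)
    have "of_nat (Suc m) * hook_sum (han_weight w) k (Suc m) = of_nat (Suc m) * hook_sum (han_weight w) (Suc n) (Suc m)"
    proof -
      have "hook_sum (han_weight w) k m = hook_sum (han_weight w) (Suc n) m"
        using less Suc by (metis lessI less_SucI Suc_lessD)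
      moreover have "(case m of 0 \<Rightarrow> 0 | Suc m \<Rightarrow> hook_sum (han_weight w) k m) =
        (case m of 0 \<Rightarrow> 0 | Suc m \<Rightarrow> hook_sum (han_weight w) (Suc n) m)"
      proof (cases m)
        case (Suc l)
        then have "l < n" "l < k" "l < Suc n" using \<open>n = Suc m\<close> less.prems by auto
        then show ?thesis using less.IH[of l k] less.IH[of l "Suc n"] Suc by simp
      qed simp
      ultimately show ?thesis
        using hook_sum_rec[OF w, of m k] hook_sum_rec[OF w, of m "Suc n"] Suc less.prems by simp
    qed
    moreover have "of_nat (Suc m) \<noteq> (0 :: complex)" by (simp only: of_nat_eq_0_iff)
    ultimately show ?thesis using Suc by (metis mult_left_cancel)
  qed (simp add: hook_sum_0)
qed

text \<open>Used with \<open>h = t / 2\<close>: the outer factor \<open>h\<close> comes from the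
  power \<open>t / 2\<close> of the series, and \<open>1 / (2 * h)\<close> is the
  \<open>1 / t\<close> split off from the hook lengths.\<close>

lemma half_power_coeffs:
  fixes h :: "'a::field_char_0"
  assumes "h \<noteq> 0"
  shows "h * (x ^ 2 * (1 / (2 * h)) * s) = s * x ^ 2 / 2"
    and "h * ((x ^ 2 * (1 / (2 * h))) ^ 2 / 2) = x ^ 4 / (4 * (2 * h))"
  using assms by (simp_all add: power_mult_distrib power_divide power2_eq_square power4_eq_xxxx)

theorem corollary4p3:
  fixes t :: nat and z :: complex
  assumes "even t" and "t > 0"
    and "\<And>h. h > 0 \<Longrightarrow> t dvd h \<Longrightarrow> z ^ h \<noteq> 1"
  shows
    "((\<lambda>\<mu>.
        var_q ^ sum_list \<mu> *
        fps_const
          (var_x ^ size (hooks_div t \<mu>) *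
           var_b powi BG_rank \<mu> *
           scalar (\<Prod>h\<in>#hooks_div t \<mu>. csqrt (1 / of_nat h * ((1 + z ^ h) / (1 - z ^ h))))))
      has_sum
        (qpoch_inf (var_q ^ (2 * t)) (var_q ^ (2 * t)) ^ (t div 2) *
         qpoch_inf (- (fps_const var_b * var_q)) (var_q ^ 4) *
         qpoch_inf (- (fps_const (inverse var_b) * var_q ^ 3)) (var_q ^ 4) *
         exp_series
           (fps_const (scalar ((1 + z ^ t) / (1 - z ^ t)) * var_x ^ 2 / 2) * var_q ^ (2 * t) +
            fps_const (var_x ^ 4 / (4 * of_nat t)) * var_q ^ (4 * t))))
     self_conjugate_partitions"
proof -
  note t = \<open>even t\<close> \<open>t > 0\<close>
  define w where "w = z ^ t"
  define v where "v = (\<lambda>h. 1 / of_nat h * ((1 + z ^ h) / (1 - z ^ h)))"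
  \<comment> \<open>Hooks come in pairs, so only squares of \<open>f\<close> enter and the branch
    chosen by \<open>csqrt\<close> does not matter.\<close>
  define f where "f = (\<lambda>h. var_x * scalar (csqrt (v h)))"
  \<comment> \<open>A pair of hooks of length \<open>t * h\<close> carries
    \<open>x ^ 2 / (t * h)\<close>; the part \<open>1 / h\<close> stays in
    \<open>han_weight\<close>.\<close>
  define \<kappa> where "\<kappa> = var_x ^ 2 * scalar (1 / of_nat t)"
  \<comment> \<open>\<open>Suc n\<close> is the least number of beads in the stable range.\<close>
  define C where "C = (\<lambda>n. \<kappa> ^ n * scalar (hook_sum (han_weight w) (Suc n) n))"
  define \<alpha> where "\<alpha> = \<kappa> * scalar (hyp w 1)"
  have w: "w ^ h \<noteq> 1" if "h > 0" for h
    using assms(3)[of "t * h"] that t by (simp add: w_def power_mult)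
  have f_sq: "f (t * h) ^ 2 = \<kappa> * scalar (han_weight w h)" for h
  proof -
    have "v (t * h) = 1 / of_nat t * han_weight w h"
      by (simp add: v_def han_weight_def lin_def hyp_def w_def power_mult)
    then have "f (t * h) ^ 2 = var_x ^ 2 * scalar (1 / of_nat t * han_weight w h)"
      by (simp only: f_def power_mult_distrib fls_const_power[symmetric] power2_csqrt)
    then show ?thesis by (simp only: \<kappa>_def scalar_mult mult.assoc)
  qed
  have C_eq: "(\<Sum>S\<in>mayas c n. hooks_prod (\<lambda>h. f (t * h) ^ 2) S) = C n" for c n
  proof -
    obtain k where k: "k > n" "(\<Sum>S\<in>mayas c n. hooks_prod (han_weight w) S) = hook_sum (han_weight w) k n"
      by (rule sum_hooks_prod_mayas)
    have "(\<Sum>S\<in>mayas c n. hooks_prod (\<lambda>h. f (t * h) ^ 2) S) =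
        (\<Sum>S\<in>mayas c n. \<kappa> ^ n * scalar (hooks_prod (han_weight w) S))"
      unfolding f_sq hooks_prod_scalar by (intro sum.cong refl) (auto simp: mayas_def)
    also have "\<dots> = \<kappa> ^ n * scalar (hook_sum (han_weight w) k n)"
      by (simp only: sum_distrib_left[symmetric] scalar_sum[symmetric] k(2))
    finally show ?thesis using hook_sum_han_weight_stable[OF w k(1)] by (simp only: C_def)
  qed
  have "Abs_fps C = exp_series (fps_const \<alpha> * fps_X + fps_const (\<kappa> ^ 2 / 2) * fps_X ^ 2)"
  proof (rule fps_eq_exp_quadratic)
    show "fps_nth (Abs_fps C) 0 = 1" by (simp add: C_def hook_sum_0)
    fix n
    let ?e = "\<lambda>n. hook_sum (han_weight w) (Suc n) n"
    have rec: "of_nat (Suc n) * ?e (Suc n) = hyp w 1 * ?e n + (case n of 0 \<Rightarrow> 0 | Suc m \<Rightarrow> ?e m)"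
      using hook_sum_rec[OF w, of n "Suc (Suc n)"] hook_sum_han_weight_stable[OF w, of n "Suc (Suc n)"]
        hook_sum_han_weight_stable[OF w, of "n - 1" "Suc (Suc n)"] by (cases n) simp_all
    have "of_nat (Suc n) * C (Suc n) = \<kappa> ^ Suc n * scalar (of_nat (Suc n) * ?e (Suc n))"
      by (simp only: C_def scalar_mult scalar_of_nat mult_ac)
    also have "\<dots> = \<alpha> * C n + (case n of 0 \<Rightarrow> 0 | Suc m \<Rightarrow> \<kappa> ^ 2 * C m)"
    proof -
      have "scalar (of_nat (Suc n) * ?e (Suc n)) = scalar (hyp w 1) * scalar (?e n) + (case n of 0 \<Rightarrow> 0 | Suc m \<Rightarrow> scalar (?e m))"
        unfolding rec by (cases n) (simp_all only: nat.case scalar_add scalar_mult fls_const_0)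
      then show ?thesis
        unfolding \<alpha>_def C_def by (cases n) (simp_all add: algebra_simps power2_eq_square del: fls_const_mult_const)
    qed
    finally show "of_nat (Suc n) * fps_nth (Abs_fps C) (Suc n) = \<alpha> * fps_nth (Abs_fps C) n +
        (case n of 0 \<Rightarrow> 0 | Suc m \<Rightarrow> \<kappa> ^ 2 * fps_nth (Abs_fps C) m)"
      by (simp only: fps_nth_Abs_fps)
  qed
  moreover have y0: "fps_nth (var_q ^ (2 * t)) 0 = 0" using t by simp
  ultimately have "gf UNIV (\<lambda>n. 2 * t * n) C =
      exp_series ((fps_const \<alpha> * fps_X + fps_const (\<kappa> ^ 2 / 2) * fps_X ^ 2) oo fps_X ^ (2 * t))"
    using t by (simp add: gf_multiples(1) exp_series_compose)
  also have "(fps_const \<alpha> * fps_X + fps_const (\<kappa> ^ 2 / 2) * fps_X ^ 2) oo fps_X ^ (2 * t) =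
     fps_const \<alpha> * var_q ^ (2 * t) + fps_const (\<kappa> ^ 2 / 2) * var_q ^ (4 * t)"
  proof -
    have "(var_q ^ (2 * t)) ^ 2 = var_q ^ (4 * t)" by (simp flip: power_mult)
    then show ?thesis
      by (simp only: fps_compose_add_distrib fps_compose_mult_distrib[OF y0] fps_const_compose
          fps_X_power_compose[OF y0] fps_X_fps_compose_startby0[OF y0])
  qed
  finally have "gf UNIV (\<lambda>n. 2 * t * n) C ^ (t div 2) =
      exp_series (of_nat (t div 2) * (fps_const \<alpha> * var_q ^ (2 * t) + fps_const (\<kappa> ^ 2 / 2) * var_q ^ (4 * t)))"
    using t by (simp add: exp_series_power)
  also have "of_nat (t div 2) * (fps_const \<alpha> * var_q ^ (2 * t) + fps_const (\<kappa> ^ 2 / 2) * var_q ^ (4 * t)) =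
    fps_const (scalar ((1 + z ^ t) / (1 - z ^ t)) * var_x ^ 2 / 2) * var_q ^ (2 * t) +
            fps_const (var_x ^ 4 / (4 * of_nat t)) * var_q ^ (4 * t)"
  proof -
    let ?H = "of_nat (t div 2) :: coeff_field"
    have H: "of_nat t = 2 * ?H" "?H \<noteq> 0" using t by (auto elim!: evenE)
    have "scalar (1 / of_nat t) = 1 / (2 * ?H)"
      unfolding H(1)[symmetric] by (simp only: fls_const_divide_const[symmetric] fls_const_1 scalar_of_nat)
    then have \<kappa>: "\<kappa> = var_x ^ 2 * (1 / (2 * ?H))" by (simp only: \<kappa>_def)
    note coeffs = half_power_coeffs[OF H(2), of "var_x", folded \<kappa>]
    have "hyp w 1 = (1 + z ^ t) / (1 - z ^ t)" by (simp add: hyp_def w_def)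
    then have "?H * \<alpha> = scalar ((1 + z ^ t) / (1 - z ^ t)) * var_x ^ 2 / 2"
      "?H * (\<kappa> ^ 2 / 2) = var_x ^ 4 / (4 * of_nat t)"
      using coeffs by (simp_all only: H(1) \<alpha>_def)
    then show ?thesis
      by (simp only: distrib_left fps_of_nat[symmetric] mult.assoc[symmetric] fps_const_mult)
  qed
  finally have E: "gf UNIV (\<lambda>n. 2 * t * n) C ^ (t div 2) = exp_series
      (fps_const (scalar ((1 + z ^ t) / (1 - z ^ t)) * var_x ^ 2 / 2) * var_q ^ (2 * t) +
            fps_const (var_x ^ 4 / (4 * of_nat t)) * var_q ^ (4 * t))" .
  have "var_b \<noteq> (0 :: coeff_field)" by simp
  note gf = gf_self_conjugate[OF t this C_eq]
  have coeff: "var_b powi BG_rank \<mu> * (\<Prod>h\<in>#hooks_div t \<mu>. f h) =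
      var_x ^ size (hooks_div t \<mu>) * var_b powi BG_rank \<mu> * scalar (\<Prod>h\<in>#hooks_div t \<mu>. csqrt (v h))" for \<mu>
    by (simp only: f_def prod_mset_scalar mult_ac)
  show ?thesis
    using has_sum_gf[OF gf(2), of "\<lambda>\<mu>. var_b powi BG_rank \<mu> * (\<Prod>h\<in>#hooks_div t \<mu>. f h)"]
    unfolding gf(1) E prod_theta[OF t \<open>var_b \<noteq> 0\<close>] unfolding coeff v_def mult.assoc .
qed

end
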